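(* (Local bifurcation from one-dimensional kernel.) Let $g,h,B,\sigma>0$, $A\in\mathbb{R}$, $\alpha\in(0,1)$, let $\beta\in\mathbb{R}$, and let $F(\lambda,(\mu,w))$, $X$, $Y$, $T_n$ and $\lambda_{n,\pm}^*$ be as in the context. For any $\lambda\in\mathbb{R}\setminus\{\lambda_{n,\pm}^*: n\in\mathbb{N}^+\}$, the solutions of $F(\lambda,(\mu,w))=0$ are trivial. For $\lambda=\lambda_{n,\pm}^*$ and each choice of sign $\pm$, there exists in the space $\mathbb{R}\times(\mathbb{R}\times X)$ a continuous solution curve $$\mathcal{K}_{n,\pm}=\{(\lambda_{n,\pm}(s),(\mu(s),w(s))): s\in\mathbb{R}\}$$ of $F(\lambda,(\mu,w))=0$ satisfying: (i) $(\lambda_{n,\pm}(0),(\mu(0),w(0)))=(\lambda_{n,\pm}^*,(0,0))$; (ii) $w(s)=s\,w^*+o(s)$ for $0\le|s|<\varepsilon$, where $w^*=\cos(nx)$ and $\varepsilon>0$ is sufficiently small; (iii) there exist a neighbourhood $\mathcal{U}_{n,\pm}$ of $(\lambda_{n,\pm}^*,(0,0))$ in $\mathbb{R}\times(\mathbb{R}\times X)$ and $\varepsilon>0$ sufficiently small such that $$\{(\lambda,(\mu,w))\in\mathcal{U}_{n,\pm}: F(\lambda,(\mu,w))=0\}=\{(\lambda_{n,\pm}(s),(\mu(s),w(s))): 0\le|s|<\varepsilon\}.$$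
   Context: For a $2\pi$-periodic function $f$, $[f]$ denotes its mean over one period. For $u\in L^2_{2\pi}$ with $[u]=0$ and Fourier expansion $u(x)=\sum_{k\ge1}a_k\cos(kx)+\sum_{k\ge1}b_k\sin(kx)$, the periodic Hilbert transform for the strip of depth $h$ is $$\mathcal{C}_h(u)(x)=\sum_{k\ge1}a_k\coth(kh)\sin(kx)-\sum_{k\ge1}b_k\coth(kh)\cos(kx).$$ $C^{k,\alpha}_{2\pi,e}(\mathbb{R})$ is the space of even, $2\pi$-periodic $C^{k,\alpha}$ functions. Put $X=\{w\in C^{2,\alpha}_{2\pi,e}(\mathbb{R}):[w]=0\}$ and $Y=C^{0,\alpha}_{2\pi,e}(\mathbb{R})$. For $\lambda,\mu\in\mathbb{R}$ and $w\in X$ (with $(1+\mathcal{C}_h(w'))^2+w'^2\neq0$ everywhere) define $$F(\lambda,(\mu,w))=\Big(\lambda-\beta\big(\tfrac{[w^2]}{2h}-w+\mathcal{C}_h(ww')-w\,\mathcal{C}_h(w')\big)-\tfrac{gA}{2}\big(\tfrac{[w^3]}{3h}-[w^2]-w^2-2hw+\mathcal{C}_h(w^2w')-w^2\mathcal{C}_h(w')+2h\,\mathcal{C}_h(ww')-2hw\,\mathcal{C}_h(w')\big)\Big)^2$$ $$-(\lambda^2+\mu-2gBw)\big(w'^2+(1+\mathcal{C}_h(w'))^2\big)-2\sigma\,\frac{w''+\mathcal{C}_h(w')w''-w'\mathcal{C}_h(w'')}{\big((1+\mathcal{C}_h(w'))^2+w'^2\big)^{1/2}}\in Y.$$ One has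 $F(\lambda,(0,0))=0$ for every $\lambda\in\mathbb{R}$; the solutions $(\lambda,(0,0))$ are the trivial solutions. For integers $n\ge1$ set $T_n=\tanh(nh)/n$ and $$\lambda_{n,\pm}^*=\frac{\beta+Agh}{2}T_n\pm\sqrt{\frac{(\beta+Agh)^2}{4}T_n^2+(gB+\sigma n^2)T_n}.$$
   Formalization: The curve is stated when the kernel of the linearization at the bifurcation value is one-dimensional; for other λ, triviality is claimed only near (λ,(0,0)); in (iii) the zeros in the neighbourhood are the curve together with the trivial solutions there. *)

theory Defs
  imports "HOL-Analysis.Analysis" "HOL-Library.Landau_Symbols"
begin

section \<open>Even periodic Hoelder spaces\<close>

definition mean :: "(real \<Rightarrow> real) \<Rightarrow> real" where
  "mean f = integral {-pi..pi} f / (2 * pi)"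

text \<open>By periodicity a global Hoelder bound is equivalent to a local one. It implies the continuity clause
  when \<open>0 < \<alpha>\<close>.\<close>

definition hoelder_space :: "nat \<Rightarrow> real \<Rightarrow> (real \<Rightarrow> real) set" where
  "hoelder_space k \<alpha> = {f.
     (\<forall>x. f (- x) = f x) \<and> (\<forall>x. f (x + 2 * pi) = f x) \<and>
     (\<forall>j<k. \<forall>x. (deriv ^^ j) f field_differentiable at x) \<and>
     continuous_on UNIV ((deriv ^^ k) f) \<and>
     (\<exists>C. \<forall>x y. \<bar>(deriv ^^ k) f x - (deriv ^^ k) f y\<bar> \<le> C * \<bar>x - y\<bar> powr \<alpha>)}"

definition hoelder_norm :: "nat \<Rightarrow> real \<Rightarrow> (real \<Rightarrow> real) \<Rightarrow> real" where
  "hoelder_norm k \<alpha> f = (\<Sum>j\<le>k. SUP x. \<bar>(deriv ^^ j) f x\<bar>) +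
     (SUP (x, y) \<in> {(x, y). x \<noteq> y}.
        \<bar>(deriv ^^ k) f x - (deriv ^^ k) f y\<bar> / \<bar>x - y\<bar> powr \<alpha>)"

definition X_space :: "real \<Rightarrow> (real \<Rightarrow> real) set" where
  "X_space \<alpha> = {w \<in> hoelder_space 2 \<alpha>. mean w = 0}"

text \<open>The library's \<open>Metric_space\<close> asks for nonnegativity and symmetry off the carrier too, hence
  the value \<open>0\<close> there.\<close>

definition X_dist :: "real \<Rightarrow> (real \<Rightarrow> real) \<Rightarrow> (real \<Rightarrow> real) \<Rightarrow> real" where
  "X_dist \<alpha> v w =
     (if v \<in> X_space \<alpha> \<and> w \<in> X_space \<alpha> then hoelder_norm 2 \<alpha> (\<lambda>x. v x - w x) else 0)"

definition RRX_topology :: "real \<Rightarrow> (real \<times> real \<times> (real \<Rightarrow> real)) topology" where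
  "RRX_topology \<alpha> = prod_topology euclideanreal
     (prod_topology euclideanreal (Metric_space.mtopology (X_space \<alpha>) (X_dist \<alpha>)))"

lemma hoelder_diff:
  assumes "f \<in> hoelder_space k \<alpha>" "g \<in> hoelder_space k \<alpha>" "j \<le> k"
  shows "(deriv ^^ j) (\<lambda>x. f x - g x) = (\<lambda>x. (deriv ^^ j) f x - (deriv ^^ j) g x)"
  using assms(3)
proof (induction j)
  case (Suc j)
  have "deriv (\<lambda>x. (deriv ^^ j) f x - (deriv ^^ j) g x) x
          = deriv ((deriv ^^ j) f) x - deriv ((deriv ^^ j) g) x" for x
    using assms(1,2) Suc.prems by (intro deriv_diff) (auto simp: hoelder_space_def)
  with Suc show ?case by auto
qed simp

lemma hoelder_deriv_periodic:
  assumes "f \<in> hoelder_space k \<alpha>" "j \<le> k"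
  shows "(deriv ^^ j) f (x + 2 * pi) = (deriv ^^ j) f x"
  using assms(2)
proof (induction j arbitrary: x)
  case 0
  then show ?case using assms(1) by (simp add: hoelder_space_def)
next
  case (Suc j)
  let ?F = "(deriv ^^ j) f"
  have d: "\<And>y. (?F has_field_derivative deriv ?F y) (at y)"
    using assms(1) Suc.prems by (auto simp: hoelder_space_def field_differentiable_derivI)
  have "((\<lambda>y. ?F (y + 2 * pi)) has_field_derivative deriv ?F (x + 2 * pi)) (at x)"
    by (rule DERIV_shift[THEN iffD1]) (rule d)
  moreover have "(\<lambda>y. ?F (y + 2 * pi)) = ?F" using Suc by auto
  ultimately show ?case using DERIV_imp_deriv by force
qed

lemma hoelder_deriv_continuous:
  assumes "f \<in> hoelder_space k \<alpha>" "j \<le> k"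
  shows "continuous_on UNIV ((deriv ^^ j) f)"
proof (cases "j = k")
  case False
  with assms show ?thesis
    by (auto simp: hoelder_space_def intro!: continuous_at_imp_continuous_on
        field_differentiable_imp_continuous_at)
qed (use assms in \<open>auto simp: hoelder_space_def\<close>)

lemma hoelder_deriv_bdd:
  assumes "f \<in> hoelder_space k \<alpha>" "j \<le> k"
  shows "\<exists>M. \<forall>x. \<bar>(deriv ^^ j) f x\<bar> \<le> M"
proof -
  let ?F = "(deriv ^^ j) f"
  have per: "?F (x + of_int n * (2 * pi)) = ?F x" for x n
  proof (induction n arbitrary: x rule: int_induct[where k = 0])
    case (step1 i)
    have "x + of_int (i + 1) * (2 * pi) = (x + of_int i * (2 * pi)) + 2 * pi"
      by (simp add: algebra_simps)
    with step1 show ?case using hoelder_deriv_periodic[OF assms] by metis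
  next
    case (step2 i)
    have "x + of_int i * (2 * pi) = (x + of_int (i - 1) * (2 * pi)) + 2 * pi"
      by (simp add: algebra_simps)
    with step2 show ?case using hoelder_deriv_periodic[OF assms] by metis
  qed simp
  have "continuous_on {0..2*pi} ?F"
    using hoelder_deriv_continuous[OF assms] continuous_on_subset by blast
  then have "bounded (?F ` {0..2*pi})"
    by (intro compact_imp_bounded compact_continuous_image) auto
  then obtain M where M: "\<And>x. x \<in> {0..2*pi} \<Longrightarrow> \<bar>?F x\<bar> \<le> M"
    unfolding bounded_iff by (metis imageI real_norm_def)
  have "\<bar>?F x\<bar> \<le> M" for x
  proof -
    define n where "n = \<lfloor>x / (2 * pi)\<rfloor>"
    have "of_int n \<le> x / (2 * pi)" "x / (2 * pi) \<le> of_int n + 1"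
      unfolding n_def by linarith+
    then have "x + of_int (- n) * (2 * pi) \<in> {0..2*pi}"
      by (auto simp: field_simps)
    from M[OF this] show ?thesis by (simp only: per)
  qed
  then show ?thesis by blast
qed

lemma Metric_space_X: "Metric_space (X_space \<alpha>) (X_dist \<alpha>)"
proof -
  let ?S = "X_space \<alpha>"
  have sub: "?S \<subseteq> hoelder_space 2 \<alpha>" by (auto simp: X_space_def)
  let ?D = "\<lambda>j f. (deriv ^^ j) f"
  let ?P = "{(x, y). x \<noteq> (y :: real)}"
  define N where "N j f g = (SUP x. \<bar>?D j f x - ?D j g x\<bar>)" for j and f g :: "real \<Rightarrow> real"
  define Q where "Q f g p = (case p of (x, y) \<Rightarrow>
      \<bar>(?D 2 f x - ?D 2 g x) - (?D 2 f y - ?D 2 g y)\<bar> / \<bar>x - y\<bar> powr \<alpha>)" for f g p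
  define H where "H f g = (SUP p \<in> ?P. Q f g p)" for f g
  have "(0, 1) \<in> ?P" by simp
  then have ne: "?P \<noteq> {}" by blast
  have dist: "X_dist \<alpha> f g = (\<Sum>j\<le>2. N j f g) + H f g"
    if "f \<in> ?S" "g \<in> ?S" for f g
  proof -
    have fg: "f \<in> hoelder_space 2 \<alpha>" "g \<in> hoelder_space 2 \<alpha>" using that sub by auto
    show ?thesis
      unfolding X_dist_def hoelder_norm_def N_def H_def Q_def
      using that by (simp add: hoelder_diff[OF fg] case_prod_beta)
  qed
  have bddN: "bdd_above (range (\<lambda>x. \<bar>?D j f x - ?D j g x\<bar>))"
    if fg: "f \<in> ?S" "g \<in> ?S" "j \<le> 2" for f g j
  proof -
    obtain M1 M2 where "\<forall>x. \<bar>?D j f x\<bar> \<le> M1" "\<forall>x. \<bar>?D j g x\<bar> \<le> M2"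
      using hoelder_deriv_bdd[OF subsetD[OF sub fg(1)] fg(3)]
        hoelder_deriv_bdd[OF subsetD[OF sub fg(2)] fg(3)] by blast
    then have "\<bar>?D j f x - ?D j g x\<bar> \<le> M1 + M2" for x
      by (meson abs_triangle_ineq4 add_mono order_trans)
    then show ?thesis by (intro bdd_aboveI[of _ "M1 + M2"]) auto
  qed
  have hoe: "\<exists>C. \<forall>x y. \<bar>?D 2 f x - ?D 2 f y\<bar> \<le> C * \<bar>x - y\<bar> powr \<alpha>" if "f \<in> ?S" for f
    using subsetD[OF sub that] by (simp add: hoelder_space_def)
  have bddQ: "bdd_above (Q f g ` ?P)" if fg: "f \<in> ?S" "g \<in> ?S" for f g
  proof -
    obtain C1 C2 where C: "\<And>x y. \<bar>?D 2 f x - ?D 2 f y\<bar> \<le> C1 * \<bar>x - y\<bar> powr \<alpha>"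
      "\<And>x y. \<bar>?D 2 g x - ?D 2 g y\<bar> \<le> C2 * \<bar>x - y\<bar> powr \<alpha>"
      using hoe[OF fg(1)] hoe[OF fg(2)] by metis
    have "Q f g p \<le> C1 + C2" if "p \<in> ?P" for p
    proof -
      obtain x y where p: "p = (x, y)" "x \<noteq> y" using \<open>p \<in> ?P\<close> by auto
      have "\<bar>(?D 2 f x - ?D 2 g x) - (?D 2 f y - ?D 2 g y)\<bar> \<le> (C1 + C2) * \<bar>x - y\<bar> powr \<alpha>"
        using C(1)[of x y] C(2)[of x y] by (simp add: distrib_right)
      then show ?thesis using p by (simp add: Q_def divide_le_eq)
    qed
    then show ?thesis by (intro bdd_aboveI[of _ "C1 + C2"]) auto
  qed
  have N0: "0 \<le> N j f g" if "f \<in> ?S" "g \<in> ?S" "j \<le> 2" for f g j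
    unfolding N_def by (rule cSUP_upper2[OF bddN[OF that], of 0]) auto
  have Q0: "0 \<le> Q f g p" for f g p
    by (cases p) (simp add: Q_def)
  have H0: "0 \<le> H f g" if "f \<in> ?S" "g \<in> ?S" for f g
    unfolding H_def by (rule cSUP_upper2[OF bddQ[OF that], of "(0, 1)"]) (auto simp: Q0)
  have Nt: "N j f e \<le> N j f g + N j g e" if "f \<in> ?S" "g \<in> ?S" "e \<in> ?S" "j \<le> 2" for f g e j
    unfolding N_def
  proof (rule cSUP_least)
    fix x
    have "\<bar>?D j f x - ?D j e x\<bar> \<le> \<bar>?D j f x - ?D j g x\<bar> + \<bar>?D j g x - ?D j e x\<bar>" by simp
    also have "\<dots> \<le> (SUP x. \<bar>?D j f x - ?D j g x\<bar>) + (SUP x. \<bar>?D j g x - ?D j e x\<bar>)"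
      using that by (intro add_mono cSUP_upper bddN) auto
    finally show "\<bar>?D j f x - ?D j e x\<bar> \<le> \<dots>" .
  qed simp
  have Ht: "H f e \<le> H f g + H g e" if "f \<in> ?S" "g \<in> ?S" "e \<in> ?S" for f g e
    unfolding H_def
  proof (rule cSUP_least[OF ne])
    fix p assume p: "p \<in> ?P"
    have "Q f e p \<le> Q f g p + Q g e p"
      by (cases p) (auto simp: Q_def add_divide_distrib[symmetric] intro!: divide_right_mono)
    also have "\<dots> \<le> (SUP p \<in> ?P. Q f g p) + (SUP p \<in> ?P. Q g e p)"
      using that p by (intro add_mono cSUP_upper bddQ) auto
    finally show "Q f e p \<le> \<dots>" .
  qed
  have comm: "X_dist \<alpha> f g = X_dist \<alpha> g f" if "f \<in> ?S" "g \<in> ?S" for f g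
  proof -
    have "Q f g p = Q g f p" for p
      by (cases p) (simp add: Q_def abs_minus_commute algebra_simps)
    then have "H f g = H g f" by (simp add: H_def)
    moreover have "N j f g = N j g f" for j by (simp add: N_def abs_minus_commute)
    ultimately show ?thesis using that by (simp add: dist)
  qed
  have zero: "f = g" if fg: "f \<in> ?S" "g \<in> ?S" and z: "X_dist \<alpha> f g = 0" for f g
  proof -
    have "0 \<le> (\<Sum>j\<le>2. N j f g)" using N0 fg by (intro sum_nonneg) auto
    with H0[OF fg] z dist[OF fg] have "(\<Sum>j\<le>2. N j f g) = 0" by linarith
    then have "N 0 f g = 0" using N0 fg by (subst (asm) sum_nonneg_eq_0_iff) auto
    then have "\<bar>f x - g x\<bar> \<le> 0" for x
      using cSUP_upper[OF UNIV_I bddN[OF fg, of 0], of x] by (simp add: N_def)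
    then show ?thesis by auto
  qed
  have refl: "X_dist \<alpha> f f = 0" if "f \<in> ?S" for f
  proof -
    have "Q f f p = 0" for p by (cases p) (simp add: Q_def)
    then have "H f f = 0" using ne by (simp add: H_def)
    then show ?thesis using that by (simp add: dist N_def)
  qed
  have off: "X_dist \<alpha> f g = 0" if "f \<notin> ?S \<or> g \<notin> ?S" for f g
    using that by (auto simp: X_dist_def)
  show ?thesis
  proof
    show "0 \<le> X_dist \<alpha> f g" for f g
    proof (cases "f \<in> ?S \<and> g \<in> ?S")
      case True
      then have "0 \<le> (\<Sum>j\<le>2. N j f g)" using N0 by (intro sum_nonneg) auto
      with True H0[of f g] dist[of f g] show ?thesis by auto
    qed (use off in auto)
    show "X_dist \<alpha> f g = X_dist \<alpha> g f" for f g
      by (cases "f \<in> ?S \<and> g \<in> ?S") (auto simp: comm off)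
    show "X_dist \<alpha> f g = 0 \<longleftrightarrow> f = g" if "f \<in> ?S" "g \<in> ?S" for f g
      using that zero refl by blast
    show "X_dist \<alpha> f e \<le> X_dist \<alpha> f g + X_dist \<alpha> g e"
      if "f \<in> ?S" "g \<in> ?S" "e \<in> ?S" for f g e
    proof -
      have "(\<Sum>j\<le>2. N j f e) \<le> (\<Sum>j\<le>2. N j f g) + (\<Sum>j\<le>2. N j g e)"
        unfolding sum.distrib[symmetric] using that Nt by (intro sum_mono) auto
      with that Ht[OF that] show ?thesis by (simp add: dist)
    qed
  qed
qed

section \<open>The periodic Hilbert transform of a strip\<close>

definition fourier_cos :: "(real \<Rightarrow> real) \<Rightarrow> nat \<Rightarrow> real" where
  "fourier_cos u k = integral {-pi..pi} (\<lambda>x. u x * cos (real k * x)) / pi"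

definition fourier_sin :: "(real \<Rightarrow> real) \<Rightarrow> nat \<Rightarrow> real" where
  "fourier_sin u k = integral {-pi..pi} (\<lambda>x. u x * sin (real k * x)) / pi"

definition coth :: "real \<Rightarrow> real" where
  "coth x = cosh x / sinh x"

text \<open>On \<open>L\<^sup>2\<close> the series is an \<open>L\<^sup>2\<close> limit. On the \<open>\<alpha>\<close>-Hoelder functions with \<open>0 < \<alpha> < 1\<close>, the only
  arguments occurring below, it converges uniformly, so its pointwise sum is the continuous
  representative. The series start at \<open>k = 1\<close>, hence the successors.\<close>

definition hilbert_strip :: "real \<Rightarrow> (real \<Rightarrow> real) \<Rightarrow> real \<Rightarrow> real" where
  "hilbert_strip h u x =
     (\<Sum>k. fourier_cos u (Suc k) * coth (real (Suc k) * h) * sin (real (Suc k) * x)) -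
     (\<Sum>k. fourier_sin u (Suc k) * coth (real (Suc k) * h) * cos (real (Suc k) * x))"

section \<open>The nonlinear operator and its solutions\<close>

definition conf_factor :: "real \<Rightarrow> (real \<Rightarrow> real) \<Rightarrow> real \<Rightarrow> real" where
  "conf_factor h w x = (1 + hilbert_strip h (deriv w) x)\<^sup>2 + (deriv w x)\<^sup>2"

definition F_op :: "real \<Rightarrow> real \<Rightarrow> real \<Rightarrow> real \<Rightarrow> real \<Rightarrow> real \<Rightarrow>
    real \<Rightarrow> real \<Rightarrow> (real \<Rightarrow> real) \<Rightarrow> real \<Rightarrow> real" where
  "F_op g h A B \<beta> \<sigma> lam mu w x =
    (let C = hilbert_strip h; w' = deriv w; w'' = deriv (deriv w) in
     (lam
       - \<beta> * (mean (\<lambda>y. (w y)\<^sup>2) / (2 * h) - w x + C (\<lambda>y. w y * w' y) x - w x * C w' x)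
       - g * A / 2 *
          (mean (\<lambda>y. (w y) ^ 3) / (3 * h) - mean (\<lambda>y. (w y)\<^sup>2) - (w x)\<^sup>2 - 2 * h * w x
           + C (\<lambda>y. (w y)\<^sup>2 * w' y) x - (w x)\<^sup>2 * C w' x
           + 2 * h * C (\<lambda>y. w y * w' y) x - 2 * h * w x * C w' x))\<^sup>2
     - (lam\<^sup>2 + mu - 2 * g * B * w x) * ((w' x)\<^sup>2 + (1 + C w' x)\<^sup>2)
     - 2 * \<sigma> * ((w'' x + C w' x * w'' x - w' x * C w'' x) / sqrt (conf_factor h w x)))"

definition solutions :: "real \<Rightarrow> real \<Rightarrow> real \<Rightarrow> real \<Rightarrow> real \<Rightarrow> real \<Rightarrow> real \<Rightarrow>
    (real \<times> real \<times> (real \<Rightarrow> real)) set" where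
  "solutions g h A B \<beta> \<sigma> \<alpha> = {(lam, mu, w).
     w \<in> X_space \<alpha> \<and> (\<forall>x. conf_factor h w x \<noteq> 0) \<and> (\<forall>x. F_op g h A B \<beta> \<sigma> lam mu w x = 0)}"

definition trivial_solutions :: "(real \<times> real \<times> (real \<Rightarrow> real)) set" where
  "trivial_solutions = {(lam, 0, \<lambda>x. 0) | lam. True}"

section \<open>Linearization and bifurcation values\<close>

text \<open>The operator is smooth from a neighbourhood of the origin of \<open>\<real> \<times> X\<close> into \<open>Y\<close>, and evaluation at
  a point is continuous on \<open>Y\<close>. Its Frechet derivative in \<open>(\<mu>, w)\<close> at \<open>(lam, (0, 0))\<close> is therefore
  obtained from the directional derivatives at each point.\<close>

definition F_lin :: "real \<Rightarrow> real \<Rightarrow> real \<Rightarrow> real \<Rightarrow> real \<Rightarrow> real \<Rightarrow>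
    real \<Rightarrow> real \<Rightarrow> (real \<Rightarrow> real) \<Rightarrow> real \<Rightarrow> real" where
  "F_lin g h A B \<beta> \<sigma> lam \<nu> \<phi> x =
     deriv (\<lambda>t. F_op g h A B \<beta> \<sigma> lam (t * \<nu>) (\<lambda>y. t * \<phi> y) x) 0"

definition F_kernel :: "real \<Rightarrow> real \<Rightarrow> real \<Rightarrow> real \<Rightarrow> real \<Rightarrow> real \<Rightarrow> real \<Rightarrow>
    real \<Rightarrow> (real \<times> (real \<Rightarrow> real)) set" where
  "F_kernel g h A B \<beta> \<sigma> \<alpha> lam =
     {(\<nu>, \<phi>). \<phi> \<in> X_space \<alpha> \<and> (\<forall>x. F_lin g h A B \<beta> \<sigma> lam \<nu> \<phi> x = 0)}"

text \<open>Function types carry no vector space structure in the library, so the dimension is spelled out.\<close>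

definition one_dimensional :: "(real \<times> (real \<Rightarrow> real)) set \<Rightarrow> bool" where
  "one_dimensional K \<longleftrightarrow>
     (\<exists>\<nu> \<phi>. (\<nu>, \<phi>) \<noteq> (0, \<lambda>x. 0) \<and> K = {(c * \<nu>, \<lambda>x. c * \<phi> x) | c. True})"

definition T_val :: "real \<Rightarrow> nat \<Rightarrow> real" where
  "T_val h n = tanh (real n * h) / real n"

text \<open>The argument \<open>e\<close> is the sign, \<open>1\<close> or \<open>-1\<close>.\<close>

definition lam_star :: "real \<Rightarrow> real \<Rightarrow> real \<Rightarrow> real \<Rightarrow> real \<Rightarrow> real \<Rightarrow> nat \<Rightarrow> real \<Rightarrow> real" where
  "lam_star g h A B \<beta> \<sigma> n e =
     (\<beta> + A * g * h) / 2 * T_val h n +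
     e * sqrt ((\<beta> + A * g * h)\<^sup>2 / 4 * (T_val h n)\<^sup>2 + (g * B + \<sigma> * (real n)\<^sup>2) * T_val h n)"

end

(*
  Bifurcation from a simple eigenvalue, carried out on Fourier coefficients. Write the conformal factor as
  J = (1 + C w')^2 + w'^2 and let S = w' / sqrt J be the sine of the tangent angle. For small w the equation
  F = 0 is equivalent to S' = R, where R has order zero in w' and C w'. Integrated once, it becomes a polynomial
  system for the coefficients of w' and of 1 / sqrt J - 1 in a weighted convolution algebra l^1(Z), in which
  all linear operators are bounded Fourier multipliers. Dividing by the amplitude s turns this into
  a system Phi(s, .) = 0 that is still polynomial and whose value at s = 0 is the linearization; after
  projection, the implicit function theorem applies at s = 0.

  Two weights are needed. The curve is constructed with weight (1 + |k|)^2, which puts w into C^3 and hence into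
  C^{2,alpha} for every alpha < 1. Uniqueness is proved with weight 1: by Bessel's inequality, w'' in L^2
  already makes the coefficients of w' summable. A solution near the trivial branch is determined by its
  n-th cosine coefficient, so the two constructions need not be compared directly.
*)
theory Submission
  imports Defs
begin

text \<open>Put p = w', q = C w' and let J be the conformal factor. The tangent angle theta has cos
  theta = (1 + q) / sqrt J, sin theta = p / sqrt J and J theta' = w'' + q w'' - p C w'', the
  numerator of the surface tension term. Multiplying F = 0 by (1 + q) / (2 \<sigma> J), which is
  positive for small w, therefore turns that term into the exact derivative of sin theta. The sine
  is preferred to the angle because it is polynomial in the two unknowns. Integrating costs one
  solvability condition, the vanishing mean of R, and this scalar equation determines mu.

  The obstacle is the passage between coefficients and functions. The operator contains C w'' as a
  pointwise series, while Hoelder continuity of w'' with a small exponent does not make its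
  coefficients summable. Conjugate Fourier series of Hoelder functions are therefore shown to
  converge uniformly, which identifies C w'' with the derivative of C w'.\<close>

no_notation Infinite_Set_Sum.abs_summable_on (infix \<open>abs'_summable'_on\<close> 50)
notation Infinite_Sum.abs_summable_on (infixr \<open>abs'_summable'_on\<close> 46)

section \<open>The weighted Fourier algebra\<close>

text \<open>Stated over a general complete normed field: it is applied to real coefficients and, in
  \<open>ev_mult\<close>, to the complex terms of a Fourier series at a fixed point.\<close>

definition conv :: "(int \<Rightarrow> 'a) \<Rightarrow> (int \<Rightarrow> 'a) \<Rightarrow> int \<Rightarrow> 'a::{real_normed_field, banach}" where
  "conv f g k = (\<Sum>\<^sub>\<infinity>j. f j * g (k - j))"

text \<open>The substitution (k, j) to (j, k - j) carries the terms of the convolution onto the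
  product family f x * g y, whose absolute summability and sum are known.\<close>

lemma conv_abs_summable_pairs:
  fixes f g :: "int \<Rightarrow> 'a::{real_normed_field, banach}"
  assumes "f abs_summable_on UNIV" "g abs_summable_on UNIV"
  shows "(\<lambda>(k, j). f j * g (k - j)) abs_summable_on UNIV \<times> UNIV"
    and "(\<Sum>\<^sub>\<infinity>(k, j)\<in>UNIV \<times> UNIV. f j * g (k - j)) = infsum f UNIV * infsum g UNIV"
proof -
  let ?P = "\<lambda>(x, y). f x * g y"
  let ?r = "\<lambda>(k, j :: int). (j, k - j)"
  have "(\<lambda>x. norm (f x) * (\<Sum>\<^sub>\<infinity>y. norm (g y))) abs_summable_on UNIV"
    unfolding norm_mult using summable_on_cmult_left[OF assms(1), of "norm (\<Sum>\<^sub>\<infinity>y. norm (g y))"] by simp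
  then have P: "?P abs_summable_on UNIV \<times> UNIV"
    using Infinite_Sum.abs_summable_on_Sigma_iff[of ?P UNIV "\<lambda>_. UNIV"] assms
    by (auto simp: norm_mult summable_on_cmult_right infsum_cmult_right')
  have bij: "bij_betw ?r (UNIV \<times> UNIV) (UNIV \<times> UNIV)"
    by (rule bij_betwI[where g = "\<lambda>(j, l). (j + l, j)"]) auto
  show "(\<lambda>(k, j). f j * g (k - j)) abs_summable_on UNIV \<times> UNIV"
    using P summable_on_reindex_bij_betw[OF bij, of "\<lambda>p. norm (?P p)"]
    by (simp add: case_prod_beta')
  have "(\<Sum>\<^sub>\<infinity>(k, j)\<in>UNIV \<times> UNIV. f j * g (k - j)) = infsum ?P (UNIV \<times> UNIV)"
    using infsum_reindex_bij_betw[OF bij, of ?P] by (simp add: case_prod_beta')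
  also have "\<dots> = (\<Sum>\<^sub>\<infinity>x. \<Sum>\<^sub>\<infinity>y. f x * g y)"
    using infsum_Sigma'_banach[of "\<lambda>x y. f x * g y" UNIV "\<lambda>_. UNIV"] P Infinite_Sum.abs_summable_summable by force
  also have "\<dots> = infsum f UNIV * infsum g UNIV"
    by (simp add: infsum_cmult_right' infsum_cmult_left')
  finally show "(\<Sum>\<^sub>\<infinity>(k, j)\<in>UNIV \<times> UNIV. f j * g (k - j)) = infsum f UNIV * infsum g UNIV" .
qed

lemma
  fixes f g :: "int \<Rightarrow> 'a::{real_normed_field, banach}"
  assumes "f abs_summable_on UNIV" "g abs_summable_on UNIV"
  shows conv_summand_abs_summable: "(\<lambda>j. f j * g (k - j)) abs_summable_on UNIV"
    and conv_infsum: "infsum (conv f g) UNIV = infsum f UNIV * infsum g UNIV"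
    and conv_abs_summable: "conv f g abs_summable_on UNIV"
proof -
  note P = conv_abs_summable_pairs[OF assms]
  have S: "\<forall>k\<in>UNIV. (\<lambda>j. f j * g (k - j)) abs_summable_on UNIV"
    "(\<lambda>k. \<Sum>\<^sub>\<infinity>j. norm (f j * g (k - j))) abs_summable_on UNIV"
    using P(1) Infinite_Sum.abs_summable_on_Sigma_iff[of "\<lambda>(k, j). f j * g (k - j)" UNIV "\<lambda>_. UNIV"] by auto
  show "(\<lambda>j. f j * g (k - j)) abs_summable_on UNIV" using S(1) by blast
  show "infsum (conv f g) UNIV = infsum f UNIV * infsum g UNIV"
    unfolding conv_def P(2)[symmetric]
    using infsum_Sigma'_banach[of "\<lambda>k j. f j * g (k - j)" UNIV "\<lambda>_. UNIV"] P(1) Infinite_Sum.abs_summable_summable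
    by force
  have "norm (conv f g k) \<le> norm (\<Sum>\<^sub>\<infinity>j. norm (f j * g (k - j)))" for k
    unfolding conv_def real_norm_def
    by (rule order_trans[OF norm_infsum_bound[OF S(1)[rule_format, OF UNIV_I]] abs_ge_self])
  with S(2) show "conv f g abs_summable_on UNIV"
    by (rule Infinite_Sum.abs_summable_on_comparison_test)
qed

lemma conv_commute: "conv f g = conv g f"
proof
  fix k :: int
  have bij: "bij_betw (\<lambda>j::int. k - j) UNIV UNIV"
    by (rule bij_betwI[where g = "\<lambda>j. k - j"]) auto
  show "conv f g k = conv g f k"
    unfolding conv_def using infsum_reindex_bij_betw[OF bij, of "\<lambda>j. f j * g (k - j)"]
    by (simp add: mult.commute)
qed

lemma abs_summable_bounded:
  fixes f :: "'b \<Rightarrow> 'a::real_normed_vector"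
  assumes "f abs_summable_on UNIV"
  shows "norm (f k) \<le> (\<Sum>\<^sub>\<infinity>j. norm (f j))"
  using finite_sum_le_infsum[of "\<lambda>j. norm (f j)" UNIV "{k}"] assms by auto

text \<open>For fixed k the family a i * b (j - i) * c (k - j) is dominated by an absolutely
  summable family of pairs times a bound for c, so the two summations may be exchanged.\<close>

lemma conv_assoc:
  fixes a b c :: "int \<Rightarrow> 'a::{real_normed_field, banach}"
  assumes "a abs_summable_on UNIV" "b abs_summable_on UNIV" "c abs_summable_on UNIV"
  shows "conv (conv a b) c = conv a (conv b c)"
proof
  fix k
  let ?t = "\<lambda>(j, i). a i * b (j - i) * c (k - j)"
  have "?t abs_summable_on UNIV \<times> UNIV"
  proof (rule Infinite_Sum.abs_summable_on_comparison_test)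
    show "(\<lambda>p. (case p of (j, i) \<Rightarrow> a i * b (j - i)) * of_real (\<Sum>\<^sub>\<infinity>l. norm (c l))) abs_summable_on UNIV \<times> UNIV"
      unfolding norm_mult
      by (intro summable_on_cmult_left conv_abs_summable_pairs(1)[OF assms(1,2)])
    have "0 \<le> (\<Sum>\<^sub>\<infinity>l. norm (c l))" by (intro infsum_nonneg) auto
    then show "norm (?t p) \<le> norm ((case p of (j, i) \<Rightarrow> a i * b (j - i)) * of_real (\<Sum>\<^sub>\<infinity>l. norm (c l)))" for p
      using abs_summable_bounded[OF assms(3)]
      by (auto simp: case_prod_beta norm_mult intro!: mult_left_mono)
  qed
  then have t: "?t summable_on UNIV \<times> UNIV" by (rule Infinite_Sum.abs_summable_summable)
  have "conv (conv a b) c k = (\<Sum>\<^sub>\<infinity>j. \<Sum>\<^sub>\<infinity>i. a i * b (j - i) * c (k - j))"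
    unfolding conv_def by (simp add: infsum_cmult_left'[symmetric])
  also have "\<dots> = (\<Sum>\<^sub>\<infinity>i. \<Sum>\<^sub>\<infinity>j. a i * b (j - i) * c (k - j))"
    using infsum_swap_banach[of "\<lambda>j i. a i * b (j - i) * c (k - j)" UNIV UNIV] t by simp
  also have "\<dots> = (\<Sum>\<^sub>\<infinity>i. a i * (\<Sum>\<^sub>\<infinity>j. b (j - i) * c (k - j)))"
    by (simp add: infsum_cmult_right'[symmetric] mult.assoc)
  also have "(\<lambda>i. \<Sum>\<^sub>\<infinity>j. b (j - i) * c (k - j)) = (\<lambda>i. conv b c (k - i))"
  proof
    fix i :: int
    have bij: "bij_betw (\<lambda>l::int. l + i) UNIV UNIV"
      by (rule bij_betwI[where g = "\<lambda>j::int. j - i"]) auto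
    show "(\<Sum>\<^sub>\<infinity>j. b (j - i) * c (k - j)) = conv b c (k - i)"
      unfolding conv_def using infsum_reindex_bij_betw[OF bij, of "\<lambda>j. b (j - i) * c (k - j)"]
      by (simp add: algebra_simps)
  qed
  also have "(\<Sum>\<^sub>\<infinity>i. a i * conv b c (k - i)) = conv a (conv b c) k" by (simp add: conv_def)
  finally show "conv (conv a b) c k = conv a (conv b c) k" by metis
qed

text \<open>A type class instance cannot depend on a term, so the exponent is read off the
  cardinality of a type: 0 for \<open>unit\<close>, 2 for \<open>bool\<close>.\<close>

definition wgt :: "'m::finite itself \<Rightarrow> int \<Rightarrow> real" where
  "wgt _ k = (1 + \<bar>real_of_int k\<bar>) ^ (2 * (CARD('m) - 1))"

lemma wgt_ge_1: "1 \<le> wgt TYPE('m::finite) k"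
  by (simp add: wgt_def)

lemma wgt_pos: "0 < wgt TYPE('m::finite) k"
  using wgt_ge_1[of k] by (smt (verit))

lemma wgt_0: "wgt TYPE('m::finite) 0 = 1"
  by (simp add: wgt_def)

text \<open>Follows from 1 + |k| \<le> (1 + |j|) (1 + |k - j|). Submultiplicativity of the weight is
  what makes the weighted norm an algebra norm.\<close>

lemma wgt_mult: "wgt TYPE('m::finite) k \<le> wgt TYPE('m) j * wgt TYPE('m) (k - j)"
proof -
  have "1 + \<bar>real_of_int k\<bar> \<le> (1 + \<bar>real_of_int j\<bar>) * (1 + \<bar>real_of_int (k - j)\<bar>)"
  proof -
    have "\<bar>real_of_int k\<bar> \<le> \<bar>real_of_int j\<bar> + \<bar>real_of_int (k - j)\<bar>" by simp
    moreover have "0 \<le> \<bar>real_of_int j\<bar> * \<bar>real_of_int (k - j)\<bar>" by simp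
    ultimately show ?thesis unfolding distrib_left distrib_right mult_1 mult_1_right by linarith
  qed
  then show ?thesis
    unfolding wgt_def power_mult_distrib[symmetric] by (intro power_mono) auto
qed

text \<open>The type parameter only encodes the weight: \<open>unit\<close> gives absolute summability, \<open>bool\<close> the
  weight \<open>(1 + \<bar>k\<bar>)\<^sup>2\<close>.\<close>

typedef ('m::finite) wien = "{a :: int \<Rightarrow> real. (\<lambda>k. \<bar>a k\<bar> * wgt TYPE('m) k) summable_on UNIV}"
  morphisms coef Wien
  by (rule exI[of _ "\<lambda>_. 0"]) simp

definition wsummable :: "'m::finite itself \<Rightarrow> (int \<Rightarrow> real) \<Rightarrow> bool" where
  "wsummable _ a \<longleftrightarrow> (\<lambda>k. \<bar>a k\<bar> * wgt TYPE('m) k) summable_on UNIV"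

lemma coef_wsummable: "wsummable TYPE('m) (coef (a :: 'm::finite wien))"
  using coef[of a] by (simp add: wsummable_def)

lemma coef_Wien: "wsummable TYPE('m::finite) a \<Longrightarrow> coef (Wien a :: 'm wien) = a"
  by (simp add: wsummable_def Wien_inverse)

lemma wien_eqI: "(\<And>k. coef a k = coef b k) \<Longrightarrow> a = b"
  by (metis coef_inject ext)

lemma wsummable_abs: "wsummable TYPE('m::finite) a \<Longrightarrow> (\<lambda>k. a k * wgt TYPE('m) k) abs_summable_on UNIV"
  using wgt_pos[where 'm = 'm] by (simp add: wsummable_def abs_mult abs_of_pos)

lemma wsummable_imp_abs_summable:
  assumes "wsummable TYPE('m::finite) a"
  shows "a abs_summable_on UNIV"
proof (rule Infinite_Sum.abs_summable_on_comparison_test[OF wsummable_abs[OF assms]])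
  fix k show "norm (a k) \<le> norm (a k * wgt TYPE('m) k)"
    using mult_left_mono[OF wgt_ge_1[where 'm = 'm], of "\<bar>a k\<bar>" k] wgt_pos[of k, where 'm = 'm]
      by (simp add: abs_mult abs_of_pos)
qed

lemma wsummable_compare:
  assumes "wsummable TYPE('m::finite) a" "\<And>k. \<bar>b k\<bar> \<le> C * \<bar>a k\<bar>"
  shows "wsummable TYPE('m) b"
proof -
  have "(\<lambda>k. C * (\<bar>a k\<bar> * wgt TYPE('m) k)) summable_on UNIV"
    using assms(1) by (intro summable_on_cmult_right) (simp add: wsummable_def)
  then show ?thesis unfolding wsummable_def
  proof (rule summable_on_comparison_test)
    fix k show "\<bar>b k\<bar> * wgt TYPE('m) k \<le> C * (\<bar>a k\<bar> * wgt TYPE('m) k)"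
      using mult_right_mono[OF assms(2)[of k], of "wgt TYPE('m) k"] wgt_pos[of k, where 'm = 'm]
      by (simp add: mult.assoc)
    show "0 \<le> \<bar>b k\<bar> * wgt TYPE('m) k" using wgt_pos[of k, where 'm = 'm] by simp
  qed
qed

lemma wsummable_add:
  assumes "wsummable TYPE('m::finite) a" "wsummable TYPE('m) b"
  shows "wsummable TYPE('m) (\<lambda>k. a k + b k)"
proof -
  have "(\<lambda>k. \<bar>a k\<bar> * wgt TYPE('m) k + \<bar>b k\<bar> * wgt TYPE('m) k) summable_on UNIV"
    using assms by (intro summable_on_add) (auto simp: wsummable_def)
  then show ?thesis unfolding wsummable_def
    by (rule summable_on_comparison_test)
      (use wgt_pos[where 'm = 'm] in \<open>auto simp: distrib_right[symmetric] less_imp_le intro!: mult_right_mono\<close>)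
qed

lemma conv_weighted_bound:
  assumes "wsummable TYPE('m::finite) a" "wsummable TYPE('m) b"
  shows "\<bar>conv a b k\<bar> * wgt TYPE('m) k
    \<le> conv (\<lambda>j. \<bar>a j\<bar> * wgt TYPE('m) j) (\<lambda>j. \<bar>b j\<bar> * wgt TYPE('m) j) k"
proof -
  have S: "(\<lambda>j. a j * b (k - j)) abs_summable_on UNIV"
    using assms by (intro conv_summand_abs_summable wsummable_imp_abs_summable)
  have "\<bar>conv a b k\<bar> * wgt TYPE('m) k \<le> (\<Sum>\<^sub>\<infinity>j. norm (a j * b (k - j))) * wgt TYPE('m) k"
    unfolding conv_def using norm_infsum_bound[OF S] wgt_pos[of k, where 'm = 'm]
    by (intro mult_right_mono) auto
  also have "\<dots> = (\<Sum>\<^sub>\<infinity>j. norm (a j * b (k - j)) * wgt TYPE('m) k)"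
    by (simp add: infsum_cmult_left')
  also have "\<dots> \<le> conv (\<lambda>j. \<bar>a j\<bar> * wgt TYPE('m) j) (\<lambda>j. \<bar>b j\<bar> * wgt TYPE('m) j) k"
    unfolding conv_def
  proof (rule infsum_mono)
    show "(\<lambda>j. norm (a j * b (k - j)) * wgt TYPE('m) k) summable_on UNIV"
      by (rule summable_on_cmult_left[OF S])
    have abs: "(\<lambda>j. \<bar>a j\<bar> * wgt TYPE('m) j) abs_summable_on UNIV" "(\<lambda>j. \<bar>b j\<bar> * wgt TYPE('m) j) abs_summable_on UNIV"
      using assms wgt_pos[where 'm = 'm] by (auto simp: wsummable_def abs_of_pos abs_mult)
    show "(\<lambda>j. (\<bar>a j\<bar> * wgt TYPE('m) j) * (\<bar>b (k - j)\<bar> * wgt TYPE('m) (k - j))) summable_on UNIV"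
      by (rule Infinite_Sum.abs_summable_summable[OF conv_summand_abs_summable[OF abs]])
    fix j
    show "norm (a j * b (k - j)) * wgt TYPE('m) k \<le> (\<bar>a j\<bar> * wgt TYPE('m) j) * (\<bar>b (k - j)\<bar> * wgt TYPE('m) (k - j))"
      using mult_left_mono[OF wgt_mult[of k j, where 'm = 'm], of "\<bar>a j\<bar> * \<bar>b (k - j)\<bar>"]
      by (simp add: abs_mult mult_ac)
  qed
  finally show ?thesis .
qed

lemma
  assumes "wsummable TYPE('m::finite) a" "wsummable TYPE('m) b"
  shows wsummable_conv: "wsummable TYPE('m) (conv a b)"
    and conv_norm_bound: "(\<Sum>\<^sub>\<infinity>k. \<bar>conv a b k\<bar> * wgt TYPE('m) k)
      \<le> (\<Sum>\<^sub>\<infinity>k. \<bar>a k\<bar> * wgt TYPE('m) k) * (\<Sum>\<^sub>\<infinity>k. \<bar>b k\<bar> * wgt TYPE('m) k)"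
proof -
  let ?a = "\<lambda>j. \<bar>a j\<bar> * wgt TYPE('m) j" and ?b = "\<lambda>j. \<bar>b j\<bar> * wgt TYPE('m) j"
  have abs: "?a abs_summable_on UNIV" "?b abs_summable_on UNIV"
    using assms wgt_pos[where 'm = 'm] by (auto simp: wsummable_def abs_of_pos abs_mult)
  have c: "conv ?a ?b summable_on UNIV"
    by (rule Infinite_Sum.abs_summable_summable[OF conv_abs_summable[OF abs]])
  show w: "wsummable TYPE('m) (conv a b)"
    unfolding wsummable_def
    by (rule summable_on_comparison_test[OF c])
      (use conv_weighted_bound[OF assms] wgt_pos[where 'm = 'm] in \<open>auto simp: less_imp_le\<close>)
  show "(\<Sum>\<^sub>\<infinity>k. \<bar>conv a b k\<bar> * wgt TYPE('m) k) \<le> infsum ?a UNIV * infsum ?b UNIV"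
    unfolding conv_infsum[OF abs, symmetric]
    by (rule infsum_mono) (use w c conv_weighted_bound[OF assms] in \<open>auto simp: wsummable_def\<close>)
qed

section \<open>Weighted summable sequences as a commutative Banach algebra\<close>

instantiation wien :: (finite) comm_ring_1
begin

definition "0 = (Wien (\<lambda>_. 0) :: 'a wien)"
definition "1 = (Wien (\<lambda>k. if k = 0 then 1 else 0) :: 'a wien)"
definition "a + b = (Wien (\<lambda>k. coef a k + coef b k) :: 'a wien)"
definition "a - b = (Wien (\<lambda>k. coef a k - coef b k) :: 'a wien)"
definition "- a = (Wien (\<lambda>k. - coef a k) :: 'a wien)"
definition "a * b = (Wien (conv (coef a) (coef b)) :: 'a wien)"

lemma coef_0 [simp]: "coef (0 :: 'a wien) k = 0"
  unfolding zero_wien_def by (subst coef_Wien) (auto simp: wsummable_def)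

lemma coef_1: "coef (1 :: 'a wien) k = (if k = 0 then 1 else 0)"
proof -
  have "(\<lambda>k. \<bar>if k = 0 then 1 else 0\<bar> * wgt TYPE('a) k) summable_on UNIV"
    by (rule finite_nonzero_values_imp_summable_on, rule finite_subset[of _ "{0}"]) auto
  then show ?thesis
    unfolding one_wien_def by (subst coef_Wien) (auto simp: wsummable_def)
qed

lemma coef_uminus [simp]: "coef (- a :: 'a wien) k = - coef a k"
  unfolding uminus_wien_def
  by (subst coef_Wien) (auto intro: wsummable_compare[OF coef_wsummable[of a], where C = 1])

lemma coef_add [simp]: "coef (a + b :: 'a wien) k = coef a k + coef b k"
  unfolding plus_wien_def
  by (subst coef_Wien) (auto intro: wsummable_add coef_wsummable)

lemma coef_diff [simp]: "coef (a - b :: 'a wien) k = coef a k - coef b k"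
  using wsummable_add[OF coef_wsummable coef_wsummable, of a "- b"]
  unfolding minus_wien_def by (subst coef_Wien) auto

lemma coef_mult: "coef (a * b :: 'a wien) = conv (coef a) (coef b)"
  unfolding times_wien_def by (subst coef_Wien) (auto intro: wsummable_conv coef_wsummable)

instance
proof
  fix a b c :: "'a wien"
  have abs: "coef x abs_summable_on UNIV" for x :: "'a wien"
    by (rule wsummable_imp_abs_summable[OF coef_wsummable])
  show "a * b * c = a * (b * c)"
    by (rule wien_eqI) (simp only: coef_mult conv_assoc[OF abs abs abs])
  show "a * b = b * a"
    by (rule wien_eqI) (simp add: coef_mult conv_commute)
  show "1 * a = a"
  proof (rule wien_eqI)
    fix k
    have "conv (coef 1) (coef a) k = (\<Sum>\<^sub>\<infinity>j\<in>{0}. coef 1 j * coef a (k - j))"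
      unfolding conv_def by (rule infsum_cong_neutral) (auto simp: coef_1)
    then show "coef (1 * a) k = coef a k" by (simp add: coef_mult coef_1)
  qed
  show "(a + b) * c = a * c + b * c"
  proof (rule wien_eqI)
    fix k
    have "(\<lambda>j. coef x j * coef c (k - j)) summable_on UNIV" for x :: "'a wien"
      by (rule Infinite_Sum.abs_summable_summable[OF conv_summand_abs_summable[OF abs abs]])
    then show "coef ((a + b) * c) k = coef (a * c + b * c) k"
      by (simp add: coef_mult conv_def distrib_right infsum_add)
  qed
  show "(0::'a wien) \<noteq> 1"
    by (metis coef_0 coef_1 zero_neq_one)
qed (auto intro!: wien_eqI)

end

instantiation wien :: (finite) real_normed_algebra_1
begin

definition "r *\<^sub>R a = (Wien (\<lambda>k. r * coef a k) :: 'a wien)"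
definition norm_wien_def: "norm (a :: 'a wien) = (\<Sum>\<^sub>\<infinity>k. \<bar>coef a k\<bar> * wgt TYPE('a) k)"
definition sgn_wien_def: "sgn (a :: 'a wien) = inverse (norm a) *\<^sub>R a"
definition dist_wien_def: "dist (a :: 'a wien) b = norm (a - b)"
definition uniformity_wien_def: "(uniformity :: ('a wien \<times> 'a wien) filter) = (INF e\<in>{0 <..}. principal {(x, y). dist x y < e})"
definition open_wien_def: "open (U :: 'a wien set) \<longleftrightarrow> (\<forall>x\<in>U. eventually (\<lambda>(x', y). x' = x \<longrightarrow> y \<in> U) uniformity)"

lemma coef_scaleR [simp]: "coef (r *\<^sub>R a :: 'a wien) k = r * coef a k"
  unfolding scaleR_wien_def
  by (subst coef_Wien) (auto simp: abs_mult intro!: wsummable_compare[OF coef_wsummable[of a], where C = "\<bar>r\<bar>"])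

lemma norm_summable: "(\<lambda>k. \<bar>coef (a :: 'a wien) k\<bar> * wgt TYPE('a) k) summable_on UNIV"
  using coef_wsummable[of a] by (simp add: wsummable_def)

instance
proof
  fix a b :: "'a wien" and r :: real
  have w0: "0 \<le> \<bar>coef x k\<bar> * wgt TYPE('a) k" for x :: "'a wien" and k
    using wgt_pos[of k, where 'm = 'a] by simp
  show "norm a = 0 \<longleftrightarrow> a = 0"
  proof
    assume "norm a = 0"
    then have "\<bar>coef a k\<bar> * wgt TYPE('a) k = 0" for k
      using nonneg_infsum_le_0D[of "\<lambda>k. \<bar>coef a k\<bar> * wgt TYPE('a) k" UNIV k] norm_summable[of a] w0
      by (simp add: norm_wien_def)
    then show "a = 0"
      using wgt_pos[where 'm = 'a] by (intro wien_eqI) (simp, metis less_irrefl)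
  qed (simp add: norm_wien_def)
  show "norm (a + b) \<le> norm a + norm b"
    unfolding norm_wien_def infsum_add[OF norm_summable norm_summable, symmetric]
  proof (rule infsum_mono[OF norm_summable summable_on_add[OF norm_summable norm_summable]])
    fix k
    show "\<bar>coef (a + b) k\<bar> * wgt TYPE('a) k \<le> \<bar>coef a k\<bar> * wgt TYPE('a) k + \<bar>coef b k\<bar> * wgt TYPE('a) k"
      using wgt_pos[of k, where 'm = 'a]
      by (simp add: distrib_right[symmetric] mult_right_mono less_imp_le)
  qed
  show "norm (r *\<^sub>R a) = \<bar>r\<bar> * norm a"
    by (simp add: norm_wien_def abs_mult mult.assoc infsum_cmult_right')
  show "norm (a * b) \<le> norm a * norm b"
    unfolding norm_wien_def coef_mult by (rule conv_norm_bound[OF coef_wsummable coef_wsummable])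
  have "norm (1 :: 'a wien) = (\<Sum>\<^sub>\<infinity>k\<in>{0}. \<bar>coef (1 :: 'a wien) k\<bar> * wgt TYPE('a) k)"
    unfolding norm_wien_def by (rule infsum_cong_neutral) (auto simp: coef_1)
  then show "norm (1 :: 'a wien) = 1" by (simp add: coef_1 wgt_0)
  have scale: "coef (r *\<^sub>R c) = (\<lambda>k. r * coef c k)" for c :: "'a wien" by (rule ext) simp
  have conv_scale: "conv (\<lambda>k. r * coef a k) (coef b) = (\<lambda>k. r * conv (coef a) (coef b) k)"
    by (simp add: conv_def fun_eq_iff infsum_cmult_right' mult.assoc)
  show "r *\<^sub>R a * b = r *\<^sub>R (a * b)"
    by (rule wien_eqI) (simp add: coef_mult conv_scale scale)
  have "conv (coef a) (\<lambda>k. r * coef b k) = (\<lambda>k. r * conv (coef a) (coef b) k)"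
    by (simp add: conv_def fun_eq_iff infsum_cmult_right'[symmetric] mult.left_commute)
  then show "a * r *\<^sub>R b = r *\<^sub>R (a * b)"
    by (intro wien_eqI) (simp add: coef_mult scale)
qed (auto intro!: wien_eqI simp: dist_wien_def sgn_wien_def uniformity_wien_def open_wien_def algebra_simps)

end

lemma coef_le_norm_weighted: "\<bar>coef a k\<bar> * wgt TYPE('m) k \<le> norm (a :: 'm::finite wien)"
  using abs_summable_bounded[of "\<lambda>k. coef a k * wgt TYPE('m) k" k] coef_wsummable[of a, THEN wsummable_abs]
    wgt_pos[where 'm = 'm]
  by (simp add: norm_wien_def abs_mult abs_of_pos)

lemma coef_le_norm: "\<bar>coef a k\<bar> \<le> norm (a :: 'm::finite wien)"
  using coef_le_norm_weighted[of a k] mult_left_mono[OF wgt_ge_1[of k, where 'm = 'm], of "\<bar>coef a k\<bar>"]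
  by simp

lemma bounded_linear_coef: "bounded_linear (\<lambda>a :: 'm::finite wien. coef a k)"
  by (rule bounded_linear_intro[where K = 1]) (use coef_le_norm in auto)

text \<open>Each coefficient converges; the Cauchy bound holds on every finite set of indices,
  survives the coefficientwise limit there, and then bounds the whole weighted sum.\<close>

instance wien :: (finite) banach
proof
  fix X :: "nat \<Rightarrow> 'a wien" assume C: "Cauchy X"
  have "Cauchy (\<lambda>n. coef (X n) k)" for k
    by (rule bounded_linear.Cauchy[OF bounded_linear_coef C])
  then have "\<forall>k. \<exists>l. (\<lambda>n. coef (X n) k) \<longlonglongrightarrow> l"
    using Cauchy_convergent_iff convergent_def by blast
  then obtain l where l: "\<And>k. (\<lambda>n. coef (X n) k) \<longlonglongrightarrow> l k" by metis
  have fin: "(\<Sum>k\<in>S. \<bar>l k - coef (X n) k\<bar> * wgt TYPE('a) k) \<le> e"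
    if "finite S" "\<And>m. m \<ge> N \<Longrightarrow> norm (X m - X n) < e" for S n N e
  proof (rule LIMSEQ_le_const2)
    show "(\<lambda>m. \<Sum>k\<in>S. \<bar>coef (X m) k - coef (X n) k\<bar> * wgt TYPE('a) k)
        \<longlonglongrightarrow> (\<Sum>k\<in>S. \<bar>l k - coef (X n) k\<bar> * wgt TYPE('a) k)"
      by (intro tendsto_intros l)
    have "(\<Sum>k\<in>S. \<bar>coef (X m) k - coef (X n) k\<bar> * wgt TYPE('a) k) \<le> e" if "m \<ge> N" for m
    proof -
      have "(\<Sum>k\<in>S. \<bar>coef (X m - X n) k\<bar> * wgt TYPE('a) k) \<le> norm (X m - X n)"
        unfolding norm_wien_def
        by (rule finite_sum_le_infsum[OF norm_summable \<open>finite S\<close>]) (use wgt_pos[where 'm = 'a] in \<open>auto simp: less_imp_le\<close>)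
      with \<open>m \<ge> N\<close> \<open>\<And>m. m \<ge> N \<Longrightarrow> norm (X m - X n) < e\<close>[of m] show ?thesis by simp
    qed
    then show "\<exists>M. \<forall>m\<ge>M. (\<Sum>k\<in>S. \<bar>coef (X m) k - coef (X n) k\<bar> * wgt TYPE('a) k) \<le> e" by blast
  qed
  have wsd: "wsummable TYPE('a) (\<lambda>k. l k - coef (X n) k)" if "\<And>m. m \<ge> N \<Longrightarrow> norm (X m - X n) < e" for n N e
    unfolding wsummable_def
    by (rule nonneg_bdd_above_summable_on)
      (use fin that wgt_pos[where 'm = 'a] in \<open>auto intro!: bdd_aboveI[of _ e] simp: less_imp_le\<close>)
  obtain N where "\<forall>m\<ge>N. \<forall>n\<ge>N. norm (X m - X n) < 1"
    using C by (metis Cauchy_iff zero_less_one)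
  \<comment> \<open>The limit is summable because it differs from the single element X N by a
    summable sequence.\<close>
  then have "wsummable TYPE('a) (\<lambda>k. l k - coef (X N) k)" using wsd[of N N 1] by auto
  from wsummable_add[OF this coef_wsummable[of "X N"]] have L: "wsummable TYPE('a) l" by simp
  define Y where "Y = (Wien l :: 'a wien)"
  have Y: "coef Y = l" unfolding Y_def by (rule coef_Wien[OF L])
  have "\<exists>N. \<forall>n\<ge>N. norm (X n - Y) < e" if "e > 0" for e
  proof -
    have "e / 2 > 0" using that by simp
    from CauchyD[OF C this] obtain N where N: "\<forall>m\<ge>N. \<forall>n\<ge>N. norm (X m - X n) < e / 2" by blast
    have "norm (X n - Y) < e" if "n \<ge> N" for n
    proof -
      have "norm (Y - X n) \<le> e / 2"
        unfolding norm_wien_def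
        by (rule infsum_le_finite_sums[OF norm_summable]) (use fin[OF _ N[rule_format, OF _ that]] in \<open>auto simp: Y\<close>)
      then show ?thesis using \<open>e > 0\<close> by (simp add: norm_minus_commute)
    qed
    then show ?thesis by blast
  qed
  then have "X \<longlonglongrightarrow> Y" by (simp add: LIMSEQ_iff)
  then show "convergent X" by (auto simp: convergent_def)
qed

section \<open>Strict differentiability and the implicit function theorem\<close>

text \<open>Both u and v vary near x. This two-point bound is already the contraction estimate of
  the implicit function theorem, and it is inherited by sums and by bounded linear and bilinear
  images, hence by polynomial maps.\<close>

definition has_strict_derivative ::
    "('a::real_normed_vector \<Rightarrow> 'b::real_normed_vector) \<Rightarrow> ('a \<Rightarrow> 'b) \<Rightarrow> 'a \<Rightarrow> bool" where
  "has_strict_derivative f L x \<longleftrightarrow> bounded_linear L \<and>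
     (\<forall>\<epsilon>>0. \<exists>\<delta>>0. \<forall>u v. norm (u - x) < \<delta> \<longrightarrow> norm (v - x) < \<delta> \<longrightarrow>
        norm (f u - f v - L (u - v)) \<le> \<epsilon> * norm (u - v))"

text \<open>The derivative is hidden so that \<open>strict_intros\<close> can work through large
  polynomial expressions; where its values matter they are recovered from derivatives along
  lines.\<close>

definition strictly_differentiable ::
    "('a::real_normed_vector \<Rightarrow> 'b::real_normed_vector) \<Rightarrow> 'a \<Rightarrow> bool" where
  "strictly_differentiable f x \<longleftrightarrow> (\<exists>L. has_strict_derivative f L x)"

named_theorems strict_intros

lemma has_strict_derivativeD:
  assumes "has_strict_derivative f L x" "\<epsilon> > 0"
  obtains \<delta> where "\<delta> > 0"
    "\<And>u v. norm (u - x) < \<delta> \<Longrightarrow> norm (v - x) < \<delta> \<Longrightarrow> norm (f u - f v - L (u - v)) \<le> \<epsilon> * norm (u - v)"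
  using assms by (auto simp: has_strict_derivative_def)

lemma strict_const [strict_intros]: "strictly_differentiable (\<lambda>_. c) x"
  unfolding strictly_differentiable_def has_strict_derivative_def
  by (rule exI[of _ "\<lambda>_. 0"]) (auto intro: exI[of _ 1])

lemma strict_compose_linear:
  assumes T: "bounded_linear T" and "strictly_differentiable f x"
  shows "strictly_differentiable (\<lambda>u. T (f u)) x"
proof -
  obtain L where L: "has_strict_derivative f L x" using assms(2) by (auto simp: strictly_differentiable_def)
  obtain K where K: "K > 0" "\<And>y. norm (T y) \<le> norm y * K" using bounded_linear.pos_bounded[OF T] by blast
  have "has_strict_derivative (\<lambda>u. T (f u)) (\<lambda>u. T (L u)) x"
    unfolding has_strict_derivative_def
  proof (intro conjI allI impI)
    show "bounded_linear (\<lambda>u. T (L u))"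
      using bounded_linear_compose[OF T, of L] L by (auto simp: has_strict_derivative_def)
    fix \<epsilon> :: real assume "\<epsilon> > 0"
    then have "\<epsilon> / K > 0" using K by simp
    from has_strict_derivativeD[OF L this] obtain \<delta> where d: "\<delta> > 0"
      "\<And>u v. norm (u - x) < \<delta> \<Longrightarrow> norm (v - x) < \<delta> \<Longrightarrow> norm (f u - f v - L (u - v)) \<le> \<epsilon> / K * norm (u - v)"
      by metis
    have "norm (T (f u) - T (f v) - T (L (u - v))) \<le> \<epsilon> * norm (u - v)"
      if "norm (u - x) < \<delta>" "norm (v - x) < \<delta>" for u v
    proof -
      have "T (f u) - T (f v) - T (L (u - v)) = T (f u - f v - L (u - v))"
        using T by (simp add: linear_diff bounded_linear.linear)
      also have "norm \<dots> \<le> norm (f u - f v - L (u - v)) * K" by (rule K)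
      also have "\<dots> \<le> \<epsilon> / K * norm (u - v) * K" using d(2)[OF that] K by (intro mult_right_mono) auto
      finally show ?thesis using K by simp
    qed
    with d(1) show "\<exists>\<delta>>0. \<forall>u v. norm (u - x) < \<delta> \<longrightarrow> norm (v - x) < \<delta> \<longrightarrow>
        norm (T (f u) - T (f v) - T (L (u - v))) \<le> \<epsilon> * norm (u - v)" by blast
  qed
  then show ?thesis by (auto simp: strictly_differentiable_def)
qed

lemma strict_id: "strictly_differentiable (\<lambda>u. u) x"
  unfolding strictly_differentiable_def has_strict_derivative_def
  by (rule exI[of _ "\<lambda>u. u"]) (auto intro: exI[of _ 1])

lemmas strict_linear = strict_compose_linear[OF _ strict_id]

lemma strict_add [strict_intros]:
  assumes "strictly_differentiable f x" "strictly_differentiable g x"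
  shows "strictly_differentiable (\<lambda>u. f u + g u) x"
proof -
  obtain L M where L: "has_strict_derivative f L x" and M: "has_strict_derivative g M x"
    using assms by (auto simp: strictly_differentiable_def)
  have "has_strict_derivative (\<lambda>u. f u + g u) (\<lambda>u. L u + M u) x"
    unfolding has_strict_derivative_def
  proof (intro conjI allI impI)
    show "bounded_linear (\<lambda>u. L u + M u)"
      using L M by (intro bounded_linear_add) (auto simp: has_strict_derivative_def)
    fix \<epsilon> :: real assume "\<epsilon> > 0"
    then have e: "\<epsilon> / 2 > 0" by simp
    obtain \<delta>1 where d1: "\<delta>1 > 0" "\<And>u v. norm (u - x) < \<delta>1 \<Longrightarrow> norm (v - x) < \<delta>1 \<Longrightarrow>
        norm (f u - f v - L (u - v)) \<le> \<epsilon> / 2 * norm (u - v)"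
      using has_strict_derivativeD[OF L e] by metis
    obtain \<delta>2 where d2: "\<delta>2 > 0" "\<And>u v. norm (u - x) < \<delta>2 \<Longrightarrow> norm (v - x) < \<delta>2 \<Longrightarrow>
        norm (g u - g v - M (u - v)) \<le> \<epsilon> / 2 * norm (u - v)"
      using has_strict_derivativeD[OF M e] by metis
    have "norm (f u + g u - (f v + g v) - (L (u - v) + M (u - v))) \<le> \<epsilon> * norm (u - v)"
      if "norm (u - x) < min \<delta>1 \<delta>2" "norm (v - x) < min \<delta>1 \<delta>2" for u v
    proof -
      have "f u + g u - (f v + g v) - (L (u - v) + M (u - v))
          = (f u - f v - L (u - v)) + (g u - g v - M (u - v))" by (simp add: algebra_simps)
      also have "norm \<dots> \<le> \<epsilon> / 2 * norm (u - v) + \<epsilon> / 2 * norm (u - v)"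
        using that by (intro norm_triangle_mono d1 d2) auto
      finally show ?thesis by (simp add: field_simps)
    qed
    with d1(1) d2(1) show "\<exists>\<delta>>0. \<forall>u v. norm (u - x) < \<delta> \<longrightarrow> norm (v - x) < \<delta> \<longrightarrow>
        norm (f u + g u - (f v + g v) - (L (u - v) + M (u - v))) \<le> \<epsilon> * norm (u - v)"
      by (intro exI[of _ "min \<delta>1 \<delta>2"]) auto
  qed
  then show ?thesis by (auto simp: strictly_differentiable_def)
qed

lemma strict_uminus [strict_intros]:
  "strictly_differentiable f x \<Longrightarrow> strictly_differentiable (\<lambda>u. - f u) x"
  by (rule strict_compose_linear[OF bounded_linear_minus[OF bounded_linear_ident]])

lemma strict_diff [strict_intros]:
  "strictly_differentiable f x \<Longrightarrow> strictly_differentiable g x \<Longrightarrow> strictly_differentiable (\<lambda>u. f u - g u) x"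
  using strict_add[of f x "\<lambda>u. - g u"] strict_uminus[of g x] by simp

lemma has_strict_derivative_lipschitz:
  assumes "has_strict_derivative f L x"
  obtains \<delta> K where "\<delta> > 0" "K > 0"
    "\<And>u v. norm (u - x) < \<delta> \<Longrightarrow> norm (v - x) < \<delta> \<Longrightarrow> norm (f u - f v) \<le> K * norm (u - v)"
    "\<And>u. norm (L u) \<le> K * norm u"
proof -
  obtain \<delta> where d: "\<delta> > 0" "\<And>u v. norm (u - x) < \<delta> \<Longrightarrow> norm (v - x) < \<delta> \<Longrightarrow>
      norm (f u - f v - L (u - v)) \<le> 1 * norm (u - v)"
    using has_strict_derivativeD[OF assms zero_less_one] by metis
  have "bounded_linear L" using assms by (simp add: has_strict_derivative_def)
  then obtain K where K: "K > 0" "\<And>y. norm (L y) \<le> norm y * K"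
    using bounded_linear.pos_bounded by blast
  show ?thesis
  proof (rule that[of \<delta> "K + 1"])
    show "norm (f u - f v) \<le> (K + 1) * norm (u - v)" if "norm (u - x) < \<delta>" "norm (v - x) < \<delta>" for u v
    proof -
      have "norm (f u - f v) \<le> norm (f u - f v - L (u - v)) + norm (L (u - v))"
        using norm_triangle_ineq[of "f u - f v - L (u - v)" "L (u - v)"] by simp
      with d(2)[OF that] K(2)[of "u - v"] show ?thesis by (simp add: algebra_simps)
    qed
    show "norm (L u) \<le> (K + 1) * norm u" for u
      using K(2)[of u] norm_ge_zero[of u] unfolding distrib_right mult.commute[of K] by linarith
  qed (use d K in auto)
qed

text \<open>The error of the product rule splits into four terms, each with one factor that is small
  near x and one that is bounded or linear in u - v.\<close>

lemma (in bounded_bilinear) strict_bilinear: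
  assumes "strictly_differentiable f x" "strictly_differentiable g x"
  shows "strictly_differentiable (\<lambda>u. prod (f u) (g u)) x"
proof -
  obtain L M where L: "has_strict_derivative f L x" and M: "has_strict_derivative g M x"
    using assms by (auto simp: strictly_differentiable_def)
  obtain K where K: "K > 0" "\<And>a b. norm (prod a b) \<le> norm a * norm b * K" using pos_bounded by blast
  obtain d1 Kf where f: "d1 > 0" "Kf > 0"
    "\<And>u v. norm (u - x) < d1 \<Longrightarrow> norm (v - x) < d1 \<Longrightarrow> norm (f u - f v) \<le> Kf * norm (u - v)"
    "\<And>u. norm (L u) \<le> Kf * norm u" using has_strict_derivative_lipschitz[OF L] by metis
  obtain d2 Kg where g: "d2 > 0" "Kg > 0"
    "\<And>u v. norm (u - x) < d2 \<Longrightarrow> norm (v - x) < d2 \<Longrightarrow> norm (g u - g v) \<le> Kg * norm (u - v)"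
    "\<And>u. norm (M u) \<le> Kg * norm u" using has_strict_derivative_lipschitz[OF M] by metis
  have "has_strict_derivative (\<lambda>u. prod (f u) (g u)) (\<lambda>u. prod (f x) (M u) + prod (L u) (g x)) x"
    unfolding has_strict_derivative_def
  proof (intro conjI allI impI)
    show "bounded_linear (\<lambda>u. prod (f x) (M u) + prod (L u) (g x))"
      using L M bounded_linear_compose[OF bounded_linear_left] bounded_linear_compose[OF bounded_linear_right]
      by (intro bounded_linear_add) (auto simp: has_strict_derivative_def)
    fix \<epsilon> :: real assume \<epsilon>: "\<epsilon> > 0"
    \<comment> \<open>C collects the bounded factors of the four error terms, so that \<eta> K C =
      \<epsilon>.\<close>
    define C where "C = (norm (f x) + 1) + Kg + (norm (g x) + 1) + Kf"
    have C: "C > 0" using f g by (simp add: C_def add_pos_pos add_nonneg_pos)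
    define \<eta> where "\<eta> = \<epsilon> / (K * C)"
    have \<eta>: "\<eta> > 0" using \<epsilon> K C by (simp add: \<eta>_def)
    obtain d3 where d3: "d3 > 0" "\<And>u v. norm (u - x) < d3 \<Longrightarrow> norm (v - x) < d3 \<Longrightarrow>
        norm (f u - f v - L (u - v)) \<le> \<eta> * norm (u - v)"
      using has_strict_derivativeD[OF L \<eta>] by metis
    obtain d4 where d4: "d4 > 0" "\<And>u v. norm (u - x) < d4 \<Longrightarrow> norm (v - x) < d4 \<Longrightarrow>
        norm (g u - g v - M (u - v)) \<le> \<eta> * norm (u - v)"
      using has_strict_derivativeD[OF M \<eta>] by metis
    \<comment> \<open>The last two entries keep f and g within min \<eta> 1 of their values at x, by
      their Lipschitz constants.\<close>
    define \<delta> where "\<delta> = Min {d1, d2, d3, d4, min \<eta> 1 / Kf, min \<eta> 1 / Kg}"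
    have \<delta>: "\<delta> > 0" using f g d3 d4 \<eta> by (simp add: \<delta>_def)
    have dle: "\<delta> \<le> d1" "\<delta> \<le> d2" "\<delta> \<le> d3" "\<delta> \<le> d4" and "\<delta> \<le> min \<eta> 1 / Kf" "\<delta> \<le> min \<eta> 1 / Kg"
      unfolding \<delta>_def by (rule Min_le; simp)+
    then have dle': "\<delta> * Kf \<le> min \<eta> 1" "\<delta> * Kg \<le> min \<eta> 1"
      using pos_le_divide_eq[OF f(2)] pos_le_divide_eq[OF g(2)] by blast+
    have "norm (prod (f u) (g u) - prod (f v) (g v) - (prod (f x) (M (u - v)) + prod (L (u - v)) (g x))) \<le> \<epsilon> * norm (u - v)"
      if u: "norm (u - x) < \<delta>" and v: "norm (v - x) < \<delta>" for u v
    proof -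
      have fu: "norm (f w - f x) \<le> \<eta>" "norm (f w - f x) \<le> 1" if "norm (w - x) < \<delta>" for w
      proof -
        have "norm (f w - f x) \<le> Kf * norm (w - x)" using that dle f by (intro f(3)) auto
        also have "\<dots> \<le> \<delta> * Kf" using that f(2) by (simp add: mult.commute)
        finally show "norm (f w - f x) \<le> \<eta>" "norm (f w - f x) \<le> 1" using dle'(1) by linarith+
      qed
      have gu: "norm (g w - g x) \<le> \<eta>" "norm (g w - g x) \<le> 1" if "norm (w - x) < \<delta>" for w
      proof -
        have "norm (g w - g x) \<le> Kg * norm (w - x)" using that dle g by (intro g(3)) auto
        also have "\<dots> \<le> \<delta> * Kg" using that g(2) by (simp add: mult.commute)
        finally show "norm (g w - g x) \<le> \<eta>" "norm (g w - g x) \<le> 1" using dle'(2) by linarith+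
      qed
      have nf: "norm (f u) \<le> norm (f x) + 1" using fu(2)[OF u] norm_triangle_sub[of "f u" "f x"] by linarith
      have ng: "norm (g v) \<le> norm (g x) + 1" using gu(2)[OF v] norm_triangle_sub[of "g v" "g x"] by linarith
      let ?d = "u - v"
      have e: "prod (f u) (g u) - prod (f v) (g v) - (prod (f x) (M ?d) + prod (L ?d) (g x))
          = prod (f u) (g u - g v - M ?d) + prod (f u - f x) (M ?d)
            + prod (f u - f v - L ?d) (g v) + prod (L ?d) (g v - g x)"
        by (simp add: diff_left diff_right add_left add_right algebra_simps)
      have 1: "norm (prod (f u) (g u - g v - M ?d)) \<le> (norm (f x) + 1) * (\<eta> * norm ?d) * K"
        using u v dle K(1) \<eta> by (intro order_trans[OF K(2)] mult_mono nf d4(2)) auto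
      have 2: "norm (prod (f u - f x) (M ?d)) \<le> \<eta> * (Kg * norm ?d) * K"
        using u \<eta> K(1) g(2) by (intro order_trans[OF K(2)] mult_mono fu g(4)) auto
      have 3: "norm (prod (f u - f v - L ?d) (g v)) \<le> (\<eta> * norm ?d) * (norm (g x) + 1) * K"
        using u v dle K(1) \<eta> by (intro order_trans[OF K(2)] mult_mono ng d3(2)) auto
      have 4: "norm (prod (L ?d) (g v - g x)) \<le> (Kf * norm ?d) * \<eta> * K"
        using v \<eta> K(1) f(2) by (intro order_trans[OF K(2)] mult_mono gu f(4)) auto
      have "norm (prod (f u) (g u) - prod (f v) (g v) - (prod (f x) (M ?d) + prod (L ?d) (g x)))
          \<le> (norm (f x) + 1) * (\<eta> * norm ?d) * K + \<eta> * (Kg * norm ?d) * K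
            + (\<eta> * norm ?d) * (norm (g x) + 1) * K + (Kf * norm ?d) * \<eta> * K"
        unfolding e by (intro norm_triangle_mono 1 2 3 4)
      also have "\<dots> = \<eta> * (K * C) * norm ?d" by (simp add: C_def algebra_simps)
      also have "\<eta> * (K * C) = \<epsilon>" using K C by (simp add: \<eta>_def)
      finally show ?thesis .
    qed
    with \<delta> show "\<exists>\<delta>>0. \<forall>u v. norm (u - x) < \<delta> \<longrightarrow> norm (v - x) < \<delta> \<longrightarrow>
      norm (prod (f u) (g u) - prod (f v) (g v) - (prod (f x) (M (u - v)) + prod (L (u - v)) (g x))) \<le> \<epsilon> * norm (u - v)"
      by blast
  qed
  then show ?thesis by (auto simp: strictly_differentiable_def)
qed

lemmas strict_mult [strict_intros] = bounded_bilinear.strict_bilinear[OF bounded_bilinear_mult]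
lemmas strict_scaleR [strict_intros] = bounded_bilinear.strict_bilinear[OF bounded_bilinear_scaleR]

lemma strict_Pair [strict_intros]:
  assumes "strictly_differentiable f x" "strictly_differentiable g x"
  shows "strictly_differentiable (\<lambda>u. (f u, g u)) x"
proof -
  have "strictly_differentiable (\<lambda>u. (f u, 0) + (0, g u)) x"
    by (intro strict_add strict_compose_linear[OF _ assms(1)] strict_compose_linear[OF _ assms(2)]
        bounded_linear_Pair bounded_linear_ident bounded_linear_zero)
  then show ?thesis by simp
qed

text \<open>Identifies a derivative that is only known to exist: its value at v is an ordinary
  derivative in one real variable.\<close>

lemma has_strict_derivative_directional:
  assumes "has_strict_derivative f L x"
  shows "((\<lambda>t. f (x + t *\<^sub>R v)) has_vector_derivative L v) (at 0)"
proof (cases "v = 0")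
  case True
  have "bounded_linear L" using assms by (simp add: has_strict_derivative_def)
  then have "L v = 0" using True by (simp add: linear_simps)
  then show ?thesis using True by simp
next
  case False
  have lin: "bounded_linear L" using assms by (simp add: has_strict_derivative_def)
  show ?thesis
    unfolding has_vector_derivative_def has_derivative_at'
  proof (intro conjI allI impI)
    show "bounded_linear (\<lambda>t. t *\<^sub>R L v)" by (rule bounded_linear_scaleR_left)
    fix e :: real assume "e > 0"
    then have e: "e / (2 * norm v) > 0" using False by simp
    from has_strict_derivativeD[OF assms this] obtain \<delta> where d: "\<delta> > 0"
      "\<And>u w. norm (u - x) < \<delta> \<Longrightarrow> norm (w - x) < \<delta> \<Longrightarrow> norm (f u - f w - L (u - w)) \<le> e / (2 * norm v) * norm (u - w)"
      by metis
    have "norm (f (x + t *\<^sub>R v) - f (x + 0 *\<^sub>R v) - (t - 0) *\<^sub>R L v) / norm (t - 0) < e"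
      if "0 < norm (t - 0)" "norm (t - 0) < \<delta> / norm v" for t
    proof -
      have "norm (f (x + t *\<^sub>R v) - f x - L (x + t *\<^sub>R v - x)) \<le> e / (2 * norm v) * norm (x + t *\<^sub>R v - x)"
        using that False d(1) by (intro d(2)) (auto simp: field_simps)
      then have "norm (f (x + t *\<^sub>R v) - f x - t *\<^sub>R L v) \<le> e / 2 * \<bar>t\<bar>"
        using False lin by (simp add: linear_simps)
      moreover have "e / 2 * \<bar>t\<bar> < e * \<bar>t\<bar>" using that \<open>e > 0\<close> by simp
      ultimately show ?thesis using that by (simp add: divide_less_eq)
    qed
    moreover have "\<delta> / norm v > 0" using d False by simp
    ultimately show "\<exists>d>0. \<forall>t. 0 < norm (t - 0) \<and> norm (t - 0) < d \<longrightarrow>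
        norm (f (x + t *\<^sub>R v) - f (x + 0 *\<^sub>R v) - (t - 0) *\<^sub>R L v) / norm (t - 0) < e"
      by blast
  qed
qed

text \<open>The zero set is only asserted to be a graph inside the closed subspace \<open>E\<close>; \<open>L\<close> need not be
  invertible outside it.\<close>

theorem implicit_function_strict:
  fixes \<Psi> :: "'p::real_normed_vector \<times> 'z::banach \<Rightarrow> 'z"
  assumes D: "has_strict_derivative \<Psi> L (p0, z0)" and zero: "\<Psi> (p0, z0) = 0"
    and E: "subspace E" "closed E" "z0 \<in> E"
    and L: "\<And>z. z \<in> E \<Longrightarrow> L (0, z) = z"
    and P: "\<And>p z. p \<in> P \<Longrightarrow> z \<in> E \<Longrightarrow> \<Psi> (p, z) \<in> E"
  obtains r \<delta> C \<gamma> where "r > 0" "\<delta> > 0" "C > 0"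
    "\<And>p. p \<in> P \<Longrightarrow> norm (p - p0) < \<delta> \<Longrightarrow> \<gamma> p \<in> E \<and> norm (\<gamma> p - z0) < r \<and> \<Psi> (p, \<gamma> p) = 0"
    "\<And>p z. p \<in> P \<Longrightarrow> norm (p - p0) < \<delta> \<Longrightarrow> z \<in> E \<Longrightarrow> norm (z - z0) < r \<Longrightarrow> \<Psi> (p, z) = 0 \<Longrightarrow> z = \<gamma> p"
    "\<And>p q. p \<in> P \<Longrightarrow> norm (p - p0) < \<delta> \<Longrightarrow> q \<in> P \<Longrightarrow> norm (q - p0) < \<delta> \<Longrightarrow>
       norm (\<gamma> p - \<gamma> q) \<le> C * norm (p - q)"
proof -
  have lin: "bounded_linear L" using D by (simp add: has_strict_derivative_def)
  then obtain K where K: "K > 0" "\<And>y. norm (L y) \<le> norm y * K"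
    using bounded_linear.pos_bounded by blast
  have "(1/2 :: real) > 0" by simp
  from has_strict_derivativeD[OF D this] obtain \<eta> where \<eta>: "\<eta> > 0"
    "\<And>u v. norm (u - (p0, z0)) < \<eta> \<Longrightarrow> norm (v - (p0, z0)) < \<eta> \<Longrightarrow>
        norm (\<Psi> u - \<Psi> v - L (u - v)) \<le> 1/2 * norm (u - v)" by metis
  define r where "r = \<eta> / 2"
  \<comment> \<open>The factor 2 (K + 1) ensures that moving p displaces the image of z0 by less
    than r / 2, which leaves the other half of the radius to the contraction.\<close>
  define \<delta> where "\<delta> = min (\<eta> / 2) (r / (2 * (K + 1)))"
  have r: "r > 0" using \<eta> by (simp add: r_def)
  then have "\<delta> > 0" using \<eta>(1) K(1) by (simp add: \<delta>_def)
  moreover have "\<delta> \<le> \<eta> / 2" and "\<delta> \<le> r / (2 * (K + 1))"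
    unfolding \<delta>_def by (rule min.cobounded1, rule min.cobounded2)
  ultimately have \<delta>: "\<delta> > 0" "\<delta> \<le> \<eta> / 2" and "\<delta> \<le> r / (2 * (K + 1))" by auto
  then have \<delta>3: "\<delta> * (K + 1) \<le> r / 2"
    using pos_le_divide_eq[of "2 * (K + 1)" \<delta> r] K(1) by (simp add: algebra_simps)
  have near: "norm ((p, z) - (p0, z0)) < \<eta>" if "norm (p - p0) < \<delta>" "norm (z - z0) \<le> r" for p z
    using norm_Pair_le[of "p - p0" "z - z0"] that \<delta> by (simp add: r_def)
  have key: "norm (\<Psi> (p, z) - \<Psi> (q, w) - L (p - q, z - w)) \<le> 1/2 * (norm (p - q) + norm (z - w))"
    if "norm (p - p0) < \<delta>" "norm (z - z0) \<le> r" "norm (q - p0) < \<delta>" "norm (w - z0) \<le> r" for p q z w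
    using \<eta>(2)[OF near[OF that(1,2)] near[OF that(3,4)]] norm_Pair_le[of "p - q" "z - w"] by simp
  \<comment> \<open>One estimate serves twice: with p = q and two zeros it gives uniqueness, with
    two parameters the Lipschitz bound for the solution map.\<close>
  have lip: "norm (z - w) \<le> 2 * (norm (\<Psi> (p, z) - \<Psi> (q, w)) + (K + 1/2) * norm (p - q))"
    if "norm (p - p0) < \<delta>" "norm (z - z0) \<le> r" "norm (q - p0) < \<delta>" "norm (w - z0) \<le> r"
      "z \<in> E" "w \<in> E" for p q z w
  proof -
    have "z - w \<in> E" using that E by (simp add: subspace_diff)
    then have "L (p - q, z - w) = L (p - q, 0) + (z - w)"
      using L[of "z - w"] linear_add[OF bounded_linear.linear[OF lin], of "(p - q, 0)" "(0, z - w)"] by simp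
    then have "z - w = (\<Psi> (p, z) - \<Psi> (q, w)) - (\<Psi> (p, z) - \<Psi> (q, w) - L (p - q, z - w)) - L (p - q, 0)"
      by simp
    moreover have "norm (A - B - D) \<le> norm A + norm B + norm D" for A B D :: 'z
      using norm_triangle_ineq4[of "A - B" D] norm_triangle_ineq4[of A B] by linarith
    ultimately have "norm (z - w) \<le> norm (\<Psi> (p, z) - \<Psi> (q, w))
        + norm (\<Psi> (p, z) - \<Psi> (q, w) - L (p - q, z - w)) + norm (L (p - q, 0))"
      by metis
    with key[OF that(1-4)] K(2)[of "(p - q, 0)"] show ?thesis by (simp add: algebra_simps)
  qed
  \<comment> \<open>On E the map L (0, .) is the identity, so z - \<Psi> (p, z) contracts with
    factor 1/2 and needs no inverse of the derivative; it maps E into itself because \<Psi>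
    does.\<close>
  have ex: "\<exists>z. z \<in> E \<and> norm (z - z0) < r \<and> \<Psi> (p, z) = 0" if p: "p \<in> P" "norm (p - p0) < \<delta>" for p
  proof -
    let ?T = "\<lambda>z. z - \<Psi> (p, z)"
    have sc: "norm (?T z - ?T w) \<le> 1/2 * norm (z - w)"
      if "z \<in> E" "w \<in> E" "norm (z - z0) \<le> r" "norm (w - z0) \<le> r" for z w
    proof -
      have "z - w \<in> E" using that E by (simp add: subspace_diff)
      then have "?T z - ?T w = - (\<Psi> (p, z) - \<Psi> (p, w) - L (p - p, z - w))" using L by simp
      then have "norm (?T z - ?T w) = norm (\<Psi> (p, z) - \<Psi> (p, w) - L (p - p, z - w))"
        by (metis norm_minus_cancel)
      then show ?thesis using key[of p z p w] that p by simp
    qed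
    have T0: "norm (?T z0 - z0) \<le> (K + 1/2) * norm (p - p0)"
    proof -
      have "norm (\<Psi> (p, z0) - \<Psi> (p0, z0) - L (p - p0, z0 - z0)) \<le> 1/2 * (norm (p - p0) + norm (z0 - z0))"
        using p \<delta> r by (intro key) auto
      then have "norm (\<Psi> (p, z0)) \<le> norm (L (p - p0, 0)) + 1/2 * norm (p - p0)"
        using zero norm_triangle_sub[of "\<Psi> (p, z0)" "L (p - p0, 0)"] by simp
      with K(2)[of "(p - p0, 0)"] show ?thesis by (simp add: algebra_simps)
    qed
    have T0': "norm (?T z0 - z0) < r / 2"
    proof (cases "norm (p - p0) = 0")
      case False
      then have "(K + 1/2) * norm (p - p0) < (K + 1) * norm (p - p0)" by (intro mult_strict_right_mono) auto
      also have "\<dots> \<le> \<delta> * (K + 1)" using p K by (simp add: mult.commute)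
      finally show ?thesis using \<delta>3 T0 by linarith
    qed (use T0 r in auto)
    have into: "norm (?T z - z0) < r" if "z \<in> E" "norm (z - z0) \<le> r" for z
    proof -
      have "norm (?T z - z0) \<le> norm (?T z - ?T z0) + norm (?T z0 - z0)"
        using norm_triangle_ineq[of "?T z - ?T z0" "?T z0 - z0"] by simp
      also have "\<dots> < r" using sc[OF that(1) E(3) that(2)] T0' that r by simp
      finally show ?thesis .
    qed
    have "\<exists>!z\<in>E \<inter> cball z0 r. ?T z = z"
    proof (rule Banach_fix[where c = "1/2"])
      show "complete (E \<inter> cball z0 r)" using E by (simp add: complete_eq_closed closed_Int)
      show "E \<inter> cball z0 r \<noteq> {}" using E r by (metis IntI centre_in_cball empty_iff less_imp_le)
      show "?T ` (E \<inter> cball z0 r) \<subseteq> E \<inter> cball z0 r"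
      proof (rule image_subsetI)
        fix z assume z: "z \<in> E \<inter> cball z0 r"
        then have "norm (z - z0) \<le> r" by (simp add: dist_norm norm_minus_commute)
        with into[of z] z have "norm (?T z - z0) \<le> r" by auto
        then show "?T z \<in> E \<inter> cball z0 r"
          using z P[OF p(1)] E(1) by (auto simp: dist_norm norm_minus_commute intro: subspace_diff)
      qed
      show "dist (?T z) (?T w) \<le> 1/2 * dist z w"
        if "z \<in> E \<inter> cball z0 r" "w \<in> E \<inter> cball z0 r" for z w
        unfolding dist_norm
        by (rule sc) (use that in \<open>auto simp: dist_norm norm_minus_commute\<close>)
    qed auto
    then obtain z where z: "z \<in> E" "norm (z - z0) \<le> r" "?T z = z"
      by (auto simp: dist_norm norm_minus_commute)
    with into[OF z(1,2)] show ?thesis by (intro exI[of _ z]) auto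
  qed
  define \<gamma> where "\<gamma> p = (SOME z. z \<in> E \<and> norm (z - z0) < r \<and> \<Psi> (p, z) = 0)" for p
  have \<gamma>: "\<gamma> p \<in> E \<and> norm (\<gamma> p - z0) < r \<and> \<Psi> (p, \<gamma> p) = 0" if "p \<in> P" "norm (p - p0) < \<delta>" for p
    unfolding \<gamma>_def by (rule someI_ex[OF ex[OF that]])
  show ?thesis
  proof (rule that[OF r \<delta>(1), of "2 * (K + 1/2)" \<gamma>])
    show "z = \<gamma> p" if "p \<in> P" "norm (p - p0) < \<delta>" "z \<in> E" "norm (z - z0) < r" "\<Psi> (p, z) = 0" for p z
      using lip[of p z p "\<gamma> p"] \<gamma>[OF that(1,2)] that by simp
    show "norm (\<gamma> p - \<gamma> q) \<le> 2 * (K + 1/2) * norm (p - q)"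
      if "p \<in> P" "norm (p - p0) < \<delta>" "q \<in> P" "norm (q - p0) < \<delta>" for p q
      using lip[of p "\<gamma> p" q "\<gamma> q"] \<gamma>[OF that(1,2)] \<gamma>[OF that(3,4)] that by (simp add: mult.assoc[symmetric])
  qed (use \<gamma> K in auto)
qed

section \<open>Fourier multipliers and parity\<close>

text \<open>\<open>Wien\<close> is unspecified outside the weighted summable sequences, so the
  lemmas on \<open>fmult\<close> carry a uniform bound on the symbol.\<close>

definition fmult :: "(int \<Rightarrow> real) \<Rightarrow> 'm::finite wien \<Rightarrow> 'm wien" where
  "fmult \<phi> a = Wien (\<lambda>k. \<phi> k * coef a k)"

lemma coef_fmult:
  assumes "\<And>k. \<bar>\<phi> k\<bar> \<le> C"
  shows "coef (fmult \<phi> a) k = \<phi> k * coef a k"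
proof -
  have "wsummable TYPE('a) (\<lambda>k. \<phi> k * coef a k)"
    by (rule wsummable_compare[OF coef_wsummable[of a], where C = C])
      (use assms in \<open>auto simp: abs_mult intro!: mult_right_mono\<close>)
  then show ?thesis by (simp add: fmult_def coef_Wien)
qed

lemma bounded_linear_fmult:
  assumes "\<And>k. \<bar>\<phi> k\<bar> \<le> C"
  shows "bounded_linear (fmult \<phi> :: 'm::finite wien \<Rightarrow> 'm wien)"
proof (rule bounded_linear_intro[where K = C])
  note c = coef_fmult[of \<phi>, OF assms]
  show "fmult \<phi> (a + b) = fmult \<phi> a + fmult \<phi> b" for a b :: "'m wien"
    by (rule wien_eqI) (simp add: c algebra_simps)
  show "fmult \<phi> (r *\<^sub>R a) = r *\<^sub>R fmult \<phi> a" for a :: "'m wien" and r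
    by (rule wien_eqI) (simp add: c)
  show "norm (fmult \<phi> a) \<le> norm a * C" for a :: "'m wien"
    unfolding norm_wien_def infsum_cmult_left'[symmetric]
  proof (rule infsum_mono[OF norm_summable summable_on_cmult_left[OF norm_summable]])
    fix k
    have "\<bar>\<phi> k\<bar> * (\<bar>coef a k\<bar> * wgt TYPE('m) k) \<le> C * (\<bar>coef a k\<bar> * wgt TYPE('m) k)"
      using wgt_pos[of k, where 'm = 'm] by (intro mult_right_mono assms) auto
    then show "\<bar>coef (fmult \<phi> a) k\<bar> * wgt TYPE('m) k \<le> \<bar>coef a k\<bar> * wgt TYPE('m) k * C"
      by (simp add: c abs_mult mult_ac)
  qed
qed

section \<open>Parity of coefficient sequences\<close>

definition evn :: "'m::finite wien \<Rightarrow> bool" where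
  "evn a \<longleftrightarrow> (\<forall>k. coef a (- k) = coef a k)"

text \<open>An odd real function has Fourier coefficients \<i> a_k with a real and odd. Storing only
  a keeps all sequences real; the price is the sign \<i>^2 = -1 in the product of two odd
  elements.\<close>

definition od :: "'m::finite wien \<Rightarrow> bool" where
  "od a \<longleftrightarrow> (\<forall>k. coef a (- k) = - coef a k)"

lemma conv_reflect: "conv f g (- k) = conv (\<lambda>j. f (- j)) (\<lambda>j. g (- j)) k"
proof -
  have bij: "bij_betw (uminus :: int \<Rightarrow> int) UNIV UNIV"
    by (rule bij_betwI[where g = uminus]) auto
  show ?thesis
    unfolding conv_def using infsum_reindex_bij_betw[OF bij, of "\<lambda>j. f j * g (- k - j)"] by simp
qed

lemma conv_minus_left: "conv (\<lambda>j. - f j) g k = - conv f g k"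
  and conv_minus_right: "conv f (\<lambda>j. - g j) k = - conv f g k"
  for f g :: "int \<Rightarrow> 'a::{real_normed_field, banach}"
  by (simp_all add: conv_def infsum_uminus)

lemma evn_mult: "evn a \<Longrightarrow> evn b \<Longrightarrow> evn (a * b)"
  and evn_mult_od: "od a \<Longrightarrow> od b \<Longrightarrow> evn (a * b)"
  and od_mult: "od a \<Longrightarrow> evn b \<Longrightarrow> od (a * b)"
  and od_mult': "evn a \<Longrightarrow> od b \<Longrightarrow> od (a * b)"
  by (simp_all add: evn_def od_def coef_mult conv_reflect conv_minus_left conv_minus_right)

lemma evn_arith: "evn a \<Longrightarrow> evn b \<Longrightarrow> evn (a + b)" "evn a \<Longrightarrow> evn b \<Longrightarrow> evn (a - b)"
  "evn a \<Longrightarrow> evn (r *\<^sub>R a)" "evn a \<Longrightarrow> evn (- a)" "evn 1" "evn 0"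
  by (auto simp: evn_def coef_1)

lemma od_arith: "od a \<Longrightarrow> od b \<Longrightarrow> od (a + b)" "od a \<Longrightarrow> od b \<Longrightarrow> od (a - b)"
  "od a \<Longrightarrow> od (r *\<^sub>R a)" "od a \<Longrightarrow> od (- a)" "od 0"
  by (auto simp: od_def)

lemmas parity_intros = evn_mult evn_mult_od od_mult od_mult' evn_arith od_arith

lemma od_coef_0: "od a \<Longrightarrow> coef a 0 = 0"
  by (auto simp: od_def dest: spec[of _ 0])

text \<open>Up to the suppressed \<i>, this is integration with mean zero on odd elements and minus
  integration on even elements of mean zero. Division by zero yields 0, so mode 0 is
  annihilated.\<close>

definition Nop :: "'m::finite wien \<Rightarrow> 'm wien" where
  "Nop = fmult (\<lambda>k. 1 / real_of_int k)"

text \<open>The strip transform has symbol -\<i> coth (k h); acting on \<i> y it becomes the real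
  symbol coth (k h) acting on y. The value \<open>coth 0 = 0\<close> from division by zero drops
  mode 0.\<close>

definition Mop :: "real \<Rightarrow> 'm::finite wien \<Rightarrow> 'm wien" where
  "Mop h = fmult (\<lambda>k. coth (real_of_int k * h))"

lemma inverse_int_bound: "\<bar>1 / real_of_int k\<bar> \<le> 1"
  by (cases "k = 0") (auto simp: abs_divide divide_le_eq_1)

lemma coth_0 [simp]: "coth 0 = 0"
  by (simp add: coth_def)

lemma coth_minus [simp]: "coth (- x) = - coth x"
  by (simp add: coth_def)

lemma coth_eq: "x \<noteq> 0 \<Longrightarrow> coth x = 1 + 2 / (exp (2 * x) - 1)"
proof -
  assume x: "x \<noteq> 0"
  have "sinh x * (2 * exp x) = exp (2 * x) - 1" "cosh x * (2 * exp x) = exp (2 * x) + 1"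
    by (simp_all add: sinh_field_def cosh_field_def exp_minus field_simps exp_add[symmetric])
  then have "coth x = (exp (2 * x) + 1) / (exp (2 * x) - 1)"
    unfolding coth_def by (metis exp_not_eq_zero mult_divide_mult_cancel_right mult_eq_0_iff zero_neq_numeral)
  with x show ?thesis by (simp add: field_simps)
qed

text \<open>The bound 1 / x makes the symbol of \<open>Mop\<close> bounded; the bound 1 / x^2 makes
  the difference between the strip transform and plain conjugation an absolutely convergent
  series.\<close>

lemma coth_near_1:
  assumes "x > 0"
  shows "0 \<le> coth x - 1" "coth x - 1 \<le> 1 / x" "coth x - 1 \<le> 1 / x\<^sup>2"
proof -
  have e: "1 + 2 * x + (2 * x)\<^sup>2 / 2 \<le> exp (2 * x)"
    using assms by (intro exp_lower_Taylor_quadratic) auto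
  have c: "coth x - 1 = 2 / (exp (2 * x) - 1)" using assms coth_eq[of x] by simp
  have p: "exp (2 * x) - 1 > 0" using assms by simp
  show "0 \<le> coth x - 1" unfolding c using p by simp
  have "(2 * x)\<^sup>2 / 2 \<ge> 0" by simp
  then have "exp (2 * x) - 1 \<ge> 2 * x" using e by linarith
  then have "2 / (exp (2 * x) - 1) \<le> 2 / (2 * x)" using assms by (intro divide_left_mono) auto
  then show "coth x - 1 \<le> 1 / x" unfolding c by simp
  have "exp (2 * x) - 1 \<ge> 2 * x\<^sup>2" using e assms by (simp add: power_mult_distrib)
  then have "2 / (exp (2 * x) - 1) \<le> 2 / (2 * x\<^sup>2)" using assms p by (intro divide_left_mono) auto
  then show "coth x - 1 \<le> 1 / x\<^sup>2" unfolding c by simp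
qed

lemma coth_bound:
  assumes "h > 0"
  shows "\<bar>coth (real_of_int k * h)\<bar> \<le> 1 + 1 / h"
proof -
  have pos: "\<bar>coth (real_of_int k * h)\<bar> \<le> 1 + 1 / h" if "k > 0" for k
  proof -
    have "1 * h \<le> real_of_int k * h" using that assms by (intro mult_right_mono) auto
    then have "1 / (real_of_int k * h) \<le> 1 / h" using assms by (intro divide_left_mono) auto
    moreover have "real_of_int k * h > 0" using that assms by simp
    ultimately show ?thesis using coth_near_1[of "real_of_int k * h"] by linarith
  qed
  consider "k > 0" | "k = 0" | "- k > 0" by linarith
  then show ?thesis
  proof cases
    case 3
    from pos[OF this] show ?thesis by simp
  qed (use pos assms in auto)
qed

lemma coef_Nop [simp]: "coef (Nop a) k = coef a k / real_of_int k"
  unfolding Nop_def by (subst coef_fmult[OF inverse_int_bound]) simp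

lemma coef_Mop: "h > 0 \<Longrightarrow> coef (Mop h a) k = coth (real_of_int k * h) * coef a k"
  unfolding Mop_def by (subst coef_fmult[OF coth_bound]) simp_all

lemma bounded_linear_Nop: "bounded_linear (Nop :: 'm::finite wien \<Rightarrow> _)"
  unfolding Nop_def by (rule bounded_linear_fmult[OF inverse_int_bound])

lemma bounded_linear_Mop: "h > 0 \<Longrightarrow> bounded_linear (Mop h :: 'm::finite wien \<Rightarrow> _)"
  unfolding Mop_def by (rule bounded_linear_fmult[OF coth_bound])

lemma Nop_parity: "od a \<Longrightarrow> evn (Nop a)" "evn a \<Longrightarrow> od (Nop a)"
  by (auto simp: od_def evn_def)

lemma Mop_parity: "h > 0 \<Longrightarrow> od a \<Longrightarrow> evn (Mop h a)"
  by (auto simp: od_def evn_def coef_Mop)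

lemma closed_evn: "closed {a :: 'm::finite wien. evn a}" and closed_od: "closed {a :: 'm::finite wien. od a}"
proof -
  have c: "continuous_on UNIV (\<lambda>a :: 'm wien. coef a k)" for k
    by (intro linear_continuous_on bounded_linear_coef)
  show "closed {a :: 'm wien. evn a}" unfolding evn_def
    by (intro closed_Collect_all closed_Collect_eq c)
  show "closed {a :: 'm wien. od a}" unfolding od_def
    by (intro closed_Collect_all closed_Collect_eq c continuous_intros)
qed

section \<open>The rescaled system\<close>

locale wave =
  fixes g h A B \<beta> \<sigma> :: real
  assumes g_pos: "g > 0" and h_pos: "h > 0" and B_pos: "B > 0" and \<sigma>_pos: "\<sigma> > 0"
begin

text \<open>The unknowns are \<open>w' = \<i> y\<close> (so \<open>w = N y\<close> and \<open>C w' = M y\<close>) and \<open>k\<close>, where \<open>1 + k\<close> stands for the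
  inverse square root of the conformal factor. Everything is evaluated at \<open>(l, s m, s y, s k)\<close> and
  divided by \<open>s\<close>, so that \<open>s = 0\<close> gives the linearization.\<close>

definition J1 :: "real \<Rightarrow> 'm::finite wien \<Rightarrow> 'm wien" where
  "J1 s y = 2 *\<^sub>R Mop h y + s *\<^sub>R (Mop h y * Mop h y - y * y)"

definition K2 :: "real \<Rightarrow> 'm::finite wien \<Rightarrow> 'm wien" where
  "K2 s k = 2 *\<^sub>R k + s *\<^sub>R (k * k)"

text \<open>Here 1 + s J1 is the conformal factor and 1 + s K2 is (1 + s k)^2. Their product minus
  1, divided by s, is this expression, so its vanishing makes 1 + s k an inverse square root of the
  conformal factor. In J1 the square of w' = \<i> y enters as -(y * y).\<close>

definition E1 :: "real \<Rightarrow> 'm::finite wien \<Rightarrow> 'm wien \<Rightarrow> 'm wien" where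
  "E1 s y k = K2 s k + J1 s y + s *\<^sub>R (K2 s k * J1 s y)"

text \<open>The base of the square in F equals l + s Q1; means of powers of w appear as zeroth
  coefficients times the unit.\<close>

definition Q1 :: "real \<Rightarrow> 'm::finite wien \<Rightarrow> 'm wien" where
  "Q1 s y = (- \<beta>) *\<^sub>R ((s * coef (Nop y * Nop y) 0 * (1 / (2 * h))) *\<^sub>R 1 - Nop y
        + s *\<^sub>R Mop h (Nop y * y) - s *\<^sub>R (Nop y * Mop h y))
     - (g * A / 2) *\<^sub>R ((s * s * coef (Nop y * Nop y * Nop y) 0 * (1 / (3 * h))) *\<^sub>R 1
        - (s * coef (Nop y * Nop y) 0) *\<^sub>R 1 - s *\<^sub>R (Nop y * Nop y) - (2 * h) *\<^sub>R Nop y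
        + (s * s) *\<^sub>R Mop h (Nop y * Nop y * y) - (s * s) *\<^sub>R (Nop y * Nop y * Mop h y)
        + (2 * h * s) *\<^sub>R Mop h (Nop y * y) - (2 * h * s) *\<^sub>R (Nop y * Mop h y))"

text \<open>The right-hand side of the equation for the sine, divided by s, with the inverse
  conformal factor written as 1 + s K2. The term l * l of the expanded square cancels against the
  one subtracted from it, which permits the division.\<close>

definition R :: "real \<Rightarrow> real \<Rightarrow> real \<Rightarrow> 'm::finite wien \<Rightarrow> 'm wien \<Rightarrow> 'm wien" where
  "R s l m y k = (1 / (2 * \<sigma>)) *\<^sub>R ((1 + s *\<^sub>R Mop h y) *
      ((l * l) *\<^sub>R K2 s k + (1 + s *\<^sub>R K2 s k) * ((2 * l) *\<^sub>R Q1 s y + s *\<^sub>R (Q1 s y * Q1 s y))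
        - m *\<^sub>R 1 + (2 * g * B) *\<^sub>R Nop y))"

text \<open>Subtracting a multiple of the first equation removes \<open>k\<close> from the linearization of the others.\<close>

definition R' :: "real \<Rightarrow> real \<Rightarrow> real \<Rightarrow> 'm::finite wien \<Rightarrow> 'm wien \<Rightarrow> 'm wien" where
  "R' s l m y k = R s l m y k - (l * l * (1 / (2 * \<sigma>))) *\<^sub>R E1 s y k"

text \<open>Coefficient form of S' = R. Since S stands for \<i> (y + s y k), mode j of the equation
  says that j times this coefficient is minus that of R, whence the plus sign. R' agrees with R as
  soon as E1 vanishes.\<close>

definition E2 :: "real \<Rightarrow> real \<Rightarrow> real \<Rightarrow> 'm::finite wien \<Rightarrow> 'm wien \<Rightarrow> 'm wien" where
  "E2 s l m y k = y + s *\<^sub>R (y * k) + Nop (R' s l m y k)"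

text \<open>Mode 0 of S' = R, which \<open>Nop\<close> discards: periodicity of S forces the
  right-hand side to have mean zero.\<close>

definition E3 :: "real \<Rightarrow> real \<Rightarrow> real \<Rightarrow> 'm::finite wien \<Rightarrow> 'm wien \<Rightarrow> real" where
  "E3 s l m y k = coef (R' s l m y k) 0"

section \<open>Homogeneity of the system in the amplitude\<close>

lemmas Nop_linear = linear_simps[OF bounded_linear_Nop]
lemmas Mop_linear = linear_simps[OF bounded_linear_Mop[OF h_pos]]

lemma J1_scale: "J1 1 (s *\<^sub>R y) = s *\<^sub>R J1 s y"
  by (simp add: J1_def Mop_linear algebra_simps)

lemma K2_scale: "K2 1 (s *\<^sub>R k) = s *\<^sub>R K2 s k"
  by (simp add: K2_def algebra_simps)

lemma E1_scale: "E1 1 (s *\<^sub>R y) (s *\<^sub>R k) = s *\<^sub>R E1 s y k"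
  by (simp add: E1_def J1_scale K2_scale algebra_simps)

lemma Q1_scale: "Q1 1 (s *\<^sub>R y) = s *\<^sub>R Q1 s y"
  by (simp add: Q1_def Nop_linear Mop_linear scaleR_add_right scaleR_diff_right mult_ac)

lemma R_scale: "R 1 l (s * m) (s *\<^sub>R y) (s *\<^sub>R k) = s *\<^sub>R R s l m y k"
proof -
  have "(l * l) *\<^sub>R s *\<^sub>R K + (1 + s *\<^sub>R K) * ((2 * l) *\<^sub>R s *\<^sub>R Q + s *\<^sub>R Q * (s *\<^sub>R Q)) - (s * m) *\<^sub>R 1 + c *\<^sub>R s *\<^sub>R N
      = s *\<^sub>R ((l * l) *\<^sub>R K + (1 + s *\<^sub>R K) * ((2 * l) *\<^sub>R Q + s *\<^sub>R (Q * Q)) - m *\<^sub>R 1 + c *\<^sub>R N)"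
    for K Q N :: "'a wien" and c
    unfolding scaleR_conv_of_real of_real_mult by (simp only: ring_distribs mult_ac mult_1 mult_1_right)
  then show ?thesis
    unfolding R_def K2_scale Q1_scale Nop_linear Mop_linear scaleR_one by simp
qed

lemma R'_scale: "R' 1 l (s * m) (s *\<^sub>R y) (s *\<^sub>R k) = s *\<^sub>R R' s l m y k"
  unfolding R'_def R_scale E1_scale by (simp add: scaleR_diff_right mult_ac)

lemma E2_scale: "E2 1 l (s * m) (s *\<^sub>R y) (s *\<^sub>R k) = s *\<^sub>R E2 s l m y k"
  unfolding E2_def R'_scale Nop_linear by (simp add: scaleR_add_right)

lemma E3_scale: "E3 1 l (s * m) (s *\<^sub>R y) (s *\<^sub>R k) = s * E3 s l m y k"
  unfolding E3_def R'_scale by simp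

section \<open>The linearization and its symbol\<close>

definition bb :: real where "bb = \<beta> + g * A * h"

text \<open>The factor by which the linearized second equation multiplies mode j. It tends to 1 for
  large |j|, since everything except y itself is smoothed by \<open>Nop\<close>; at j = 0 division
  by zero makes it 1.\<close>

definition symb :: "real \<Rightarrow> int \<Rightarrow> real" where
  "symb l j = 1 + ((l * bb + g * B) / real_of_int j - l * l * coth (real_of_int j * h)) / (\<sigma> * real_of_int j)"

lemma E1_0: "E1 0 y k = 2 *\<^sub>R k + 2 *\<^sub>R Mop h y"
  by (simp add: E1_def K2_def J1_def)

lemma Q1_0: "Q1 0 y = bb *\<^sub>R Nop y"
  by (simp add: Q1_def bb_def scaleR_add_left algebra_simps)

lemma R'_0: "R' 0 l m y k = (1 / (2 * \<sigma>)) *\<^sub>R ((2 * (l * bb + g * B)) *\<^sub>R Nop y - (2 * l * l) *\<^sub>R Mop h y - m *\<^sub>R 1)"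
  by (rule wien_eqI)
    (use \<sigma>_pos h_pos in \<open>simp add: R'_def R_def E1_0 Q1_0 K2_def coef_Mop coef_1 field_simps\<close>)

lemma coef_E2_0: "coef (E2 0 l m y k) j = symb l j * coef y j"
  using \<sigma>_pos h_pos by (cases "j = 0") (simp_all add: E2_def R'_0 symb_def coef_Mop coef_1 field_simps)

lemma E3_0: "E3 0 l m y k = - m / (2 * \<sigma>)"
  using h_pos by (simp add: E3_def R'_0 coef_Mop coef_1)

text \<open>Evenness of w means odd y and even k. The system respects this splitting, which allows
  the implicit function theorem to run inside a parity subspace, where the kernel loses its second
  dimension.\<close>

lemma
  assumes "od y" "evn k"
  shows evn_E1: "evn (E1 s y k)" and evn_Q1: "evn (Q1 s y)" and evn_R: "evn (R s l m y k)"
    and evn_R': "evn (R' s l m y k)" and od_E2: "od (E2 s l m y k)"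
proof -
  have y: "evn (Nop y)" "evn (Mop h y)" "evn (y * y)" "od (Nop y * y)"
    using assms Nop_parity Mop_parity[OF h_pos] parity_intros by metis+
  then have y': "od (Nop y * Nop y * y)" using assms parity_intros by metis
  note i = y y' assms Mop_parity[OF h_pos] evn_arith evn_mult
  have J: "evn (J1 s y)" "evn (K2 s k)" unfolding J1_def K2_def by (intro i)+
  then show E: "evn (E1 s y k)" unfolding E1_def by (intro J i)
  show Q: "evn (Q1 s y)" unfolding Q1_def by (intro i)
  show R: "evn (R s l m y k)" unfolding R_def by (intro J Q i)
  show R': "evn (R' s l m y k)" unfolding R'_def by (intro E R i)
  show "od (E2 s l m y k)" unfolding E2_def by (intro R' od_arith od_mult Nop_parity assms)
qed

lemma strict_coef [strict_intros]: "strictly_differentiable f x \<Longrightarrow> strictly_differentiable (\<lambda>u. coef (f u :: 'm::finite wien) k) x"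
  by (rule strict_compose_linear[OF bounded_linear_coef])

lemma strict_Nop [strict_intros]: "strictly_differentiable f x \<Longrightarrow> strictly_differentiable (\<lambda>u. Nop (f u :: 'm::finite wien)) x"
  by (rule strict_compose_linear[OF bounded_linear_Nop])

lemma strict_Mop [strict_intros]: "strictly_differentiable f x \<Longrightarrow> strictly_differentiable (\<lambda>u. Mop h (f u :: 'm::finite wien)) x"
  by (rule strict_compose_linear[OF bounded_linear_Mop[OF h_pos]])

lemma
  fixes y k :: "'p::real_normed_vector \<Rightarrow> 'm::finite wien"
  assumes [strict_intros]: "strictly_differentiable s x" "strictly_differentiable l x" "strictly_differentiable m x"
    "strictly_differentiable y x" "strictly_differentiable k x"
  shows strict_E1: "strictly_differentiable (\<lambda>u. E1 (s u) (y u) (k u)) x"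
    and strict_E2: "strictly_differentiable (\<lambda>u. E2 (s u) (l u) (m u) (y u) (k u)) x"
    and strict_E3: "strictly_differentiable (\<lambda>u. E3 (s u) (l u) (m u) (y u) (k u)) x"
proof -
  have [strict_intros]: "strictly_differentiable (\<lambda>u. J1 (s u) (y u)) x" "strictly_differentiable (\<lambda>u. K2 (s u) (k u)) x"
    unfolding J1_def K2_def by (intro strict_intros)+
  show E [strict_intros]: "strictly_differentiable (\<lambda>u. E1 (s u) (y u) (k u)) x"
    unfolding E1_def by (intro strict_intros)
  have [strict_intros]: "strictly_differentiable (\<lambda>u. Q1 (s u) (y u)) x"
    unfolding Q1_def by (intro strict_intros)
  have [strict_intros]: "strictly_differentiable (\<lambda>u. R' (s u) (l u) (m u) (y u) (k u)) x"
    unfolding R_def R'_def by (intro strict_intros)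
  show "strictly_differentiable (\<lambda>u. E2 (s u) (l u) (m u) (y u) (k u)) x"
    "strictly_differentiable (\<lambda>u. E3 (s u) (l u) (m u) (y u) (k u)) x"
    unfolding E2_def E3_def by (intro strict_intros)+
qed

lemma symb_minus: "symb l (- j) = symb l j"
  by (simp add: symb_def) (metis minus_diff_eq minus_divide_left)

text \<open>The symbol differs from 1 by at most D / |j|, so it is at least 1/2 outside a finite set
  of modes. Inside that set a maximum suffices, zeros of the symbol having inverse 0.\<close>

lemma inverse_symb_bounded: "\<exists>C. \<forall>j. \<bar>inverse (symb l j)\<bar> \<le> C"
proof -
  define D where "D = (\<bar>l * bb + g * B\<bar> + \<bar>l * l\<bar> * (1 + 1 / h)) / \<sigma>"
  have D0: "D \<ge> 0" using \<sigma>_pos h_pos by (simp add: D_def)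
  have dev: "\<bar>symb l j - 1\<bar> \<le> D / \<bar>real_of_int j\<bar>" for j
  proof -
    have "\<bar>(l * bb + g * B) / real_of_int j\<bar> \<le> \<bar>l * bb + g * B\<bar>"
      using mult_left_mono[OF inverse_int_bound[of j], of "\<bar>l * bb + g * B\<bar>"] by (simp add: abs_divide)
    moreover have "\<bar>l * l * coth (real_of_int j * h)\<bar> \<le> \<bar>l * l\<bar> * (1 + 1 / h)"
      unfolding abs_mult[of "l * l"] by (intro mult_left_mono coth_bound h_pos) auto
    ultimately have "\<bar>(l * bb + g * B) / real_of_int j - l * l * coth (real_of_int j * h)\<bar> \<le> \<bar>l * bb + g * B\<bar> + \<bar>l * l\<bar> * (1 + 1 / h)"
      by linarith
    then have "\<bar>(l * bb + g * B) / real_of_int j - l * l * coth (real_of_int j * h)\<bar> / (\<sigma> * \<bar>real_of_int j\<bar>)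
        \<le> (\<bar>l * bb + g * B\<bar> + \<bar>l * l\<bar> * (1 + 1 / h)) / (\<sigma> * \<bar>real_of_int j\<bar>)"
      using \<sigma>_pos by (intro divide_right_mono) auto
    then show ?thesis using \<sigma>_pos by (simp add: symb_def D_def abs_mult abs_divide)
  qed
  define S where "S = {- \<lceil>2 * D\<rceil> .. \<lceil>2 * D\<rceil>}"
  define C where "C = Max ((\<lambda>j. \<bar>inverse (symb l j)\<bar>) ` S)"
  have "\<bar>inverse (symb l j)\<bar> \<le> max 2 C" for j
  proof (cases "j \<in> S")
    case True
    then have "\<bar>inverse (symb l j)\<bar> \<le> C" unfolding C_def by (intro Max_ge) (auto simp: S_def)
    then show ?thesis by simp
  next
    case False
    then have "\<bar>j\<bar> > \<lceil>2 * D\<rceil>" by (auto simp: S_def)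
    then have "2 * D < real_of_int \<bar>j\<bar>" by linarith
    then have "D / \<bar>real_of_int j\<bar> \<le> 1 / 2" using D0 by (simp add: field_simps)
    then have "symb l j \<ge> 1 / 2" using dev[of j] by linarith
    then have "\<bar>inverse (symb l j)\<bar> \<le> inverse (1 / 2)"
      using le_imp_inverse_le[of "1/2" "symb l j"] by simp
    then show ?thesis by simp
  qed
  then show ?thesis by blast
qed

text \<open>Inverse of the linearized second equation off its kernel. Because
  \<open>inverse 0 = 0\<close>, the resonant modes are sent to 0.\<close>

definition Vop :: "real \<Rightarrow> 'm::finite wien \<Rightarrow> 'm wien" where
  "Vop l = fmult (\<lambda>j. inverse (symb l j))"

lemma coef_Vop: "coef (Vop l a) j = inverse (symb l j) * coef a j"
  using inverse_symb_bounded[of l] coef_fmult[of "\<lambda>j. inverse (symb l j)"] unfolding Vop_def by blast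

lemma bounded_linear_Vop: "bounded_linear (Vop l :: 'm::finite wien \<Rightarrow> _)"
  using inverse_symb_bounded[of l] bounded_linear_fmult[of "\<lambda>j. inverse (symb l j)"] unfolding Vop_def by blast

end

section \<open>Estimates for small solutions of the coefficient system\<close>

context wave
begin

definition Phi :: "real \<times> real \<times> real \<times> 'm::finite wien \<times> 'm wien \<Rightarrow> real \<times> 'm wien \<times> 'm wien" where
  "Phi = (\<lambda>(s, l, m, y, k). (E3 s l m y k, E2 s l m y k, E1 s y k))"

lemma strict_Phi:
  assumes "strictly_differentiable s x" "strictly_differentiable l x" "strictly_differentiable m x"
    "strictly_differentiable y x" "strictly_differentiable k x"
  shows "strictly_differentiable (\<lambda>u. Phi (s u, l u, m u, y u, k u)) x"
  unfolding Phi_def split_conv by (intro strict_Pair strict_E1[OF assms] strict_E2[OF assms] strict_E3[OF assms])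

text \<open>Valid for every s: for s \<noteq> 0 it exchanges solutions of the original system, s =
  1, with those of the rescaled one, and s = 0 yields the trivial solutions.\<close>

lemma Phi_scale: "Phi (1, l, s * m, s *\<^sub>R y, s *\<^sub>R k) = s *\<^sub>R Phi (s, l, m, y, k)"
  by (simp add: Phi_def E1_scale E2_scale E3_scale)

lemma Phi_trivial: "Phi (1, l, 0, 0, 0) = 0"
  using Phi_scale[of l 0 0 0 0] by (simp only: mult_zero_left scaleR_zero_left)

text \<open>Phi vanishes both at the given solution and at the trivial one with the same l. Strict
  differentiability at l0 therefore bounds the linear part of the solution by a small multiple of
  its size, uniformly for l near l0.\<close>

lemma small_solution_bound:
  fixes l0 \<epsilon> :: real
  assumes "\<epsilon> > 0"
  obtains r where "r > 0" "\<And>l m (y :: 'm::finite wien) k. \<bar>l - l0\<bar> < r \<Longrightarrow> \<bar>m\<bar> < r \<Longrightarrow> norm y < r \<Longrightarrow> norm k < r \<Longrightarrow>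
    Phi (1, l, m, y, k) = 0 \<Longrightarrow> norm (Phi (0, l0, m, y, k)) \<le> \<epsilon> * (\<bar>m\<bar> + norm y + norm k)"
proof -
  let ?f = "\<lambda>u :: real \<times> real \<times> 'm wien \<times> 'm wien. Phi (1, fst u, fst (snd u), fst (snd (snd u)), snd (snd (snd u)))"
  let ?x = "(l0, 0, 0, 0) :: real \<times> real \<times> 'm wien \<times> 'm wien"
  have "strictly_differentiable ?f ?x"
    by (intro strict_Phi strict_const strict_compose_linear[OF bounded_linear_fst]
        strict_compose_linear[OF bounded_linear_snd] strict_id)
  then obtain L where L: "has_strict_derivative ?f L ?x" by (auto simp: strictly_differentiable_def)
  \<comment> \<open>Along the line the system equals t times the rescaled system at t, so its
    derivative at t = 0 is the rescaled system at 0.\<close>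
  have L0: "L (0, m, y, k) = Phi (0, l0, m, y, k)" for m y k
  proof -
    have "strictly_differentiable (\<lambda>t. Phi (t, l0, m, y, k)) (0::real)"
      by (intro strict_Phi strict_const strict_id)
    then obtain M where "has_strict_derivative (\<lambda>t. Phi (t, l0, m, y, k)) M (0::real)"
      by (auto simp: strictly_differentiable_def)
    from has_strict_derivative_directional[OF this, of 1]
    have "((\<lambda>t. Phi (t, l0, m, y, k)) has_vector_derivative M 1) (at 0)" by simp
    then have "((\<lambda>t. t *\<^sub>R Phi (t, l0, m, y, k)) has_vector_derivative (0 *\<^sub>R M 1 + 1 *\<^sub>R Phi (0, l0, m, y, k))) (at 0)"
      by (intro has_vector_derivative_scaleR) (auto intro: derivative_eq_intros)
    moreover have "(\<lambda>t. ?f (?x + t *\<^sub>R (0, m, y, k))) = (\<lambda>t. t *\<^sub>R Phi (t, l0, m, y, k))"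
      by (simp add: Phi_scale fun_eq_iff)
    then have "((\<lambda>t. t *\<^sub>R Phi (t, l0, m, y, k)) has_vector_derivative L (0, m, y, k)) (at 0)"
      using has_strict_derivative_directional[OF L, of "(0, m, y, k)"] by simp
    ultimately show ?thesis using vector_derivative_unique_at by fastforce
  qed
  from has_strict_derivativeD[OF L assms] obtain \<delta> where d: "\<delta> > 0"
    "\<And>u v. norm (u - ?x) < \<delta> \<Longrightarrow> norm (v - ?x) < \<delta> \<Longrightarrow> norm (?f u - ?f v - L (u - v)) \<le> \<epsilon> * norm (u - v)" by metis
  have tri: "norm (a, b, c, e) \<le> \<bar>a\<bar> + \<bar>b\<bar> + norm c + norm e" for a b :: real and c e :: "'m wien"
    using norm_Pair_le[of a "(b, c, e)"] norm_Pair_le[of b "(c, e)"] norm_Pair_le[of c e] by simp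
  show ?thesis
  proof (rule that[of "\<delta> / 4"])
    fix l m and y k :: "'m wien"
    assume a: "\<bar>l - l0\<bar> < \<delta> / 4" "\<bar>m\<bar> < \<delta> / 4" "norm y < \<delta> / 4" "norm k < \<delta> / 4" "Phi (1, l, m, y, k) = 0"
    have "norm (?f (l, m, y, k) - ?f (l, 0, 0, 0) - L ((l, m, y, k) - (l, 0, 0, 0))) \<le> \<epsilon> * norm ((l, m, y, k) - (l, 0, 0, 0))"
    proof (rule d(2))
      show "norm ((l, m, y, k) - ?x) < \<delta>" using a tri[of "l - l0" m y k] by simp
      show "norm ((l, 0, 0, 0) - ?x) < \<delta>" proof -
        have "\<bar>l - l0\<bar> < \<delta>" using a(1) d(1) by linarith
        then show ?thesis using tri[of "l - l0" 0 0 0] by simp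
      qed
    qed
    then have "norm (Phi (0, l0, m, y, k)) \<le> \<epsilon> * norm (0::real, m, y, k)"
      using a(5) by (simp add: Phi_trivial L0)
    also have "\<dots> \<le> \<epsilon> * (\<bar>m\<bar> + norm y + norm k)" using tri[of 0 m y k] assms by (intro mult_left_mono) auto
    finally show "norm (Phi (0, l0, m, y, k)) \<le> \<epsilon> * (\<bar>m\<bar> + norm y + norm k)" .
  qed (use d in auto)
qed

text \<open>The odd element that represents the derivative of cos (n x).\<close>

definition bstar :: "int \<Rightarrow> 'm::finite wien" where
  "bstar n = Wien (\<lambda>j. if \<bar>j\<bar> = n then real_of_int j / 2 else 0)"

lemma coef_bstar: "coef (bstar n :: 'm::finite wien) j = (if \<bar>j\<bar> = n then real_of_int j / 2 else 0)"
proof -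
  have "wsummable TYPE('m) (\<lambda>j. if \<bar>j\<bar> = n then real_of_int j / 2 else 0)"
    unfolding wsummable_def
    by (rule finite_nonzero_values_imp_summable_on, rule finite_subset[of _ "{- \<bar>n\<bar>..\<bar>n\<bar>}"]) (auto split: if_splits)
  then show ?thesis by (simp add: bstar_def coef_Wien)
qed

lemma od_bstar: "od (bstar n)"
  by (simp add: od_def coef_bstar)

text \<open>The second component forced by the linearized first equation 2 k + 2 M y = 0.\<close>

definition kstar :: "int \<Rightarrow> 'm::finite wien" where
  "kstar n = - Mop h (bstar n)"

lemma evn_kstar: "evn (kstar n)"
  unfolding kstar_def by (intro evn_arith Mop_parity h_pos od_bstar)

text \<open>Here z is y without its kernel part; \<open>Vop\<close> recovers it from E2, while m is
  read off E3 and k + M (y - z) is half of E1 minus M z. In the constant, 2 \<sigma> accounts for m,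
  Kv for z and 1 + Km Kv for the last term.\<close>

lemma linear_estimate:
  obtains C where "C > 0" "\<And>m (y :: 'm::finite wien) k z. (\<And>j. symb l0 j = 0 \<Longrightarrow> coef z j = 0) \<Longrightarrow>
    (\<And>j. symb l0 j \<noteq> 0 \<Longrightarrow> coef z j = coef y j) \<Longrightarrow>
    \<bar>m\<bar> + norm z + norm (k + Mop h (y - z)) \<le> C * norm (Phi (0, l0, m, y, k))"
proof -
  obtain Kv where Kv: "Kv > 0" "\<And>a :: 'm wien. norm (Vop l0 a) \<le> norm a * Kv"
    using bounded_linear.pos_bounded[OF bounded_linear_Vop] by blast
  obtain Km where Km: "Km > 0" "\<And>a :: 'm wien. norm (Mop h a) \<le> norm a * Km"
    using bounded_linear.pos_bounded[OF bounded_linear_Mop[OF h_pos]] by blast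
  show ?thesis
  proof (rule that[of "2 * \<sigma> + Kv + 1 + Km * Kv"])
    show "0 < 2 * \<sigma> + Kv + 1 + Km * Kv" using \<sigma>_pos Kv Km by (simp add: add_pos_pos)
    fix m and y k z :: "'m wien"
    assume z: "\<And>j. symb l0 j = 0 \<Longrightarrow> coef z j = 0" "\<And>j. symb l0 j \<noteq> 0 \<Longrightarrow> coef z j = coef y j"
    define N where "N = norm (Phi (0, l0, m, y, k))"
    have N0: "N \<ge> 0" by (simp add: N_def)
    have e3: "norm (E3 0 l0 m y k) \<le> N" and e2: "norm (E2 0 l0 m y k) \<le> N" and e1: "norm (E1 0 y k) \<le> N"
      unfolding N_def Phi_def split_conv
      using norm_fst_le[of "E3 0 l0 m y k" "(E2 0 l0 m y k, E1 0 y k)"]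
        norm_snd_le[of "(E2 0 l0 m y k, E1 0 y k)" "E3 0 l0 m y k"]
        norm_fst_le[of "E2 0 l0 m y k" "E1 0 y k"] norm_snd_le[of "E1 0 y k" "E2 0 l0 m y k"] by linarith+
    have "\<bar>m\<bar> \<le> 2 * \<sigma> * N" using e3 \<sigma>_pos by (simp add: E3_0 abs_divide divide_le_eq mult.commute)
    moreover
    have "z = Vop l0 (E2 0 l0 m y k)"
    proof (rule wien_eqI)
      fix j show "coef z j = coef (Vop l0 (E2 0 l0 m y k)) j"
        using z[of j] by (cases "symb l0 j = 0") (simp_all add: coef_Vop coef_E2_0)
    qed
    then have nz: "norm z \<le> Kv * N"
      using Kv(2)[of "E2 0 l0 m y k"] mult_right_mono[OF e2, of Kv] Kv(1) by (metis less_imp_le mult.commute order_trans)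
    moreover
    have "k + Mop h (y - z) = (1/2) *\<^sub>R E1 0 y k - Mop h z"
      by (simp add: E1_0 Mop_linear scaleR_add_right)
    then have "norm (k + Mop h (y - z)) \<le> norm ((1/2) *\<^sub>R E1 0 y k) + norm (Mop h z)"
      using norm_triangle_ineq4 by metis
    moreover have "norm (Mop h z) \<le> Km * Kv * N"
      using order_trans[OF Km(2)[of z] mult_right_mono[OF nz, of Km]] Km(1) by (simp add: mult_ac)
    ultimately show "\<bar>m\<bar> + norm z + norm (k + Mop h (y - z)) \<le> (2 * \<sigma> + Kv + 1 + Km * Kv) * norm (Phi (0, l0, m, y, k))"
      using e1 N0 unfolding N_def[symmetric] distrib_right by simp
  qed
qed

text \<open>Without kernel the linear estimate controls the whole solution. A residual bound with
  factor 1 / (2 C) then leaves the size at most half of itself, hence zero.\<close>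

proposition regular_isolated:
  assumes "\<And>j. symb l0 j \<noteq> 0"
  obtains r where "r > 0" "\<And>l m (y :: 'm::finite wien) k. \<bar>l - l0\<bar> < r \<Longrightarrow> \<bar>m\<bar> < r \<Longrightarrow> norm y < r \<Longrightarrow> norm k < r \<Longrightarrow>
    Phi (1, l, m, y, k) = 0 \<Longrightarrow> m = 0 \<and> y = 0"
proof -
  obtain C where C: "C > 0" "\<And>m (y :: 'm wien) k z. (\<And>j. symb l0 j = 0 \<Longrightarrow> coef z j = 0) \<Longrightarrow>
    (\<And>j. symb l0 j \<noteq> 0 \<Longrightarrow> coef z j = coef y j) \<Longrightarrow>
    \<bar>m\<bar> + norm z + norm (k + Mop h (y - z)) \<le> C * norm (Phi (0, l0, m, y, k))"
    using linear_estimate by metis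
  have "1 / (2 * C) > 0" using C by simp
  from small_solution_bound[OF this] obtain r where r: "r > 0"
    "\<And>l m (y :: 'm wien) k. \<bar>l - l0\<bar> < r \<Longrightarrow> \<bar>m\<bar> < r \<Longrightarrow> norm y < r \<Longrightarrow> norm k < r \<Longrightarrow>
    Phi (1, l, m, y, k) = 0 \<Longrightarrow> norm (Phi (0, l0, m, y, k)) \<le> 1 / (2 * C) * (\<bar>m\<bar> + norm y + norm k)" by metis
  show ?thesis
  proof (rule that[OF r(1)])
    fix l m and y k :: "'m wien"
    assume a: "\<bar>l - l0\<bar> < r" "\<bar>m\<bar> < r" "norm y < r" "norm k < r" "Phi (1, l, m, y, k) = 0"
    have "\<bar>m\<bar> + norm y + norm k \<le> C * norm (Phi (0, l0, m, y, k))"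
      using C(2)[of y y m k] assms by (simp add: Mop_linear)
    also have "\<dots> \<le> C * (1 / (2 * C) * (\<bar>m\<bar> + norm y + norm k))"
      using C(1) r(2)[OF a] by (intro mult_left_mono) auto
    also have "\<dots> = (\<bar>m\<bar> + norm y + norm k) / 2" using C(1) by simp
    finally have "\<bar>m\<bar> + norm y + norm k \<le> 0" by simp
    then show "m = 0 \<and> y = 0" using norm_ge_zero[of y] norm_ge_zero[of k] by (smt (verit) norm_le_zero_iff)
  qed
qed

text \<open>A small solution of amplitude s stays within e |s| of s times the kernel vector. This is
  what allows division by s later: the quotient is close to the normalized kernel vector.\<close>

lemma critical_estimate:
  assumes n: "n > 0" and crit: "\<And>j. symb l0 j = 0 \<longleftrightarrow> \<bar>j\<bar> = n" and e: "e > 0"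
  obtains r where "r > 0" "\<And>l m (y :: 'm::finite wien) k s. \<bar>l - l0\<bar> < r \<Longrightarrow> \<bar>m\<bar> < r \<Longrightarrow> norm y < r \<Longrightarrow> norm k < r \<Longrightarrow>
    Phi (1, l, m, y, k) = 0 \<Longrightarrow> od y \<Longrightarrow> coef y n = s * real_of_int n / 2 \<Longrightarrow>
    \<bar>m\<bar> + norm (y - s *\<^sub>R bstar n) + norm (k - s *\<^sub>R kstar n) \<le> e * \<bar>s\<bar>"
proof -
  obtain C where C: "C > 0" "\<And>m (y :: 'm wien) k z. (\<And>j. symb l0 j = 0 \<Longrightarrow> coef z j = 0) \<Longrightarrow>
    (\<And>j. symb l0 j \<noteq> 0 \<Longrightarrow> coef z j = coef y j) \<Longrightarrow>
    \<bar>m\<bar> + norm z + norm (k + Mop h (y - z)) \<le> C * norm (Phi (0, l0, m, y, k))"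
    using linear_estimate by metis
  define N where "N = norm (bstar n :: 'm wien) + norm (kstar n :: 'm wien) + 1"
  have N: "N > 0" by (simp add: N_def add_nonneg_pos)
  \<comment> \<open>The first entry lets half of T absorb the error, the second bounds what remains
    by e |s|.\<close>
  define \<epsilon> where "\<epsilon> = min (1 / (2 * C)) (e / (2 * C * N))"
  have \<epsilon>: "\<epsilon> > 0" using C N e by (simp add: \<epsilon>_def)
  have "\<epsilon> \<le> 1 / (2 * C)" "\<epsilon> \<le> e / (2 * C * N)" unfolding \<epsilon>_def by (rule min.cobounded1, rule min.cobounded2)
  then have \<epsilon>C: "C * \<epsilon> \<le> 1 / 2" "2 * (C * \<epsilon>) * N \<le> e"
    using C N pos_le_divide_eq[of "2 * C" \<epsilon> 1] pos_le_divide_eq[of "2 * C * N" \<epsilon> e] by (auto simp: mult_ac)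
  obtain r where r: "r > 0"
    "\<And>l m (y :: 'm wien) k. \<bar>l - l0\<bar> < r \<Longrightarrow> \<bar>m\<bar> < r \<Longrightarrow> norm y < r \<Longrightarrow> norm k < r \<Longrightarrow>
    Phi (1, l, m, y, k) = 0 \<Longrightarrow> norm (Phi (0, l0, m, y, k)) \<le> \<epsilon> * (\<bar>m\<bar> + norm y + norm k)"
    using small_solution_bound[OF \<epsilon>] by metis
  show ?thesis
  proof (rule that[OF r(1)])
    fix l m s and y k :: "'m wien"
    assume a: "\<bar>l - l0\<bar> < r" "\<bar>m\<bar> < r" "norm y < r" "norm k < r" "Phi (1, l, m, y, k) = 0"
      and o: "od y" and s: "coef y n = s * real_of_int n / 2"
    let ?z = "y - s *\<^sub>R bstar n"
    have yn: "coef y (- n) = - (s * real_of_int n / 2)" using o s by (simp add: od_def)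
    define T where "T = \<bar>m\<bar> + norm ?z + norm (k - s *\<^sub>R kstar n)"
    have k: "k - s *\<^sub>R kstar n = k + Mop h (y - ?z)" by (simp add: kstar_def Mop_linear)
    have "T \<le> C * norm (Phi (0, l0, m, y, k))"
      unfolding T_def k
    proof (rule C(2))
      show "coef ?z j = 0" if "symb l0 j = 0" for j
        using that n s yn crit[of j] by (auto simp: coef_bstar abs_if split: if_splits)
      show "coef ?z j = coef y j" if "symb l0 j \<noteq> 0" for j
        using that crit[of j] by (simp add: coef_bstar)
    qed
    also have "\<dots> \<le> C * (\<epsilon> * (\<bar>m\<bar> + norm y + norm k))"
      using C(1) r(2)[OF a] by (intro mult_left_mono) auto
    also have "\<dots> = C * \<epsilon> * (\<bar>m\<bar> + norm y + norm k)" by simp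
    also have "\<bar>m\<bar> + norm y + norm k \<le> T + \<bar>s\<bar> * N"
    proof -
      have "norm y \<le> norm ?z + \<bar>s\<bar> * norm (bstar n :: 'm wien)"
        using norm_triangle_ineq[of ?z "s *\<^sub>R bstar n"] by simp
      moreover have "norm k \<le> norm (k - s *\<^sub>R kstar n) + \<bar>s\<bar> * norm (kstar n :: 'm wien)"
        using norm_triangle_ineq[of "k - s *\<^sub>R kstar n" "s *\<^sub>R kstar n"] by simp
      ultimately show ?thesis unfolding T_def N_def distrib_left by simp
    qed
    then have "C * \<epsilon> * (\<bar>m\<bar> + norm y + norm k) \<le> C * \<epsilon> * (T + \<bar>s\<bar> * N)"
      using C(1) \<epsilon> by (intro mult_left_mono) auto
    also have "\<dots> = C * \<epsilon> * T + C * \<epsilon> * N * \<bar>s\<bar>" by (simp add: algebra_simps)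
    also have "C * \<epsilon> * T \<le> 1 / 2 * T" using \<epsilon>C(1) by (intro mult_right_mono) (auto simp: T_def)
    finally have "T \<le> 2 * (C * \<epsilon>) * N * \<bar>s\<bar>" by simp
    also have "\<dots> \<le> e * \<bar>s\<bar>" using \<epsilon>C(2) by (intro mult_right_mono) auto
    finally show "\<bar>m\<bar> + norm ?z + norm (k - s *\<^sub>R kstar n) \<le> e * \<bar>s\<bar>" by (simp add: T_def)
  qed
qed

section \<open>Transversality and the curve through a critical value\<close>

definition dsymb :: "real \<Rightarrow> int \<Rightarrow> real" where
  "dsymb l j = (bb / real_of_int j - 2 * l * coth (real_of_int j * h)) / (\<sigma> * real_of_int j)"

lemma symb_deriv: "((\<lambda>t. symb (l + t * d) j) has_real_derivative d * dsymb l j) (at 0)"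
  unfolding symb_def dsymb_def
  by (cases "j = 0") (use \<sigma>_pos in \<open>auto intro!: derivative_eq_intros simp: field_simps\<close>)

lemma vector_derivative_functional:
  assumes "(f has_vector_derivative d) (at (0::real))" "bounded_linear T"
    and "((\<lambda>t. T (f t)) has_real_derivative c) (at 0)"
  shows "T d = c"
  using bounded_linear.has_vector_derivative[OF assms(2,1)] assms(3)
  by (metis DERIV_unique has_real_derivative_iff_has_vector_derivative)

text \<open>Fixing the n-th coefficient of y removes the kernel direction from the unknowns. The
  parameter l takes its place, and the n-th coefficient of the second equation determines it because
  \<open>dsymb\<close> does not vanish there.\<close>

proposition critical_curve:
  assumes n: "n > 0" and crit: "\<And>j. symb l0 j = 0 \<longleftrightarrow> \<bar>j\<bar> = n" and trans: "dsymb l0 n \<noteq> 0"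
  obtains r \<delta> C L M Y K where "r > 0" "\<delta> > 0" "C > 0"
    "\<And>s. \<bar>s\<bar> < \<delta> \<Longrightarrow> od (Y s :: 'm::finite wien) \<and> evn (K s) \<and> coef (Y s) n = real_of_int n / 2 \<and>
        Phi (s, L s, M s, Y s, K s) = 0"
    "\<And>s l m y k. \<bar>s\<bar> < \<delta> \<Longrightarrow> od y \<Longrightarrow> evn k \<Longrightarrow> coef y n = real_of_int n / 2 \<Longrightarrow>
        Phi (s, l, m, y, k) = 0 \<Longrightarrow> norm ((l, m, y, k) - (l0, 0, bstar n, kstar n)) < r \<Longrightarrow>
        (l, m, y, k) = (L s, M s, Y s, K s)"
    "\<And>s t. \<bar>s\<bar> < \<delta> \<Longrightarrow> \<bar>t\<bar> < \<delta> \<Longrightarrow> norm ((L s, M s, Y s, K s) - (L t, M t, Y t, K t)) \<le> C * \<bar>s - t\<bar>"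
    "(L 0, M 0, Y 0, K 0) = (l0, 0, bstar n, kstar n)"
proof -
  \<comment> \<open>The derivative in l of the n-th coefficient of E2 at the kernel vector, whose
    n-th coefficient is n / 2.\<close>
  define c where "c = dsymb l0 n * (real_of_int n / 2)"
  have c: "c \<noteq> 0" using trans n by (simp add: c_def)
  \<comment> \<open>Left inverse of the linearization on E: l from the resonant mode, m from E3, the
    other modes of y through \<open>Vop\<close>, and k from E1 after removal of M y. The variation
    of l enters E2 only in the resonant modes, which \<open>Vop\<close> kills.\<close>
  let ?G = "\<lambda>u :: real \<times> 'm wien \<times> 'm wien. (coef (fst (snd u)) n / c, - (2 * \<sigma>) * fst u, Vop l0 (fst (snd u)),
      (1/2) *\<^sub>R snd (snd u) - Mop h (Vop l0 (fst (snd u))))"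
  have G: "bounded_linear ?G"
    by (intro bounded_linear_Pair bounded_linear_sub bounded_linear_compose[OF bounded_linear_divide]
        bounded_linear_compose[OF bounded_linear_coef] bounded_linear_compose[OF bounded_linear_Vop]
        bounded_linear_compose[OF bounded_linear_Mop[OF h_pos]] bounded_linear_const_mult
        bounded_linear_const_scaleR bounded_linear_compose[OF bounded_linear_fst]
        bounded_linear_compose[OF bounded_linear_snd] bounded_linear_fst bounded_linear_snd bounded_linear_ident)
  define \<Psi> where "\<Psi> p = ?G (Phi (fst p, fst (snd p), fst (snd (snd p)), bstar n + fst (snd (snd (snd p))), snd (snd (snd (snd p)))))"
    for p :: "real \<times> real \<times> real \<times> 'm wien \<times> 'm wien"
  have \<Psi>: "\<Psi> (s, l, m, y, k) = ?G (Phi (s, l, m, bstar n + y, k))" for s l m y k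
    by (simp only: \<Psi>_def fst_conv snd_conv)
  define z0 where "z0 = (l0, 0 :: real, 0 :: 'm wien, kstar n :: 'm wien)"
  define E where "E = {z :: real \<times> real \<times> 'm wien \<times> 'm wien.
      od (fst (snd (snd z))) \<and> coef (fst (snd (snd z))) n = 0 \<and> evn (snd (snd (snd z)))}"
  have "strictly_differentiable \<Psi> (0, z0)"
    unfolding \<Psi>_def
    by (intro strict_compose_linear[OF G] strict_Phi strict_add strict_const strict_compose_linear[OF bounded_linear_fst]
        strict_compose_linear[OF bounded_linear_snd] strict_id)
  then obtain D where D: "has_strict_derivative \<Psi> D (0, z0)" by (auto simp: strictly_differentiable_def)
  have Phi0: "\<Psi> (0, l, m, y, k) = (symb l n * (real_of_int n / 2 + coef y n) / c, m,
      Vop l0 (E2 0 l m (bstar n + y) k), k + Mop h (bstar n + y) - Mop h (Vop l0 (E2 0 l m (bstar n + y) k)))" for l m y k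
    using \<sigma>_pos n unfolding \<Psi>
    by (simp add: Phi_def coef_E2_0 E3_0 E1_0 coef_bstar scaleR_add_right)
  have zero: "\<Psi> (0, z0) = 0"
  proof -
    have "Vop l0 (E2 0 l0 0 (bstar n + 0) (kstar n)) = (0 :: 'm wien)"
      by (rule wien_eqI) (simp add: coef_Vop coef_E2_0 coef_bstar crit)
    then show ?thesis using crit n by (simp add: z0_def Phi0 zero_prod_def kstar_def Mop_linear)
  qed
  have subE: "subspace E"
    unfolding subspace_def E_def by (auto simp: zero_prod_def intro: evn_arith od_arith)
  have clE: "closed E"
  proof -
    have "E = (\<lambda>z. fst (snd (snd z))) -` {a. od a} \<inter> (\<lambda>z. coef (fst (snd (snd z))) n) -` {0} \<inter> (\<lambda>z. snd (snd (snd z))) -` {a. evn a}"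
      by (auto simp: E_def)
    then show ?thesis
      by (simp only:) (intro closed_Int closed_vimage closed_od closed_evn closed_singleton continuous_intros
          bounded_linear.continuous_on[OF bounded_linear_coef])
  qed
  have z0E: "z0 \<in> E" by (simp add: z0_def E_def evn_kstar od_arith)
  \<comment> \<open>D is known only to exist. Its four components are computed from real derivatives
    along lines, those in the algebra coefficient by coefficient.\<close>
  have DE: "D (0, z) = z" if "z \<in> E" for z
  proof -
    obtain d m y k where z: "z = (d, m, y, k)" by (cases z) auto
    with that have y: "od y" "coef y n = 0" "coef y (- n) = 0" by (auto simp: E_def od_def)
    obtain D1 D2 D3 D4 where D4: "D (0, z) = (D1, D2, D3, D4)" by (cases "D (0, z)") auto
    define f where "f t = \<Psi> (0, l0 + t * d, t * m, t *\<^sub>R y, kstar n + t *\<^sub>R k)" for t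
    have "f = (\<lambda>t. \<Psi> ((0, z0) + t *\<^sub>R (0, z)))" by (simp add: f_def z0_def z fun_eq_iff)
    then have f: "(f has_vector_derivative (D1, D2, D3, D4)) (at 0)"
      using has_strict_derivative_directional[OF D, of "(0, z)"] D4 by simp
    have ft: "f t = (symb (l0 + t * d) n * (real_of_int n / 2) / c, t * m, Vop l0 (E2 0 (l0 + t * d) (t * m) (bstar n + t *\<^sub>R y) (kstar n + t *\<^sub>R k)),
        kstar n + t *\<^sub>R k + Mop h (bstar n + t *\<^sub>R y) - Mop h (Vop l0 (E2 0 (l0 + t * d) (t * m) (bstar n + t *\<^sub>R y) (kstar n + t *\<^sub>R k))))" for t
      using y by (simp add: f_def Phi0)
    have "fst (D1, D2, D3, D4) = d"
    proof (rule vector_derivative_functional[OF f bounded_linear_fst])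
      have "((\<lambda>t. symb (l0 + t * d) n * (real_of_int n / 2) / c) has_real_derivative d * dsymb l0 n * (real_of_int n / 2) / c) (at 0)"
        by (intro DERIV_cdivide DERIV_cmult_right symb_deriv)
      then show "((\<lambda>t. fst (f t)) has_real_derivative d) (at 0)"
        using c by (simp add: ft c_def)
    qed
    moreover have "fst (snd (D1, D2, D3, D4)) = m"
    proof (rule vector_derivative_functional[OF f])
      show "bounded_linear (\<lambda>p :: real \<times> real \<times> 'm wien \<times> 'm wien. fst (snd p))"
        by (intro bounded_linear_compose[OF bounded_linear_fst] bounded_linear_snd)
      show "((\<lambda>t. fst (snd (f t))) has_real_derivative m) (at 0)"
        by (auto simp: ft intro!: derivative_eq_intros)
    qed
    \<comment> \<open>In a resonant mode both the inverse symbol and the coefficient of y vanish; in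
      any other mode \<open>bstar\<close> vanishes and the symbol cancels its inverse.\<close>
    moreover have V: "((\<lambda>t. coef (fst (snd (snd (f t)))) j) has_real_derivative coef y j) (at 0)" for j
    proof -
      have "((\<lambda>t. inverse (symb l0 j) * (symb (l0 + t * d) j * (coef (bstar n :: 'm wien) j + t * coef y j))) has_real_derivative
          inverse (symb l0 j) * (d * dsymb l0 j * (coef (bstar n :: 'm wien) j + 0 * coef y j) + (0 + 1 * coef y j) * symb (l0 + 0 * d) j)) (at 0)"
        by (intro DERIV_cmult DERIV_mult symb_deriv DERIV_add DERIV_const DERIV_cmult_right DERIV_ident)
      moreover have "inverse (symb l0 j) * (d * dsymb l0 j * (coef (bstar n :: 'm wien) j + 0 * coef y j) + (0 + 1 * coef y j) * symb (l0 + 0 * d) j) = coef y j"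
        using y crit[of j] by (cases "\<bar>j\<bar> = n") (auto simp: coef_bstar abs_if split: if_splits)
      ultimately show ?thesis by (simp add: ft coef_Vop coef_E2_0)
    qed
    have "coef (fst (snd (snd (D1, D2, D3, D4)))) j = coef y j" for j
      by (rule vector_derivative_functional[OF f _ V])
        (intro bounded_linear_compose[OF bounded_linear_coef] bounded_linear_compose[OF bounded_linear_fst]
          bounded_linear_compose[OF bounded_linear_snd] bounded_linear_snd)
    then have "D3 = y" by (intro wien_eqI) simp
    moreover have "coef (snd (snd (snd (D1, D2, D3, D4)))) j = coef k j" for j
    proof (rule vector_derivative_functional[OF f])
      show "bounded_linear (\<lambda>p :: real \<times> real \<times> 'm wien \<times> 'm wien. coef (snd (snd (snd p))) j)"
        by (intro bounded_linear_compose[OF bounded_linear_coef]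
          bounded_linear_compose[OF bounded_linear_snd] bounded_linear_snd)
      have "((\<lambda>t. t * (coef k j + coth (real_of_int j * h) * coef y j) - coth (real_of_int j * h) * coef (fst (snd (snd (f t)))) j)
          has_real_derivative 1 * (coef k j + coth (real_of_int j * h) * coef y j) - coth (real_of_int j * h) * coef y j) (at 0)"
        by (intro DERIV_diff DERIV_cmult_right DERIV_ident DERIV_cmult V)
      moreover have "coef (snd (snd (snd (f t)))) j = t * (coef k j + coth (real_of_int j * h) * coef y j) - coth (real_of_int j * h) * coef (fst (snd (snd (f t)))) j" for t
        using h_pos by (simp add: ft coef_Mop kstar_def algebra_simps)
      ultimately show "((\<lambda>t. coef (snd (snd (snd (f t)))) j) has_real_derivative coef k j) (at 0)" by simp
    qed
    then have "D4 = k" by (intro wien_eqI) simp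
    ultimately show ?thesis using D4 z by simp
  qed
  have Vodd: "od (Vop l0 a)" if "od a" for a :: "'m wien"
    using that by (auto simp: od_def coef_Vop symb_minus)
  have PE: "\<Psi> (s, z) \<in> E" if "z \<in> E" for s z
  proof -
    obtain l m y k where z: "z = (l, m, y, k)" by (cases z) auto
    with that have y: "od (bstar n + y)" "evn k" by (auto simp: E_def intro: od_arith od_bstar)
    show ?thesis
      using od_E2[OF y] evn_E1[OF y] crit[of n] n
      by (auto simp: z \<Psi> Phi_def E_def coef_Vop intro!: Vodd evn_arith Mop_parity h_pos)
  qed
  have Pzero: "Phi (s, l, m, bstar n + y, k) = 0" if "(l, m, y, k) \<in> E" "\<Psi> (s, l, m, y, k) = 0" for s l m y k
  proof -
    have y: "od (bstar n + y)" "evn k" using that by (auto simp: E_def intro: od_arith od_bstar)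
    from that(2) have z: "coef (E2 s l m (bstar n + y) k) n = 0" "E3 s l m (bstar n + y) k = 0"
      "Vop l0 (E2 s l m (bstar n + y) k) = 0" "E1 s (bstar n + y) k = 0"
      using \<sigma>_pos c by (auto simp: \<Psi> Phi_def zero_prod_def Mop_linear)
    \<comment> \<open>Applying ?G loses nothing: \<open>Vop\<close> is injective off the modes n and
      -n, the first component settles mode n, and oddness settles -n.\<close>
    have "E2 s l m (bstar n + y) k = 0"
    proof (rule wien_eqI)
      fix j
      have "coef (E2 s l m (bstar n + y) k) (- n) = 0" using od_E2[OF y] z(1) by (simp add: od_def)
      moreover have "inverse (symb l0 j) * coef (E2 s l m (bstar n + y) k) j = 0"
        using z(3) coef_Vop[of l0 "E2 s l m (bstar n + y) k" j] by simp
      ultimately show "coef (E2 s l m (bstar n + y) k) j = coef 0 j"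
        using z(1) crit[of j] by (cases "\<bar>j\<bar> = n") (auto simp: abs_if split: if_splits)
    qed
    then show ?thesis using z by (simp add: Phi_def zero_prod_def)
  qed
  obtain r \<delta> C \<gamma> where g: "r > 0" "\<delta> > 0" "C > 0"
    "\<And>p. p \<in> UNIV \<Longrightarrow> norm (p - 0) < \<delta> \<Longrightarrow> \<gamma> p \<in> E \<and> norm (\<gamma> p - z0) < r \<and> \<Psi> (p, \<gamma> p) = 0"
    "\<And>p z. p \<in> UNIV \<Longrightarrow> norm (p - 0) < \<delta> \<Longrightarrow> z \<in> E \<Longrightarrow> norm (z - z0) < r \<Longrightarrow> \<Psi> (p, z) = 0 \<Longrightarrow> z = \<gamma> p"
    "\<And>p q. p \<in> UNIV \<Longrightarrow> norm (p - 0) < \<delta> \<Longrightarrow> q \<in> UNIV \<Longrightarrow> norm (q - 0) < \<delta> \<Longrightarrow> norm (\<gamma> p - \<gamma> q) \<le> C * norm (p - q)"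
    using implicit_function_strict[OF D zero subE clE z0E DE, of UNIV] PE by blast
  define L where "L s = fst (\<gamma> s)" for s
  define M where "M s = fst (snd (\<gamma> s))" for s
  define Y where "Y s = bstar n + fst (snd (snd (\<gamma> s)))" for s
  define K where "K s = snd (snd (snd (\<gamma> s)))" for s
  have \<gamma>: "\<gamma> s = (L s, M s, Y s - bstar n, K s)" for s by (simp add: L_def M_def Y_def K_def)
  have uniq: "(l, m, y, k) = (L s, M s, Y s, K s)"
    if "\<bar>s\<bar> < \<delta>" "od y" "evn k" "coef y n = real_of_int n / 2"
      "Phi (s, l, m, y, k) = 0" "norm ((l, m, y, k) - (l0, 0, bstar n, kstar n)) < r" for s l m y k
  proof -
    have "(l, m, y - bstar n, k) = \<gamma> s"
    proof (rule g(5))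
      show "(l, m, y - bstar n, k) \<in> E" using that n by (auto simp: E_def coef_bstar intro: od_arith od_bstar)
      show "norm ((l, m, y - bstar n, k) - z0) < r" using that by (simp add: z0_def)
      show "\<Psi> (s, l, m, y - bstar n, k) = 0" using that by (simp add: \<Psi> Vop_def[symmetric] linear_simps[OF bounded_linear_Vop] Mop_linear zero_prod_def)
    qed (use that in auto)
    then show ?thesis by (auto simp: \<gamma>)
  qed
  show ?thesis
  proof (rule that[OF g(1,2,3), of Y K L M])
    show "od (Y s) \<and> evn (K s) \<and> coef (Y s) n = real_of_int n / 2 \<and> Phi (s, L s, M s, Y s, K s) = 0" if "\<bar>s\<bar> < \<delta>" for s
      using g(4)[of s] that Pzero[of "L s" "M s" "Y s - bstar n" "K s" s] n od_arith(1)[OF od_bstar[of n], of "Y s - bstar n"]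
      by (auto simp: \<gamma> E_def coef_bstar)
    show "norm ((L s, M s, Y s, K s) - (L t, M t, Y t, K t)) \<le> C * \<bar>s - t\<bar>" if "\<bar>s\<bar> < \<delta>" "\<bar>t\<bar> < \<delta>" for s t
      using g(6)[of s t] that by (simp add: \<gamma>)
    have "z0 = \<gamma> 0" using g z0E zero by (intro g(5)) auto
    then show "(L 0, M 0, Y 0, K 0) = (l0, 0, bstar n, kstar n)" by (auto simp: \<gamma> z0_def)
  qed (use uniq in auto)
qed

end

section \<open>Absolutely convergent trigonometric series\<close>

text \<open>With a free phase, cosine and sine series are treated together, and differentiation
  multiplies the coefficients by k and advances the phase by pi / 2.\<close>

definition tser :: "(int \<Rightarrow> real) \<Rightarrow> real \<Rightarrow> real \<Rightarrow> real" where
  "tser c \<phi> x = (\<Sum>\<^sub>\<infinity>k. c k * cos (real_of_int k * x + \<phi>))"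

definition Ecos :: "(int \<Rightarrow> real) \<Rightarrow> real \<Rightarrow> real" where
  "Ecos c = tser c 0"

text \<open>The phase \<open>\<pi>/2\<close> gives \<open>-\<Sum> c\<^sub>k sin (k x)\<close>, the function with Fourier coefficients \<open>\<i> c\<^sub>k\<close> for odd \<open>c\<close>.\<close>

definition Osin :: "(int \<Rightarrow> real) \<Rightarrow> real \<Rightarrow> real" where
  "Osin c = tser c (pi / 2)"

lemma tser_abs_summable:
  assumes "c abs_summable_on UNIV"
  shows "(\<lambda>k. c k * cos (real_of_int k * x + \<phi>)) abs_summable_on UNIV"
  by (rule Infinite_Sum.abs_summable_on_comparison_test[OF assms])
    (simp add: abs_mult mult_left_le)

lemma tser_has_sum:
  assumes "c abs_summable_on UNIV"
  shows "((\<lambda>k. c k * cos (real_of_int k * x + \<phi>)) has_sum tser c \<phi> x) UNIV"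
  unfolding tser_def
  by (rule has_sum_infsum[OF Infinite_Sum.abs_summable_summable[OF tser_abs_summable[OF assms]]])

lemma tser_bound:
  assumes "c abs_summable_on UNIV"
  shows "\<bar>tser c \<phi> x\<bar> \<le> (\<Sum>\<^sub>\<infinity>k. \<bar>c k\<bar>)"
proof -
  have "\<bar>tser c \<phi> x\<bar> \<le> (\<Sum>\<^sub>\<infinity>k. norm (c k * cos (real_of_int k * x + \<phi>)))"
    unfolding tser_def using norm_infsum_bound[OF tser_abs_summable[OF assms]] by simp
  also have "\<dots> \<le> (\<Sum>\<^sub>\<infinity>k. \<bar>c k\<bar>)"
    by (rule infsum_mono[OF tser_abs_summable[OF assms]])
      (use assms in \<open>auto simp: abs_mult mult_left_le\<close>)
  finally show ?thesis .
qed

text \<open>The Weierstrass test applied to the net of finite partial sums; uniform convergence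
  gives continuity and termwise integration for an unordered index set.\<close>

lemma series_integral:
  fixes f :: "'i \<Rightarrow> real \<Rightarrow> real"
  assumes bound: "\<And>k x. x \<in> {a..b} \<Longrightarrow> \<bar>f k x\<bar> \<le> M k" and M: "M summable_on UNIV"
    and cont: "\<And>k. continuous_on {a..b} (f k)"
  shows "continuous_on {a..b} (\<lambda>x. \<Sum>\<^sub>\<infinity>k. f k x)"
    and "((\<lambda>k. integral {a..b} (f k)) has_sum integral {a..b} (\<lambda>x. \<Sum>\<^sub>\<infinity>k. f k x)) UNIV"
proof -
  have u: "uniform_limit {a..b} (\<lambda>X x. \<Sum>k\<in>X. f k x) (\<lambda>x. \<Sum>\<^sub>\<infinity>k. f k x) (finite_subsets_at_top UNIV)"
    by (rule Weierstrass_m_test_general[OF _ M]) (use bound in auto)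
  have c: "continuous_on {a..b} (\<lambda>x. \<Sum>k\<in>X. f k x)" for X
    by (intro continuous_on_sum cont)
  show "continuous_on {a..b} (\<lambda>x. \<Sum>\<^sub>\<infinity>k. f k x)"
    by (rule uniform_limit_theorem[OF _ u]) (auto simp: c)
  obtain I J where IJ: "\<And>X. ((\<lambda>x. \<Sum>k\<in>X. f k x) has_integral I X) {a..b}"
    "((\<lambda>x. \<Sum>\<^sub>\<infinity>k. f k x) has_integral J) {a..b}" "(I \<longlongrightarrow> J) (finite_subsets_at_top UNIV)"
    using uniform_limit_integral[OF u c] by (metis finite_subsets_at_top_neq_bot)
  have "I X = (\<Sum>k\<in>X. integral {a..b} (f k))" if "finite X" for X
  proof -
    have "integral {a..b} (\<lambda>x. \<Sum>k\<in>X. f k x) = (\<Sum>k\<in>X. integral {a..b} (f k))"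
      by (rule integral_sum[OF that]) (intro integrable_continuous_real cont)
    then show ?thesis using IJ(1)[of X] by (simp add: integral_unique)
  qed
  then have "eventually (\<lambda>X. I X = (\<Sum>k\<in>X. integral {a..b} (f k))) (finite_subsets_at_top UNIV)"
    by (intro eventually_finite_subsets_at_top_weakI) auto
  then have "((\<lambda>X. \<Sum>k\<in>X. integral {a..b} (f k)) \<longlongrightarrow> J) (finite_subsets_at_top UNIV)"
    using IJ(3) by (rule Lim_transform_eventually[rotated])
  then show "((\<lambda>k. integral {a..b} (f k)) has_sum integral {a..b} (\<lambda>x. \<Sum>\<^sub>\<infinity>k. f k x)) UNIV"
    using IJ(2) by (simp add: has_sum_def integral_unique)
qed

lemma continuous_on_tser:
  assumes "c abs_summable_on UNIV"
  shows "continuous_on S (tser c \<phi>)"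
proof -
  have "isCont (tser c \<phi>) x" for x
  proof -
    have "continuous_on {x-1..x+1} (\<lambda>x. \<Sum>\<^sub>\<infinity>k. c k * cos (real_of_int k * x + \<phi>))"
      by (rule series_integral(1)[where M = "\<lambda>k. \<bar>c k\<bar>"])
        (use assms in \<open>auto simp: abs_mult mult_left_le intro!: continuous_intros\<close>)
    then have "continuous_on {x-1..x+1} (tser c \<phi>)" by (simp add: tser_def[abs_def])
    then show ?thesis by (rule continuous_on_interior) simp
  qed
  then show ?thesis by (simp add: continuous_at_imp_continuous_on)
qed

text \<open>The series of derivatives is integrated term by term from x - 1, a base point chosen
  only to lie left of x, and the fundamental theorem differentiates the result.\<close>

lemma tser_has_derivative:
  assumes c: "c abs_summable_on UNIV" and kc: "(\<lambda>k. real_of_int k * c k) abs_summable_on UNIV"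
  shows "(tser c \<phi> has_real_derivative tser (\<lambda>k. real_of_int k * c k) (\<phi> + pi / 2) x) (at x)"
proof -
  let ?d = "tser (\<lambda>k. real_of_int k * c k) (\<phi> + pi / 2)"
  let ?a = "x - 1"
  have int: "integral {?a..t} ?d = tser c \<phi> t - tser c \<phi> ?a" if "?a \<le> t" for t
  proof -
    have "((\<lambda>k. integral {?a..t} (\<lambda>u. real_of_int k * c k * cos (real_of_int k * u + (\<phi> + pi / 2)))) has_sum integral {?a..t} ?d) UNIV"
      unfolding tser_def
      by (rule series_integral(2)[where M = "\<lambda>k. \<bar>real_of_int k * c k\<bar>"])
        (use kc in \<open>auto simp: abs_mult mult_left_le intro!: continuous_intros\<close>)
    moreover have "integral {?a..t} (\<lambda>u. real_of_int k * c k * cos (real_of_int k * u + (\<phi> + pi / 2)))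
        = c k * cos (real_of_int k * t + \<phi>) - c k * cos (real_of_int k * ?a + \<phi>)" for k
    proof (rule integral_unique, rule fundamental_theorem_of_calculus[OF that])
      fix u
      have "cos (real_of_int k * u + (\<phi> + pi / 2)) = - sin (real_of_int k * u + \<phi>)"
        using minus_sin_cos_eq[of "real_of_int k * u + \<phi>"] by (simp add: add.assoc)
      then have "((\<lambda>t. c k * cos (real_of_int k * t + \<phi>)) has_real_derivative real_of_int k * c k * cos (real_of_int k * u + (\<phi> + pi / 2))) (at u)"
        by (auto intro!: derivative_eq_intros)
      then show "((\<lambda>t. c k * cos (real_of_int k * t + \<phi>)) has_vector_derivative real_of_int k * c k * cos (real_of_int k * u + (\<phi> + pi / 2))) (at u within {?a..t})"
        by (simp add: has_real_derivative_iff_has_vector_derivative has_vector_derivative_at_within)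
    qed
    ultimately have "((\<lambda>k. c k * cos (real_of_int k * t + \<phi>) - c k * cos (real_of_int k * ?a + \<phi>)) has_sum integral {?a..t} ?d) UNIV"
      by simp
    moreover have "((\<lambda>k. c k * cos (real_of_int k * t + \<phi>) - c k * cos (real_of_int k * ?a + \<phi>)) has_sum tser c \<phi> t - tser c \<phi> ?a) UNIV"
      using has_sum_add[OF tser_has_sum[OF c] has_sum_uminusI[OF tser_has_sum[OF c]]] by simp
    ultimately show ?thesis by (rule has_sum_unique)
  qed
  have "((\<lambda>t. integral {?a..t} ?d) has_real_derivative ?d x) (at x within {?a..x+1})"
    by (rule integral_has_real_derivative[OF continuous_on_tser[OF kc]]) auto
  then have "((\<lambda>t. integral {?a..t} ?d) has_real_derivative ?d x) (at x)"
    by (simp add: at_within_Icc_at)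
  then have "((\<lambda>t. integral {?a..t} ?d + tser c \<phi> ?a) has_real_derivative ?d x + 0) (at x)"
    by (intro DERIV_add DERIV_const)
  then have D: "((\<lambda>t. integral {?a..t} ?d + tser c \<phi> ?a) has_real_derivative ?d x) (at x)" by simp
  show ?thesis
    by (rule DERIV_cong_ev[THEN iffD1, OF refl _ refl D])
      (use int in \<open>auto simp: eventually_at_filter intro!: eventually_nhds[THEN iffD2] exI[of _ "{?a<..}"]\<close>)
qed

lemma
  assumes c: "c abs_summable_on UNIV" and kc: "(\<lambda>k. real_of_int k * c k) abs_summable_on UNIV"
  shows Ecos_has_derivative: "(Ecos c has_real_derivative Osin (\<lambda>k. real_of_int k * c k) x) (at x)"
    and Osin_has_derivative: "(Osin c has_real_derivative - Ecos (\<lambda>k. real_of_int k * c k) x) (at x)"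
proof -
  show "(Ecos c has_real_derivative Osin (\<lambda>k. real_of_int k * c k) x) (at x)"
    using tser_has_derivative[OF assms, of 0 x] by (simp add: Ecos_def Osin_def)
  have "tser d (pi / 2 + pi / 2) x = - tser d 0 x" for d
    by (simp add: tser_def infsum_uminus[symmetric])
  then show "(Osin c has_real_derivative - Ecos (\<lambda>k. real_of_int k * c k) x) (at x)"
    using tser_has_derivative[OF assms, of "pi/2" x] by (simp add: Ecos_def Osin_def)
qed

section \<open>Fourier coefficients of trigonometric series\<close>

lemma integral_cos_phase:
  "integral {-pi..pi} (\<lambda>x. cos (real_of_int m * x + \<theta>)) = (if m = 0 then 2 * pi * cos \<theta> else 0)"
proof (cases "m = 0")
  case False
  have "((\<lambda>x. cos (real_of_int m * x + \<theta>)) has_integral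
      sin (real_of_int m * pi + \<theta>) / real_of_int m - sin (real_of_int m * (-pi) + \<theta>) / real_of_int m) {-pi..pi}"
  proof (rule fundamental_theorem_of_calculus)
    fix u
    have "((\<lambda>x. sin (real_of_int m * x + \<theta>) / real_of_int m) has_real_derivative cos (real_of_int m * u + \<theta>)) (at u)"
      using False by (auto intro!: derivative_eq_intros)
    then show "((\<lambda>x. sin (real_of_int m * x + \<theta>) / real_of_int m) has_vector_derivative cos (real_of_int m * u + \<theta>)) (at u within {-pi..pi})"
      by (simp add: has_real_derivative_iff_has_vector_derivative has_vector_derivative_at_within)
  qed simp
  moreover have "sin (real_of_int m * pi + \<theta>) = sin (real_of_int m * (-pi) + \<theta>)"
    using sin_zero_iff_int2[of "real_of_int m * pi"] unfolding sin_add by simp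
  ultimately show ?thesis using False by (simp add: integral_unique)
qed simp

lemma integral_cos_cos:
  "integral {-pi..pi} (\<lambda>x. cos (real_of_int j * x + \<phi>) * cos (real_of_int k * x + \<psi>))
    = pi * ((if j = k then cos (\<phi> - \<psi>) else 0) + (if j = - k then cos (\<phi> + \<psi>) else 0))"
proof -
  have "integral {-pi..pi} (\<lambda>x. cos (real_of_int j * x + \<phi>) * cos (real_of_int k * x + \<psi>))
      = integral {-pi..pi} (\<lambda>x. (cos (real_of_int (j - k) * x + (\<phi> - \<psi>)) + cos (real_of_int (j + k) * x + (\<phi> + \<psi>))) / 2)"
    by (intro integral_cong) (simp add: cos_times_cos algebra_simps)
  also have "\<dots> = (integral {-pi..pi} (\<lambda>x. cos (real_of_int (j - k) * x + (\<phi> - \<psi>)))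
      + integral {-pi..pi} (\<lambda>x. cos (real_of_int (j + k) * x + (\<phi> + \<psi>)))) / 2"
    unfolding integral_divide
    by (subst integral_add) (auto intro!: integrable_continuous_real continuous_intros)
  also have "\<dots> = pi * ((if j = k then cos (\<phi> - \<psi>) else 0) + (if j = - k then cos (\<phi> + \<psi>) else 0))"
    unfolding integral_cos_phase by (auto simp: eq_neg_iff_add_eq_0 algebra_simps)
  finally show ?thesis .
qed

lemma integral_tser_cos:
  assumes c: "c abs_summable_on UNIV"
  shows "integral {-pi..pi} (\<lambda>x. tser c \<phi> x * cos (real_of_int k * x + \<psi>))
    = pi * (c k * cos (\<phi> - \<psi>) + c (- k) * cos (\<phi> + \<psi>))"
proof -
  let ?f = "\<lambda>j x. c j * cos (real_of_int j * x + \<phi>) * cos (real_of_int k * x + \<psi>)"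
  let ?g = "\<lambda>j. pi * ((if j = k then c k * cos (\<phi> - \<psi>) else 0) + (if j = - k then c (- k) * cos (\<phi> + \<psi>) else 0))"
  have "((\<lambda>j. integral {-pi..pi} (?f j)) has_sum integral {-pi..pi} (\<lambda>x. \<Sum>\<^sub>\<infinity>j. ?f j x)) UNIV"
  proof (rule series_integral(2)[where M = "\<lambda>k. \<bar>c k\<bar>"])
    fix j x
    have "\<bar>cos (real_of_int j * x + \<phi>)\<bar> * \<bar>cos (real_of_int k * x + \<psi>)\<bar> \<le> 1 * 1" by (intro mult_mono) auto
    then show "\<bar>?f j x\<bar> \<le> \<bar>c j\<bar>" by (simp add: abs_mult mult.assoc mult_left_le)
  qed (use c in \<open>auto intro!: continuous_intros\<close>)
  moreover have "integral {-pi..pi} (?f j) = ?g j" for j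
    using integral_cos_cos[of j \<phi> k \<psi>] by (simp add: mult.assoc algebra_simps)
  ultimately have "(?g has_sum integral {-pi..pi} (\<lambda>x. \<Sum>\<^sub>\<infinity>j. ?f j x)) UNIV" by simp
  moreover have "(?g has_sum pi * (c k * cos (\<phi> - \<psi>) + c (- k) * cos (\<phi> + \<psi>))) UNIV"
  proof (intro has_sum_cmult_right has_sum_add)
    show "((\<lambda>j. if j = k then c k * cos (\<phi> - \<psi>) else 0) has_sum c k * cos (\<phi> - \<psi>)) UNIV"
      by (rule has_sum_finite_neutralI[of "{k}"]) auto
    show "((\<lambda>j. if j = - k then c (- k) * cos (\<phi> + \<psi>) else 0) has_sum c (- k) * cos (\<phi> + \<psi>)) UNIV"
      by (rule has_sum_finite_neutralI[of "{- k}"]) auto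
  qed
  ultimately have "integral {-pi..pi} (\<lambda>x. \<Sum>\<^sub>\<infinity>j. ?f j x) = pi * (c k * cos (\<phi> - \<psi>) + c (- k) * cos (\<phi> + \<psi>))"
    by (rule has_sum_unique)
  then show ?thesis by (simp add: tser_def infsum_cmult_left')
qed

lemma
  assumes "c abs_summable_on UNIV"
  shows fourier_cos_Ecos: "fourier_cos (Ecos c) k = c (int k) + c (- int k)"
    and fourier_sin_Ecos: "fourier_sin (Ecos c) k = 0"
    and fourier_cos_Osin: "fourier_cos (Osin c) k = 0"
    and fourier_sin_Osin: "fourier_sin (Osin c) k = c (- int k) - c (int k)"
    and mean_Ecos: "mean (Ecos c) = c 0"
proof -
  have s: "sin (real k * x) = cos (real k * x + - (pi / 2))" for x by (simp add: cos_diff)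
  show "fourier_cos (Ecos c) k = c (int k) + c (- int k)" "fourier_cos (Osin c) k = 0"
    using integral_tser_cos[OF assms, of 0 "int k" 0] integral_tser_cos[OF assms, of "pi/2" "int k" 0]
    by (auto simp: fourier_cos_def Ecos_def Osin_def)
  show "fourier_sin (Ecos c) k = 0" "fourier_sin (Osin c) k = c (- int k) - c (int k)"
    using integral_tser_cos[OF assms, of 0 "int k" "- (pi / 2)"] integral_tser_cos[OF assms, of "pi/2" "int k" "- (pi/2)"]
    unfolding fourier_sin_def Ecos_def Osin_def s by (auto simp: field_simps)
  show "mean (Ecos c) = c 0"
    using integral_tser_cos[OF assms, of 0 0 0] by (simp add: mean_def Ecos_def)
qed

text \<open>Converts unordered sums over the integers into series starting at mode 1, the form used
  by \<open>hilbert_strip\<close>; modes n + 1 and -(n + 1) are paired and mode 0 is split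
  off.\<close>

lemma has_sum_int_sums:
  fixes f :: "int \<Rightarrow> real"
  assumes "f abs_summable_on UNIV"
  shows "(\<lambda>n. f (int (Suc n)) + f (- int (Suc n))) sums (infsum f UNIV - f 0)"
proof -
  have sub: "f summable_on A" for A
    using Infinite_Sum.abs_summable_summable[OF assms] summable_on_subset_banach by blast
  have U: "UNIV = ({0} \<union> {0<..}) \<union> {..<0 :: int}" by auto
  have "infsum f UNIV = infsum f {0} + infsum f {0<..} + infsum f {..<0}"
    by (subst U, subst infsum_Un_disjoint, (auto simp: sub)[3], subst infsum_Un_disjoint) (auto simp: sub)
  moreover have b1: "bij_betw (\<lambda>n. int (Suc n)) UNIV {0<..}"
    by (rule bij_betwI[where g = "\<lambda>k. nat k - 1"]) auto
  have "((\<lambda>n. f (int (Suc n))) has_sum infsum f {0<..}) UNIV"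
    using has_sum_reindex_bij_betw[OF b1, of f "infsum f {0<..}"] has_sum_infsum[OF sub] by blast
  moreover have b2: "bij_betw (\<lambda>n. - int (Suc n)) UNIV {..<0}"
    by (rule bij_betwI[where g = "\<lambda>k. nat (- k) - 1"]) auto
  have "((\<lambda>n. f (- int (Suc n))) has_sum infsum f {..<0}) UNIV"
    using has_sum_reindex_bij_betw[OF b2, of f "infsum f {..<0}"] has_sum_infsum[OF sub] by blast
  ultimately show ?thesis
    using has_sum_imp_sums[OF has_sum_add] by fastforce
qed

lemma Ecos_sums:
  assumes "c abs_summable_on UNIV" "\<And>k. c (- k) = c k" "c 0 = 0"
  shows "(\<lambda>n. 2 * c (int (Suc n)) * cos (real (Suc n) * x)) sums Ecos c x"
  using has_sum_int_sums[OF tser_abs_summable[OF assms(1), of x 0]] assms(2,3)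
  by (simp add: Ecos_def tser_def mult.assoc mult_2[symmetric] del: of_nat_Suc mult_2)

lemma hilbert_strip_Osin:
  assumes h: "h > 0" and c: "c abs_summable_on UNIV" and o: "\<And>k. c (- k) = - c k"
  shows "hilbert_strip h (Osin c) x = Ecos (\<lambda>k. coth (real_of_int k * h) * c k) x"
proof -
  have "(\<lambda>k. c k * (1 + 1 / h)) abs_summable_on UNIV"
    unfolding norm_mult by (rule summable_on_cmult_left[OF c])
  then have s: "(\<lambda>k. coth (real_of_int k * h) * c k) abs_summable_on UNIV"
  proof (rule Infinite_Sum.abs_summable_on_comparison_test)
    show "norm (coth (real_of_int k * h) * c k) \<le> norm (c k * (1 + 1 / h))" for k
      using mult_left_mono[OF coth_bound[OF h, of k], of "\<bar>c k\<bar>"] h by (simp add: abs_mult mult.commute)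
  qed
  have "c 0 = 0" using o[of 0] by simp
  have "(\<lambda>n. 2 * (coth (real_of_int (int (Suc n)) * h) * c (int (Suc n))) * cos (real (Suc n) * x)) sums
      Ecos (\<lambda>k. coth (real_of_int k * h) * c k) x"
    by (rule Ecos_sums[OF s]) (use o in auto)
  then have "(\<lambda>k. fourier_sin (Osin c) (Suc k) * coth (real (Suc k) * h) * cos (real (Suc k) * x))
      sums (- Ecos (\<lambda>k. coth (real_of_int k * h) * c k) x)"
    using sums_minus by (force simp: fourier_sin_Osin[OF c] o mult_ac simp del: of_nat_Suc)
  then show ?thesis
    unfolding hilbert_strip_def fourier_cos_Osin[OF c] by (simp add: sums_iff)
qed

text \<open>Complex point evaluation. It is an algebra homomorphism, and its real and imaginary
  parts are \<open>Ecos\<close> and minus \<open>Osin\<close>, so all product rules for the four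
  parity combinations come from one identity.\<close>

definition ev :: "'m::finite wien \<Rightarrow> real \<Rightarrow> complex" where
  "ev a x = (\<Sum>\<^sub>\<infinity>k. complex_of_real (coef a k) * cis (real_of_int k * x))"

lemma coef_abs_summable: "coef (a :: 'm::finite wien) abs_summable_on UNIV"
  by (rule wsummable_imp_abs_summable[OF coef_wsummable])

lemma ev_abs_summable: "(\<lambda>k. complex_of_real (coef a k) * cis (real_of_int k * x)) abs_summable_on UNIV"
  using coef_abs_summable[of a] by (simp add: norm_mult)

lemma Re_ev: "Re (ev a x) = Ecos (coef a) x"
  unfolding ev_def Ecos_def tser_def
  by (subst infsum_Re[symmetric]) (auto intro: Infinite_Sum.abs_summable_summable[OF ev_abs_summable])

lemma Im_ev: "Im (ev a x) = - Osin (coef a) x"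
  unfolding ev_def Osin_def tser_def
  by (subst infsum_Im[symmetric])
    (auto intro: Infinite_Sum.abs_summable_summable[OF ev_abs_summable] simp: cos_add infsum_uminus)

text \<open>The exponentials of modes j and k - j multiply to that of mode k, so the terms of the
  two series convolve like their coefficients; the sum of a convolution is the product of the
  sums.\<close>

lemma ev_mult: "ev (a * b) x = ev a x * ev b x"
proof -
  let ?f = "\<lambda>a k. complex_of_real (coef a k) * cis (real_of_int k * x)"
  have "conv (?f a) (?f b) k = ?f (a * b) k" for k
  proof -
    have "?f a j * ?f b (k - j) = complex_of_real (coef a j * coef b (k - j)) * cis (real_of_int k * x)" for j
    proof -
      have "cis (real_of_int j * x) * cis (real_of_int (k - j) * x) = cis (real_of_int k * x)"
        by (simp add: cis_mult algebra_simps)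
      then show ?thesis by (simp add: algebra_simps)
    qed
    then have "conv (?f a) (?f b) k = (\<Sum>\<^sub>\<infinity>j. complex_of_real (coef a j * coef b (k - j))) * cis (real_of_int k * x)"
      by (simp only: conv_def infsum_cmult_left')
    also have "(\<Sum>\<^sub>\<infinity>j. complex_of_real (coef a j * coef b (k - j))) = complex_of_real (coef (a * b) k)"
      unfolding coef_mult conv_def
      by (rule infsumI[OF has_sum_of_real[OF has_sum_infsum]])
        (rule Infinite_Sum.abs_summable_summable[OF conv_summand_abs_summable[OF coef_abs_summable coef_abs_summable]])
    finally show ?thesis .
  qed
  then have "conv (?f a) (?f b) = ?f (a * b)" by (rule ext)
  then show ?thesis
    unfolding ev_def using conv_infsum[OF ev_abs_summable[of a x] ev_abs_summable[of b x]] by simp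
qed

lemma Ecos_linear:
  fixes a b :: "'m::finite wien"
  shows "Ecos (coef (a + b)) x = Ecos (coef a) x + Ecos (coef b) x"
    "Ecos (coef (a - b)) x = Ecos (coef a) x - Ecos (coef b) x"
    "Ecos (coef (- a)) x = - Ecos (coef a) x"
    "Ecos (coef (r *\<^sub>R a)) x = r * Ecos (coef a) x"
    "Ecos (coef (1 :: 'm wien)) x = 1" "Ecos (coef (0 :: 'm wien)) x = 0"
  and Osin_linear:
    "Osin (coef (a + b)) x = Osin (coef a) x + Osin (coef b) x"
    "Osin (coef (a - b)) x = Osin (coef a) x - Osin (coef b) x"
    "Osin (coef (- a)) x = - Osin (coef a) x"
    "Osin (coef (r *\<^sub>R a)) x = r * Osin (coef a) x"
    "Osin (coef (0 :: 'm wien)) x = 0"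
proof -
  have s: "(\<lambda>k. coef c k * cos (real_of_int k * x + \<phi>)) summable_on UNIV" for c :: "'m wien" and \<phi>
    by (rule Infinite_Sum.abs_summable_summable[OF tser_abs_summable[OF coef_abs_summable]])
  have add: "tser (coef (c + d)) \<phi> x = tser (coef c) \<phi> x + tser (coef d) \<phi> x" for c d :: "'m wien" and \<phi>
    by (simp add: tser_def distrib_right infsum_add s)
  have sc: "tser (coef (r *\<^sub>R c)) \<phi> x = r * tser (coef c) \<phi> x" for c :: "'m wien" and \<phi> r
    by (simp add: tser_def mult.assoc infsum_cmult_right')
  have mi: "tser (coef (- c)) \<phi> x = - tser (coef c) \<phi> x" for c :: "'m wien" and \<phi>
    using sc[of "-1" c \<phi>] by simp
  have di: "tser (coef (c - d)) \<phi> x = tser (coef c) \<phi> x - tser (coef d) \<phi> x" for c d :: "'m wien" and \<phi>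
    using add[of c "- d" \<phi>] mi[of d \<phi>] by simp
  show "Ecos (coef (a + b)) x = Ecos (coef a) x + Ecos (coef b) x"
    "Ecos (coef (a - b)) x = Ecos (coef a) x - Ecos (coef b) x"
    "Ecos (coef (- a)) x = - Ecos (coef a) x"
    "Ecos (coef (r *\<^sub>R a)) x = r * Ecos (coef a) x"
    "Osin (coef (a + b)) x = Osin (coef a) x + Osin (coef b) x"
    "Osin (coef (a - b)) x = Osin (coef a) x - Osin (coef b) x"
    "Osin (coef (- a)) x = - Osin (coef a) x"
    "Osin (coef (r *\<^sub>R a)) x = r * Osin (coef a) x"
    by (simp_all add: Ecos_def Osin_def add sc mi di)
  show "Ecos (coef (0 :: 'm wien)) x = 0" "Osin (coef (0 :: 'm wien)) x = 0"
    by (simp_all add: Ecos_def Osin_def tser_def)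
  have "tser (coef (1 :: 'm wien)) 0 x = (\<Sum>\<^sub>\<infinity>k\<in>{0}. coef (1 :: 'm wien) k * cos (real_of_int k * x + 0))"
    unfolding tser_def by (rule infsum_cong_neutral) (auto simp: coef_1)
  then show "Ecos (coef (1 :: 'm wien)) x = 1" by (simp add: Ecos_def coef_1)
qed

lemma Osin_evn: "evn a \<Longrightarrow> Osin (coef a) x = 0"
  and Ecos_od: "od a \<Longrightarrow> Ecos (coef a) x = 0"
proof -
  have bij: "bij_betw (uminus :: int \<Rightarrow> int) UNIV UNIV"
    by (rule bij_betwI[where g = uminus]) auto
  have r: "tser c \<phi> x = (\<Sum>\<^sub>\<infinity>k. c (- k) * cos (- (real_of_int k * x) + \<phi>))" for c \<phi>
    unfolding tser_def using infsum_reindex_bij_betw[OF bij, of "\<lambda>k. c k * cos (real_of_int k * x + \<phi>)"] by simp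
  have c: "cos (pi / 2 - t) = - cos (t + pi / 2)" for t :: real by (simp add: cos_add cos_diff)
  show "Osin (coef a) x = 0" if "evn a"
    using r[of "coef a" "pi / 2"] that by (simp add: c Osin_def evn_def infsum_uminus tser_def)
  show "Ecos (coef a) x = 0" if "od a"
    using r[of "coef a" 0] that by (simp add: Ecos_def od_def infsum_uminus tser_def)
qed

lemma Ecos_mult: "evn a \<Longrightarrow> evn b \<Longrightarrow> Ecos (coef (a * b)) x = Ecos (coef a) x * Ecos (coef b) x"
  and Ecos_mult_od: "od a \<Longrightarrow> od b \<Longrightarrow> Ecos (coef (a * b)) x = - (Osin (coef a) x * Osin (coef b) x)"
  and Osin_mult: "evn a \<Longrightarrow> od b \<Longrightarrow> Osin (coef (a * b)) x = Ecos (coef a) x * Osin (coef b) x"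
  and Osin_mult': "od a \<Longrightarrow> evn b \<Longrightarrow> Osin (coef (a * b)) x = Osin (coef a) x * Ecos (coef b) x"
  using arg_cong[OF ev_mult[of a b x], of Re] arg_cong[OF ev_mult[of a b x], of Im]
  by (simp_all add: Re_ev Im_ev Osin_evn Ecos_od)

lemma Osin_inj:
  assumes "od a" "od b" "\<And>x. Osin (coef a) x = Osin (coef b) x"
  shows "a = b"
proof (rule wien_eqI)
  fix k
  have e: "Osin (coef a) = Osin (coef b)" using assms by blast
  have "coef a (int n) = coef b (int n)" for n
    using fourier_sin_Osin[OF coef_abs_summable, of a n] fourier_sin_Osin[OF coef_abs_summable, of b n] assms
    unfolding e by (simp add: od_def)
  then show "coef a k = coef b k"
    using assms(1,2) by (metis od_def int_cases2)
qed

section \<open>Fourier series of continuous periodic functions\<close>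

text \<open>The integral over a window of one period has derivative f (c + pi) - f (c - pi) = 0 in
  its centre.\<close>

lemma periodic_integral_shift:
  fixes f :: "real \<Rightarrow> real"
  assumes cont: "continuous_on UNIV f" and per: "\<And>x. f (x + 2 * pi) = f x"
  shows "integral {a - pi..a + pi} f = integral {-pi..pi} f"
proof -
  have int: "f integrable_on {u..v}" for u v
    using cont continuous_on_subset by (intro integrable_continuous_real) blast
  have "((\<lambda>a. integral {a - pi..a + pi} f) has_real_derivative 0) (at c)" for c
  proof -
    \<comment> \<open>A fixed base point to the left of both window ends for all centres near
      c.\<close>
    let ?l = "c - pi - 1"
    have p: "- 1 < 2 * pi" using pi_gt_zero by linarith
    have G: "((\<lambda>t. integral {?l..t} f) has_real_derivative f t) (at t)" if "t > ?l" for t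
    proof -
      have "((\<lambda>t. integral {?l..t} f) has_real_derivative f t) (at t within {?l..t + 1})"
        by (rule integral_has_real_derivative) (use that cont continuous_on_subset in \<open>auto\<close>)
      then show ?thesis using that by (simp add: at_within_Icc_at)
    qed
    have "((\<lambda>a. integral {?l..a + pi} f - integral {?l..a - pi} f) has_real_derivative f (c + pi) * 1 - f (c - pi) * 1) (at c)"
      by (intro DERIV_diff DERIV_chain2[OF G]) (auto intro!: derivative_eq_intros simp: p)
    moreover have "f (c + pi) = f (c - pi)" using per[of "c - pi"] by (simp add: algebra_simps)
    ultimately have D: "((\<lambda>a. integral {?l..a + pi} f - integral {?l..a - pi} f) has_real_derivative 0) (at c)" by simp
    have "integral {?l..a + pi} f - integral {?l..a - pi} f = integral {a - pi..a + pi} f" if "a \<in> {c - 1<..}" for a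
    proof -
      have "?l \<le> a - pi" "a - pi \<le> a + pi" using that pi_ge_zero by (simp, linarith)
      from Henstock_Kurzweil_Integration.integral_combine[OF this int] show ?thesis by simp
    qed
    then have "eventually (\<lambda>a. integral {?l..a + pi} f - integral {?l..a - pi} f = integral {a - pi..a + pi} f) (nhds c)"
      by (auto intro!: eventually_nhds[THEN iffD2] exI[of _ "{c - 1<..}"])
    from DERIV_cong_ev[OF refl this refl, THEN iffD1, OF D] show ?thesis .
  qed
  then have "integral {a - pi..a + pi} f = integral {0 - pi..0 + pi} f"
    by (intro DERIV_isconst_all) auto
  then show ?thesis by simp
qed

text \<open>Bessel's inequality for the cosine system: the integral of (f - P)^2 is nonnegative, and
  f^2 integrates to at most 2 pi S^2.\<close>

lemma fourier_cos_le_bessel: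
  assumes cont: "continuous_on {-pi..pi} f" and bd: "\<And>x. \<bar>f x\<bar> \<le> S"
  shows "(\<Sum>k\<in>{1..n}. (fourier_cos f k)\<^sup>2) \<le> 2 * S\<^sup>2"
proof -
  define P where "P x = (\<Sum>k\<in>{1..n}. fourier_cos f k * cos (real k * x))" for x
  have contP: "continuous_on {-pi..pi} P" unfolding P_def by (intro continuous_intros)
  have int: "g integrable_on {-pi..pi}" if "continuous_on {-pi..pi} g" for g :: "real \<Rightarrow> real"
    using that by (rule integrable_continuous_real)
  define s where "s = (\<Sum>k\<in>{1..n}. (fourier_cos f k)\<^sup>2)"
  have proj: "integral {-pi..pi} (\<lambda>x. u x * P x) = (\<Sum>k\<in>{1..n}. fourier_cos f k * (pi * fourier_cos u k))"
    if "continuous_on {-pi..pi} u" for u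
  proof -
    have "integral {-pi..pi} (\<lambda>x. u x * P x) = integral {-pi..pi} (\<lambda>x. \<Sum>k\<in>{1..n}. fourier_cos f k * (u x * cos (real k * x)))"
      by (simp add: P_def sum_distrib_left mult_ac)
    also have "\<dots> = (\<Sum>k\<in>{1..n}. fourier_cos f k * integral {-pi..pi} (\<lambda>x. u x * cos (real k * x)))"
      using that by (subst integral_sum) (auto intro!: int continuous_intros)
    finally show ?thesis by (simp add: fourier_cos_def)
  qed
  have fP: "integral {-pi..pi} (\<lambda>x. f x * P x) = pi * s"
    unfolding proj[OF cont] s_def sum_distrib_left by (simp add: power2_eq_square mult_ac)
  have cosP: "fourier_cos P k = fourier_cos f k" if "k \<in> {1..n}" for k
  proof -
    have "integral {-pi..pi} (\<lambda>x. P x * cos (real k * x))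
        = integral {-pi..pi} (\<lambda>x. \<Sum>j\<in>{1..n}. fourier_cos f j * (cos (real j * x) * cos (real k * x)))"
      by (simp add: P_def sum_distrib_right mult.assoc)
    also have "\<dots> = (\<Sum>j\<in>{1..n}. fourier_cos f j * integral {-pi..pi} (\<lambda>x. cos (real j * x) * cos (real k * x)))"
      by (subst integral_sum) (auto intro!: int continuous_intros)
    also have "\<dots> = (\<Sum>j\<in>{1..n}. if j = k then fourier_cos f j * pi else 0)"
    proof (rule sum.cong[OF refl])
      fix j assume "j \<in> {1..n}"
      with that show "fourier_cos f j * integral {-pi..pi} (\<lambda>x. cos (real j * x) * cos (real k * x)) = (if j = k then fourier_cos f j * pi else 0)"
        using integral_cos_cos[of "int j" 0 "int k" 0] by auto
    qed
    also have "\<dots> = fourier_cos f k * pi" using that by (simp add: sum.delta)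
    finally show ?thesis by (simp add: fourier_cos_def)
  qed
  have PP: "integral {-pi..pi} (\<lambda>x. P x * P x) = pi * s"
    unfolding proj[OF contP] s_def sum_distrib_left by (rule sum.cong) (simp_all add: cosP power2_eq_square)
  have "0 \<le> integral {-pi..pi} (\<lambda>x. (f x - P x)\<^sup>2)"
    by (rule integral_nonneg) (auto intro!: int continuous_intros cont contP)
  also have "integral {-pi..pi} (\<lambda>x. (f x - P x)\<^sup>2) = integral {-pi..pi} (\<lambda>x. (f x)\<^sup>2 - 2 * (f x * P x) + P x * P x)"
    by (simp add: power2_eq_square algebra_simps)
  also have "\<dots> = integral {-pi..pi} (\<lambda>x. (f x)\<^sup>2) - 2 * (pi * s) + pi * s"
    using cont contP by (subst integral_add, (auto intro!: int continuous_intros)[2], subst integral_diff,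
      (auto intro!: int continuous_intros)[2]) (simp add: fP PP)
  finally have "pi * s \<le> integral {-pi..pi} (\<lambda>x. (f x)\<^sup>2)" by simp
  also have "\<dots> \<le> integral {-pi..pi} (\<lambda>x. S\<^sup>2)"
  proof (rule integral_le)
    fix x show "(f x)\<^sup>2 \<le> S\<^sup>2" using bd[of x] by (rule power2_le_iff_abs_le[THEN iffD2, rotated]) (use bd[of x] in linarith)
  qed (auto intro!: int continuous_intros cont)
  also have "\<dots> = pi * (2 * S\<^sup>2)" by simp
  finally show ?thesis by (simp add: s_def)
qed

text \<open>Induction on the power: cos x times cos (k x) is the average of the cosines of modes k +
  1 and k - 1.\<close>

lemma fourier_cos_powers:
  assumes cont: "continuous_on {-pi..pi} f" and zero: "\<And>k. integral {-pi..pi} (\<lambda>x. f x * cos (real k * x)) = 0"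
  shows "integral {-pi..pi} (\<lambda>x. f x * cos x ^ j * cos (real k * x)) = 0"
proof (induction j arbitrary: k)
  case (Suc j)
  \<comment> \<open>For k = 0 the lower neighbour -1 is replaced by 1, which has the same cosine;
    natural subtraction would give 0.\<close>
  define i where "i = (if k = 0 then 1 else k - 1)"
  have c: "cos x * cos (real k * x) = (cos (real (k + 1) * x) + cos (real i * x)) / 2" for x
  proof (cases "k = 0")
    case False
    have "cos x * cos (real k * x) = (cos (real k * x - x) + cos (real k * x + x)) / 2"
      by (subst mult.commute) (rule cos_times_cos)
    moreover have "real k * x - x = real i * x" using False by (simp add: i_def of_nat_diff left_diff_distrib)
    moreover have "real k * x + x = real (k + 1) * x" by (simp add: distrib_right)
    ultimately show ?thesis by simp
  qed (simp add: i_def)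
  let ?a = "\<lambda>m x. f x * cos x ^ j * cos (real m * x)"
  have "f x * cos x ^ Suc j * cos (real k * x) = (?a (k + 1) x + ?a i x) / 2" for x
  proof -
    have "f x * cos x ^ Suc j * cos (real k * x) = f x * cos x ^ j * (cos x * cos (real k * x))" by simp
    also have "\<dots> = (?a (k + 1) x + ?a i x) / 2" by (subst c) (simp only: distrib_left times_divide_eq_right)
    finally show ?thesis .
  qed
  then have "integral {-pi..pi} (\<lambda>x. f x * cos x ^ Suc j * cos (real k * x)) = integral {-pi..pi} (\<lambda>x. (?a (k + 1) x + ?a i x) / 2)"
    by (simp only:)
  also have "\<dots> = (integral {-pi..pi} (?a (k + 1)) + integral {-pi..pi} (?a i)) / 2"
    unfolding integral_divide using cont
    by (subst integral_add) (auto intro!: integrable_continuous_real continuous_intros)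
  also have "\<dots> = 0" unfolding Suc.IH by simp
  finally show ?case .
qed (use zero in simp)

text \<open>An even periodic function is a continuous function of \<open>cos x\<close>, so Weierstrass approximation
  by polynomials suffices.\<close>

lemma fourier_cos_unique:
  assumes cont: "continuous_on UNIV f" and ev: "\<And>x. f (- x) = f x" and per: "\<And>x. f (x + 2 * pi) = f x"
    and zero: "\<And>k. integral {-pi..pi} (\<lambda>x. f x * cos (real k * x)) = 0"
  shows "f x = 0"
proof -
  have cont': "continuous_on {-pi..pi} f" using cont continuous_on_subset by blast
  have int: "g integrable_on {-pi..pi}" if "continuous_on {-pi..pi} g" for g :: "real \<Rightarrow> real"
    using that by (rule integrable_continuous_real)
  \<comment> \<open>The only use of evenness: on a period f factors through the cosine.\<close>
  have f: "f (arccos (cos x)) = f x" if "x \<in> {-pi..pi}" for x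
  proof (cases "x \<ge> 0")
    case False
    with that have "arccos (cos (- x)) = - x" by (intro arccos_cos) auto
    then show ?thesis using ev[of x] by simp
  qed (use that arccos_cos in auto)
  have "bounded (f ` {-pi..pi})" by (intro compact_imp_bounded compact_continuous_image cont') auto
  then obtain S where S: "\<And>x. x \<in> {-pi..pi} \<Longrightarrow> \<bar>f x\<bar> \<le> S" unfolding bounded_iff by (metis imageI real_norm_def)
  have "continuous_on {-1..1} (\<lambda>t. f (arccos t))"
    by (rule continuous_on_compose2[OF cont continuous_on_arccos']) auto
  have small: "integral {-pi..pi} (\<lambda>x. (f x)\<^sup>2) \<le> 2 * pi * S * e" if e: "e > 0" for e
  proof -
    obtain p where p: "real_polynomial_function p" "\<And>t. t \<in> {-1..1} \<Longrightarrow> \<bar>f (arccos t) - p t\<bar> < e"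
      using Stone_Weierstrass_real_polynomial_function[OF compact_Icc \<open>continuous_on {-1..1} (\<lambda>t. f (arccos t))\<close> e] by metis
    from p(1) obtain a n where a: "p = (\<lambda>t. \<Sum>i\<le>n. a i * t ^ i)" by (auto simp: real_polynomial_function_iff_sum)
    have "integral {-pi..pi} (\<lambda>x. f x * p (cos x)) = integral {-pi..pi} (\<lambda>x. \<Sum>i\<le>n. a i * (f x * cos x ^ i * cos (real 0 * x)))"
      by (simp add: a sum_distrib_left mult_ac)
    also have "\<dots> = (\<Sum>i\<le>n. a i * integral {-pi..pi} (\<lambda>x. f x * cos x ^ i * cos (real 0 * x)))"
      using cont' by (subst integral_sum) (auto intro!: int continuous_intros)
    also have "\<dots> = 0" unfolding fourier_cos_powers[OF cont' zero] by simp
    finally have z: "integral {-pi..pi} (\<lambda>x. f x * p (cos x)) = 0" .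
    have pc: "continuous_on {-pi..pi} (\<lambda>x. p (cos x))" unfolding a by (intro continuous_intros)
    \<comment> \<open>Orthogonality of f to p (cos x) replaces one factor f by the approximation
      error.\<close>
    have "integral {-pi..pi} (\<lambda>x. (f x)\<^sup>2) = integral {-pi..pi} (\<lambda>x. f x * (f x - p (cos x)) + f x * p (cos x))"
      by (simp add: power2_eq_square algebra_simps)
    also have "\<dots> = integral {-pi..pi} (\<lambda>x. f x * (f x - p (cos x))) + 0"
      unfolding z[symmetric] using cont' pc by (subst integral_add) (auto intro!: int continuous_intros)
    also have "\<dots> \<le> integral {-pi..pi} (\<lambda>x. S * e)"
      unfolding add_0_right
    proof (rule integral_le)
      fix x assume x: "x \<in> {-pi..pi}"
      have "f x * (f x - p (cos x)) \<le> \<bar>f x\<bar> * \<bar>f x - p (cos x)\<bar>" by (metis abs_ge_self abs_mult)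
      also have "\<dots> \<le> S * e"
        using S[OF x] p(2)[of "cos x"] f[OF x] by (intro mult_mono) auto
      finally show "f x * (f x - p (cos x)) \<le> S * e" .
    qed (use cont' pc in \<open>auto intro!: int continuous_intros\<close>)
    also have "\<dots> = 2 * pi * S * e" by simp
    finally show ?thesis .
  qed
  have "integral {-pi..pi} (\<lambda>x. (f x)\<^sup>2) \<le> 0"
  proof (rule field_le_epsilon)
    fix e :: real assume "e > 0"
    have S0: "S \<ge> 0" using S[of 0] by auto
    have "integral {-pi..pi} (\<lambda>x. (f x)\<^sup>2) \<le> 2 * pi * S * (e / (2 * pi * (S + 1)))"
      using \<open>e > 0\<close> S0 by (intro small) auto
    also have "\<dots> \<le> e" using S0 \<open>e > 0\<close> by (simp add: divide_le_eq mult_le_cancel_left)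
    finally show "integral {-pi..pi} (\<lambda>x. (f x)\<^sup>2) \<le> 0 + e" by simp
  qed
  moreover have "integral {-pi..pi} (\<lambda>x. (f x)\<^sup>2) \<ge> 0"
    using cont' by (intro integral_nonneg) (auto intro!: int continuous_intros)
  ultimately have "integral {-pi..pi} (\<lambda>x. (f x)\<^sup>2) = 0" by simp
  moreover have "continuous_on {-pi..pi} (\<lambda>x. (f x)\<^sup>2)" by (intro continuous_intros cont')
  ultimately have base: "f x = 0" if "x \<in> {-pi..pi}" for x
    using integral_eq_0_iff[of "-pi" pi "\<lambda>x. (f x)\<^sup>2"] that by auto
  have per': "f (x + of_int n * (2 * pi)) = f x" for x n
  proof (induction n arbitrary: x rule: int_induct[where k = 0])
    case (step1 i)
    have "x + of_int (i + 1) * (2 * pi) = (x + of_int i * (2 * pi)) + 2 * pi" by (simp add: algebra_simps)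
    with step1 show ?case using per by metis
  next
    case (step2 i)
    have "x + of_int i * (2 * pi) = (x + of_int (i - 1) * (2 * pi)) + 2 * pi" by (simp add: algebra_simps)
    with step2 show ?case using per by metis
  qed simp
  define n where "n = \<lfloor>(x + pi) / (2 * pi)\<rfloor>"
  have "of_int n \<le> (x + pi) / (2 * pi)" "(x + pi) / (2 * pi) \<le> of_int n + 1" unfolding n_def by linarith+
  then have "x + of_int (- n) * (2 * pi) \<in> {-pi..pi}" by (auto simp: field_simps)
  from base[OF this] show ?thesis by (simp only: per')
qed

section \<open>The conjugate Dirichlet kernel and partial sums\<close>

lemma sin_half_ge:
  assumes "0 \<le> u" "u \<le> pi"
  shows "u / 4 \<le> sin (u / 2)"
proof -
  have "\<bar>sin (u / 2) - (\<Sum>m<3. sin_coeff m * (u / 2) ^ m)\<bar> \<le> inverse (fact 3) * \<bar>u / 2\<bar> ^ 3"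
    by (rule Maclaurin_sin_bound)
  then have "\<bar>sin (u / 2) - u / 2\<bar> \<le> (u / 2) ^ 3 / 6"
    using assms by (simp add: numeral_3_eq_3 sin_coeff_def fact_numeral)
  moreover have "(u / 2) ^ 3 / 6 \<le> u / 4"
  proof -
    have "pi \<le> 3.2" by (rule order_trans[OF pi_approx(2)]) simp
    then have "u \<le> 3.2" using assms by linarith
    \<comment> \<open>The cubic term u^3 / 48 is at most u / 4 exactly when u^2 \<le> 12, and 3.2^2
      is below 12.\<close>
    then have "u * u \<le> 3.2 * 3.2" using assms by (intro mult_mono) auto
    then have "u * (u * u) \<le> u * 12" using assms by (intro mult_left_mono) auto
    then show ?thesis by (simp add: power3_eq_cube)
  qed
  ultimately show ?thesis by linarith
qed

text \<open>Multiplication by 2 sin (u / 2) makes the sum telescope to a difference of two cosines,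
  at most 2 in absolute value; the lower bound u / 4 for the sine gives 4 / u.\<close>

lemma conjugate_dirichlet_bound:
  assumes "0 < u" "u \<le> pi"
  shows "\<bar>\<Sum>k<n. sin (real (Suc k) * u)\<bar> \<le> 4 / u"
proof -
  have "2 * sin (u / 2) * (\<Sum>k<n. sin (real (Suc k) * u)) = cos (u / 2) - cos ((real n + 1/2) * u)"
  proof (induction n)
    case (Suc n)
    have "2 * sin (u / 2) * sin (real (Suc n) * u) = cos (u / 2 - real (Suc n) * u) - cos (u / 2 + real (Suc n) * u)"
      by (simp only: mult.assoc sin_times_sin) simp
    moreover have "cos (u / 2 - real (Suc n) * u) = cos ((real n + 1/2) * u)"
      by (subst cos_minus[symmetric]) (simp add: algebra_simps)
    moreover have "u / 2 + real (Suc n) * u = (real (Suc n) + 1/2) * u" by (simp add: algebra_simps)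
    ultimately show ?case using Suc by (simp add: distrib_left del: of_nat_Suc)
  qed simp
  moreover have "\<bar>cos (u / 2) - cos ((real n + 1/2) * u)\<bar> \<le> 2"
    using abs_cos_le_one[of "u / 2"] abs_cos_le_one[of "(real n + 1/2) * u"] by linarith
  ultimately have "2 * \<bar>sin (u / 2)\<bar> * \<bar>\<Sum>k<n. sin (real (Suc k) * u)\<bar> \<le> 2"
    by (metis abs_mult abs_numeral)
  moreover have s: "u / 4 \<le> \<bar>sin (u / 2)\<bar>" using sin_half_ge[of u] assms by linarith
  then have "2 * (u / 4) * \<bar>\<Sum>k<n. sin (real (Suc k) * u)\<bar> \<le> 2 * \<bar>sin (u / 2)\<bar> * \<bar>\<Sum>k<n. sin (real (Suc k) * u)\<bar>"
    by (intro mult_right_mono) auto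
  ultimately show ?thesis using assms by (simp add: field_simps)
qed

text \<open>Since D is even, the integral of D t * sin (k (x - t)) keeps only the cosine
  coefficient. Periodicity centres the integral at x, and folding the two halves together produces
  the difference D (x - u) - D (x + u).\<close>

lemma conjugate_coefficient:
  assumes cont: "continuous_on UNIV D" and ev: "\<And>x. D (- x) = D x" and per: "\<And>x. D (x + 2 * pi) = D x"
  shows "pi * (fourier_cos D k * sin (real k * x)) = integral {0..pi} (\<lambda>u. (D (x - u) - D (x + u)) * sin (real k * u))"
proof -
  have cD: "continuous_on S (\<lambda>u. D (q u))" if "continuous_on S q" for S and q :: "real \<Rightarrow> real"
    using continuous_on_compose2[OF cont that] by auto
  have int: "g integrable_on {a..b}" if "continuous_on {a..b} g" for g :: "real \<Rightarrow> real" and a b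
    using that by (rule integrable_continuous_real)
  have s0: "integral {-pi..pi} (\<lambda>t. D t * sin (real k * t)) = 0"
  proof -
    have "integral {-pi..- (-pi)} (\<lambda>t. D (- t) * sin (real k * (- t))) = integral {-pi..pi} (\<lambda>t. D t * sin (real k * t))"
      by (rule Henstock_Kurzweil_Integration.integral_reflect_real)
    then show ?thesis by (simp add: ev)
  qed
  let ?G = "\<lambda>t. D t * sin (real k * (x - t))"
  have "integral {x - pi..x + pi} ?G = integral {-pi..pi} ?G"
  proof (rule periodic_integral_shift)
    have "sin (real k * (x - (t + 2 * pi))) = sin (real k * (x - t))" for t
    proof -
      have "real k * (x - (t + 2 * pi)) = real k * (x - t) - 2 * real k * pi" by (simp add: algebra_simps)
      then show ?thesis by (simp only: sin_diff[of "real k * (x - t)" "2 * real k * pi"] sin_2npi cos_2npi mult_1_right mult_zero_right diff_zero)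
    qed
    then show "?G (t + 2 * pi) = ?G t" for t by (simp add: per)
  qed (intro continuous_intros cD)
  also have "\<dots> = integral {-pi..pi} (\<lambda>t. sin (real k * x) * (D t * cos (real k * t)) - cos (real k * x) * (D t * sin (real k * t)))"
    by (simp add: right_diff_distrib sin_diff algebra_simps)
  also have "\<dots> = sin (real k * x) * integral {-pi..pi} (\<lambda>t. D t * cos (real k * t)) - cos (real k * x) * integral {-pi..pi} (\<lambda>t. D t * sin (real k * t))"
    by (subst integral_diff) (auto intro!: int continuous_intros cD)
  also have "\<dots> = pi * (fourier_cos D k * sin (real k * x))"
    unfolding s0 by (simp add: fourier_cos_def)
  finally have 1: "integral {x - pi..x + pi} ?G = pi * (fourier_cos D k * sin (real k * x))" .
  have "integral {x - pi..x + pi} ?G = integral {-pi..pi} (\<lambda>u. D (u + x) * sin (real k * (- u)))"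
    using integral_shift_real_ivl[of "x - pi" x "x + pi" ?G] by simp
  also have "\<dots> = integral {-pi..0} (\<lambda>u. D (u + x) * sin (real k * (- u))) + integral {0..pi} (\<lambda>u. D (u + x) * sin (real k * (- u)))"
    by (rule Henstock_Kurzweil_Integration.integral_combine[symmetric]) (auto intro!: int continuous_intros cD)
  also have "integral {-pi..0} (\<lambda>u. D (u + x) * sin (real k * (- u))) = integral {0..pi} (\<lambda>u. D (x - u) * sin (real k * u))"
    using Henstock_Kurzweil_Integration.integral_reflect_real[of pi 0 "\<lambda>u. D (x - u) * sin (real k * u)"] by (simp add: add.commute)
  finally have 2: "integral {x - pi..x + pi} ?G = integral {0..pi} (\<lambda>u. D (x - u) * sin (real k * u)) + integral {0..pi} (\<lambda>u. D (u + x) * sin (real k * (- u)))" .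
  also have "\<dots> = integral {0..pi} (\<lambda>u. D (x - u) * sin (real k * u) + D (u + x) * sin (real k * (- u)))"
    by (rule integral_add[symmetric]) (auto intro!: int continuous_intros cD)
  also have "\<dots> = integral {0..pi} (\<lambda>u. (D (x - u) - D (x + u)) * sin (real k * u))"
    by (intro integral_cong) (simp add: algebra_simps)
  finally show ?thesis using 1 by simp
qed

text \<open>The difference decays like u^\<beta> and the kernel grows at most like 4 / u, so the
  integrand is dominated by the integrable u^(\<beta> - 1). The resulting bound is independent of n
  and x.\<close>

lemma conjugate_partial_sum_bound:
  assumes cont: "continuous_on UNIV D" and ev: "\<And>x. D (- x) = D x" and per: "\<And>x. D (x + 2 * pi) = D x"
    and \<beta>: "\<beta> > 0" and bd: "\<And>x u. 0 < u \<Longrightarrow> u \<le> pi \<Longrightarrow> \<bar>D (x - u) - D (x + u)\<bar> \<le> A * u powr \<beta>"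
  shows "\<bar>\<Sum>k<n. fourier_cos D (Suc k) * sin (real (Suc k) * x)\<bar> \<le> 4 * A * pi powr \<beta> / (\<beta> * pi)"
proof -
  have cD: "continuous_on S (\<lambda>u. D (q u))" if "continuous_on S q" for S and q :: "real \<Rightarrow> real"
    using continuous_on_compose2[OF cont that] by auto
  let ?I = "\<lambda>u. (D (x - u) - D (x + u)) * (\<Sum>k<n. sin (real (Suc k) * u))"
  have "pi * (\<Sum>k<n. fourier_cos D (Suc k) * sin (real (Suc k) * x))
      = (\<Sum>k<n. integral {0..pi} (\<lambda>u. (D (x - u) - D (x + u)) * sin (real (Suc k) * u)))"
    unfolding sum_distrib_left conjugate_coefficient[OF cont ev per] by simp
  also have "\<dots> = integral {0..pi} ?I"
    unfolding sum_distrib_left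
    by (rule integral_sum[symmetric]) (auto intro!: integrable_continuous_real continuous_intros cD)
  finally have e: "pi * (\<Sum>k<n. fourier_cos D (Suc k) * sin (real (Suc k) * x)) = integral {0..pi} ?I" .
  have p: "((\<lambda>u. 4 * A * u powr (\<beta> - 1)) has_integral 4 * A * (pi powr (\<beta> - 1 + 1) / (\<beta> - 1 + 1))) {0..pi}"
    by (intro has_integral_mult_right has_integral_powr_from_0) (use \<beta> in auto)
  have "norm (integral {0..pi} ?I) \<le> integral {0..pi} (\<lambda>u. 4 * A * u powr (\<beta> - 1))"
  proof (rule integral_norm_bound_integral)
    show "?I integrable_on {0..pi}" by (intro integrable_continuous_real continuous_intros cD)
    show "(\<lambda>u. 4 * A * u powr (\<beta> - 1)) integrable_on {0..pi}" using p by blast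
    fix u assume u: "u \<in> {0..pi}"
    show "norm (?I u) \<le> 4 * A * u powr (\<beta> - 1)"
    proof (cases "u = 0")
      case False
      with u have u': "0 < u" "u \<le> pi" by auto
      have "norm (?I u) \<le> (A * u powr \<beta>) * (4 / u)"
        unfolding real_norm_def abs_mult
        by (intro mult_mono bd[OF u'] conjugate_dirichlet_bound[OF u'] order_trans[OF abs_ge_zero bd[OF u']]) auto
      also have "u powr \<beta> = u powr (\<beta> - 1) * u" using u' by (simp add: powr_diff)
      finally show ?thesis using u' by (simp add: mult_ac)
    qed simp
  qed
  also have "\<dots> = 4 * A * pi powr \<beta> / \<beta>" using integral_unique[OF p] by simp
  finally have "pi * \<bar>\<Sum>k<n. fourier_cos D (Suc k) * sin (real (Suc k) * x)\<bar> \<le> 4 * A * pi powr \<beta> / \<beta>"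
    unfolding e[symmetric] by (simp add: abs_mult)
  then have "\<bar>\<Sum>k<n. fourier_cos D (Suc k) * sin (real (Suc k) * x)\<bar> \<le> 4 * A * pi powr \<beta> / \<beta> / pi"
    unfolding pos_le_divide_eq[OF pi_gt_zero] by (simp only: mult.commute)
  then show ?thesis by (simp only: divide_divide_eq_left)
qed

section \<open>Uniform convergence of conjugate Fourier series\<close>

lemma tser_periodic: "tser c \<phi> (x + 2 * pi) = tser c \<phi> x"
proof -
  have "cos (real_of_int k * (x + 2 * pi) + \<phi>) = cos (real_of_int k * x + \<phi>)" for k
  proof -
    have "real_of_int k * (x + 2 * pi) + \<phi> = real_of_int k * x + \<phi> + 2 * pi * of_int k" by (simp add: algebra_simps)
    then show ?thesis by (simp only: cos_add[of "real_of_int k * x + \<phi>" "2 * pi * of_int k"] cos_int_2pin sin_int_2pin mult_1_right mult_zero_right diff_zero)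
  qed
  then show ?thesis by (simp add: tser_def)
qed

lemma Ecos_even: "Ecos c (- x) = Ecos c x"
  by (simp add: Ecos_def tser_def)

lemma summable_fourier_cos_Ecos:
  assumes "c abs_summable_on UNIV"
  shows "summable (\<lambda>k. \<bar>fourier_cos (Ecos c) (Suc k)\<bar>)"
proof (rule summable_comparison_test')
  have "(\<lambda>k. \<bar>c k\<bar>) abs_summable_on UNIV" using assms by simp
  from has_sum_int_sums[OF this]
  show "summable (\<lambda>n. \<bar>c (int (Suc n))\<bar> + \<bar>c (- int (Suc n))\<bar>)" by (rule sums_summable)
  show "norm \<bar>fourier_cos (Ecos c) (Suc n)\<bar> \<le> \<bar>c (int (Suc n))\<bar> + \<bar>c (- int (Suc n))\<bar>" if "n \<ge> 0" for n
    unfolding fourier_cos_Ecos[OF assms] by simp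
qed

text \<open>The symmetric difference quotients \<open>P\<close> of \<open>F\<close> have absolutely summable coefficients and keep the
  Hoelder constant of \<open>f\<close>, so \<open>f - P\<close> is small in a weaker Hoelder norm, which controls all conjugate
  partial sums at once.\<close>

lemma conjugate_series_uniformly_convergent:
  fixes f F :: "real \<Rightarrow> real"
  assumes F: "\<And>x. (F has_real_derivative f x) (at x)" and c: "c abs_summable_on UNIV" "F = Osin c"
    and cont: "continuous_on UNIV f" and ev: "\<And>x. f (- x) = f x" and per: "\<And>x. f (x + 2 * pi) = f x"
    and \<alpha>: "0 < \<alpha>" and K: "K > 0" and hoe: "\<And>x y. \<bar>f x - f y\<bar> \<le> K * \<bar>x - y\<bar> powr \<alpha>"
  shows "uniformly_convergent_on UNIV (\<lambda>N x. \<Sum>k<N. fourier_cos f (Suc k) * sin (real (Suc k) * x))"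
proof -
  define P where "P d x = (F (x + d) - F (x - d)) / (2 * d)" for d x
  \<comment> \<open>The symmetric difference quotient multiplies mode k by sin (k d) / d, which is
    at most 1 / d, so it inherits summability from F; the phase pi / 2 contributes the sign.\<close>
  define cd where "cd d k = - (c k * sin (real_of_int k * d)) / d" for d k
  have cd: "cd d abs_summable_on UNIV" if "d > 0" for d
  proof (rule Infinite_Sum.abs_summable_on_comparison_test)
    show "(\<lambda>k. c k * (1 / d)) abs_summable_on UNIV"
      unfolding norm_mult by (rule summable_on_cmult_left[OF c(1)])
    show "norm (cd d k) \<le> norm (c k * (1 / d))" for k
      using that by (simp add: cd_def abs_mult divide_right_mono mult_left_le)
  qed
  have PE: "P d = Ecos (cd d)" if "d > 0" for d
  proof
    fix x
    have "((\<lambda>k. (c k * cos (real_of_int k * (x + d) + pi/2) + - (c k * cos (real_of_int k * (x - d) + pi/2))) * (1 / (2 * d)))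
        has_sum (F (x + d) + - F (x - d)) * (1 / (2 * d))) UNIV"
      unfolding c(2) Osin_def by (intro has_sum_cmult_left has_sum_add has_sum_uminusI tser_has_sum c(1))
    moreover have "(c k * cos (real_of_int k * (x + d) + pi/2) + - (c k * cos (real_of_int k * (x - d) + pi/2))) * (1 / (2 * d))
        = cd d k * cos (real_of_int k * x + 0)" for k
    proof -
      have m: "cos (t + pi/2) = - sin t" for t :: real using minus_sin_cos_eq[of t] by simp
      have g: "a * - u + - (a * - v) = - (a * (u - v))" for a u v :: real by (simp add: algebra_simps)
      have s: "sin (real_of_int k * (x + d)) - sin (real_of_int k * (x - d)) = 2 * (cos (real_of_int k * x) * sin (real_of_int k * d))"
        by (simp only: distrib_left right_diff_distrib sin_add sin_diff)
      have "(c k * cos (real_of_int k * (x + d) + pi/2) + - (c k * cos (real_of_int k * (x - d) + pi/2)))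
          = - (2 * c k * (cos (real_of_int k * x) * sin (real_of_int k * d)))"
        unfolding m g s by simp
      then show ?thesis using that by (simp add: cd_def)
    qed
    ultimately have "((\<lambda>k. cd d k * cos (real_of_int k * x + 0)) has_sum P d x) UNIV" by (simp add: P_def)
    moreover have "((\<lambda>k. cd d k * cos (real_of_int k * x + 0)) has_sum Ecos (cd d) x) UNIV"
      unfolding Ecos_def by (rule tser_has_sum[OF cd[OF that]])
    ultimately show "P d x = Ecos (cd d) x" by (rule has_sum_unique)
  qed
  have Pf: "\<bar>f x - P d x\<bar> \<le> K * d powr \<alpha>" if d0: "d > 0" for d x
  proof -
    obtain z where z: "x - d < z" "z < x + d" "F (x + d) - F (x - d) = (x + d - (x - d)) * f z"
      using MVT2[of "x - d" "x + d" F f] F d0 by auto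
    then have "P d x = f z" using d0 by (simp add: P_def)
    moreover have "\<bar>f x - f z\<bar> \<le> K * \<bar>x - z\<bar> powr \<alpha>" by (rule hoe)
    moreover have "K * \<bar>x - z\<bar> powr \<alpha> \<le> K * d powr \<alpha>"
      using z K \<alpha> by (intro mult_left_mono powr_mono2) auto
    ultimately show ?thesis by simp
  qed
  \<comment> \<open>The mean value theorem for the difference F (x + s) - F (y + s) gives one common
    point z for both quotients, which preserves the Hoelder constant.\<close>
  have Ph: "\<bar>P d x - P d y\<bar> \<le> K * \<bar>x - y\<bar> powr \<alpha>" if d0: "d > 0" for d x y
  proof -
    have D: "((\<lambda>s. F (x + s) - F (y + s)) has_real_derivative f (x + s) - f (y + s)) (at s)" for s
    proof (rule DERIV_diff)
      have "((\<lambda>s. F (u + s)) has_real_derivative f (u + s) * 1) (at s)" for u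
        by (rule DERIV_chain2[OF F]) (auto intro!: derivative_eq_intros)
      then show "((\<lambda>s. F (x + s)) has_real_derivative f (x + s)) (at s)"
        "((\<lambda>s. F (y + s)) has_real_derivative f (y + s)) (at s)" by simp_all
    qed
    obtain z where z: "F (x + d) - F (y + d) - (F (x + - d) - F (y + - d)) = (d - (- d)) * (f (x + z) - f (y + z))"
      using MVT2[of "- d" d "\<lambda>s. F (x + s) - F (y + s)" "\<lambda>s. f (x + s) - f (y + s)"] D d0 by auto
    have "P d x - P d y = (F (x + d) - F (y + d) - (F (x + - d) - F (y + - d))) / (2 * d)"
      by (simp add: P_def diff_divide_distrib)
    also have "\<dots> = f (x + z) - f (y + z)" unfolding z using that by simp
    finally show ?thesis using hoe[of "x + z" "y + z"] by simp
  qed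
  define A where "A d = 2 * K * d powr (\<alpha> / 2) * 2 powr (\<alpha> / 2)" for d
  have contP: "continuous_on UNIV (P d)" if "d > 0" for d
    unfolding PE[OF that] Ecos_def by (rule continuous_on_tser[OF cd[OF that]])
  \<comment> \<open>Interpolation: a quantity bounded by multiples of both d^\<alpha> and (2
    u)^\<alpha> is bounded by the same multiple of their geometric mean. Half of the exponent
    supplies smallness, the other half decay in u.\<close>
  have Dbound: "\<bar>(f (x - u) - P d (x - u)) - (f (x + u) - P d (x + u))\<bar> \<le> A d * u powr (\<alpha> / 2)"
    if "d > 0" "0 < u" for d x u
  proof -
    let ?z = "\<bar>(f (x - u) - P d (x - u)) - (f (x + u) - P d (x + u))\<bar>"
    have 1: "?z \<le> 2 * K * d powr \<alpha>" using Pf[OF that(1), of "x - u"] Pf[OF that(1), of "x + u"] by linarith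
    have e: "\<bar>(x - u) - (x + u)\<bar> = 2 * u" using that by simp
    have 2: "?z \<le> 2 * K * (2 * u) powr \<alpha>"
      using hoe[of "x - u" "x + u", unfolded e] Ph[OF that(1), of "x - u" "x + u", unfolded e] by linarith
    have h: "t powr \<alpha> = t powr (\<alpha> / 2) * t powr (\<alpha> / 2)" if "t > 0" for t :: real
      using that by (simp add: powr_add[symmetric])
    have "?z \<le> 2 * K * (d powr (\<alpha> / 2) * (2 * u) powr (\<alpha> / 2))"
    proof (cases "d \<le> 2 * u")
      case True
      note 1
      also have "2 * K * d powr \<alpha> \<le> 2 * K * (d powr (\<alpha> / 2) * (2 * u) powr (\<alpha> / 2))"
        unfolding h[OF that(1)] using True that K \<alpha> by (intro mult_left_mono powr_mono2) auto
      finally show ?thesis .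
    next
      case False
      note 2
      also have "2 * K * (2 * u) powr \<alpha> \<le> 2 * K * (d powr (\<alpha> / 2) * (2 * u) powr (\<alpha> / 2))"
        using False that K \<alpha> h[of "2 * u"] by (simp only: h) (intro mult_left_mono mult_right_mono powr_mono2, auto)
      finally show ?thesis .
    qed
    also have "\<dots> = A d * u powr (\<alpha> / 2)" using that by (simp add: A_def powr_mult)
    finally show ?thesis .
  qed
  define C where "C = 4 * (2 * K * 2 powr (\<alpha> / 2)) * pi powr (\<alpha> / 2) / (\<alpha> / 2 * pi)"
  have C: "C > 0" using K \<alpha> by (simp add: C_def)
  let ?\<sigma> = "\<lambda>g N x. \<Sum>k<N. fourier_cos g (Suc k) * sin (real (Suc k) * x)"
  have Dsum: "\<bar>?\<sigma> (\<lambda>x. f x - P d x) N x\<bar> \<le> C * d powr (\<alpha> / 2)" if "d > 0" for d N x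
  proof -
    have "\<bar>?\<sigma> (\<lambda>x. f x - P d x) N x\<bar> \<le> 4 * A d * pi powr (\<alpha> / 2) / (\<alpha> / 2 * pi)"
    proof (rule conjugate_partial_sum_bound)
      show "continuous_on UNIV (\<lambda>x. f x - P d x)" by (intro continuous_on_diff cont contP that)
      show "f (- x) - P d (- x) = f x - P d x" for x by (simp add: ev PE[OF that] Ecos_even)
      show "f (x + 2 * pi) - P d (x + 2 * pi) = f x - P d x" for x
        by (simp add: per PE[OF that] Ecos_def tser_periodic)
    qed (use \<alpha> Dbound that in auto)
    then show ?thesis by (simp add: A_def C_def mult_ac)
  qed
  have split: "?\<sigma> f N x = ?\<sigma> (\<lambda>x. f x - P d x) N x + ?\<sigma> (P d) N x" if "d > 0" for d N x
  proof -
    have "fourier_cos f k = fourier_cos (\<lambda>x. f x - P d x) k + fourier_cos (P d) k" for k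
    proof -
      have i: "(\<lambda>x. g x * cos (real k * x)) integrable_on {-pi..pi}" if "continuous_on UNIV g" for g
        using continuous_on_subset[OF that] by (intro integrable_continuous_real continuous_intros) auto
      have "integral {-pi..pi} (\<lambda>x. (f x - P d x) * cos (real k * x) + P d x * cos (real k * x))
          = integral {-pi..pi} (\<lambda>x. (f x - P d x) * cos (real k * x)) + integral {-pi..pi} (\<lambda>x. P d x * cos (real k * x))"
        by (intro integral_add i continuous_on_diff cont contP that)
      then show ?thesis by (simp add: fourier_cos_def add_divide_distrib[symmetric] algebra_simps)
    qed
    then show ?thesis by (simp only: distrib_right sum.distrib)
  qed
  show ?thesis
  proof (rule Cauchy_uniformly_convergent, rule uniformly_Cauchy_onI')
    fix e :: real assume "e > 0"
    \<comment> \<open>Chosen so that each conjugate partial sum of f - P is at most e / 4; two of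
      these and a tail of P below e / 4 stay under e.\<close>
    define d where "d = (e / (4 * C)) powr (2 / \<alpha>)"
    have d: "d > 0" using \<open>e > 0\<close> C by (simp add: d_def)
    have "d powr (\<alpha> / 2) = e / (4 * C)" using \<alpha> \<open>e > 0\<close> C by (simp add: d_def powr_powr)
    then have Ce: "C * d powr (\<alpha> / 2) = e / 4" using C by simp
    have "summable (\<lambda>k. \<bar>fourier_cos (P d) (Suc k)\<bar>)"
      unfolding PE[OF d] by (rule summable_fourier_cos_Ecos[OF cd[OF d]])
    moreover have "e / 4 > 0" using \<open>e > 0\<close> by simp
    ultimately obtain M where M: "\<And>m n. m \<ge> M \<Longrightarrow> norm (\<Sum>k=m..<n. \<bar>fourier_cos (P d) (Suc k)\<bar>) < e / 4"
      unfolding summable_Cauchy by blast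
    have "dist (?\<sigma> f m x) (?\<sigma> f n x) < e" if "m \<ge> M" "n > m" for m n x
    proof -
      have "?\<sigma> (P d) n x - ?\<sigma> (P d) m x = (\<Sum>k=m..<n. fourier_cos (P d) (Suc k) * sin (real (Suc k) * x))"
        using sum_diff_nat_ivl[of 0 m n "\<lambda>k. fourier_cos (P d) (Suc k) * sin (real (Suc k) * x)"] that by (simp add: lessThan_atLeast0)
      also have "\<bar>\<dots>\<bar> \<le> (\<Sum>k=m..<n. \<bar>fourier_cos (P d) (Suc k) * sin (real (Suc k) * x)\<bar>)" by (rule sum_abs)
      also have "\<dots> \<le> (\<Sum>k=m..<n. \<bar>fourier_cos (P d) (Suc k)\<bar>)"
        by (intro sum_mono) (simp add: abs_mult mult_left_le del: of_nat_Suc)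
      also have "\<dots> < e / 4" using M[OF that(1), of n] by simp
      finally have "\<bar>?\<sigma> (P d) n x - ?\<sigma> (P d) m x\<bar> < e / 4" .
      moreover have "\<bar>?\<sigma> (\<lambda>x. f x - P d x) m x\<bar> \<le> e / 4" "\<bar>?\<sigma> (\<lambda>x. f x - P d x) n x\<bar> \<le> e / 4"
        using Dsum[OF d, where N = m and x = x] Dsum[OF d, where N = n and x = x] unfolding Ce by auto
      ultimately show ?thesis
        using \<open>e > 0\<close> unfolding dist_real_def split[OF d, where N = m] split[OF d, where N = n] by linarith
    qed
    then show "\<exists>M. \<forall>x\<in>UNIV. \<forall>m\<ge>M. \<forall>n>m. dist (?\<sigma> f m x) (?\<sigma> f n x) < e" by blast
  qed
qed

section \<open>Fourier coefficients of elements of X\<close>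

lemma deriv2: "(deriv ^^ 2) w = deriv (deriv w)"
  by (simp add: numeral_2_eq_2)

lemma X_space_props:
  assumes "w \<in> X_space \<alpha>"
  shows X_even: "w (- x) = w x" and X_periodic: "w (x + 2 * pi) = w x"
    and X_deriv: "(w has_real_derivative deriv w x) (at x)"
    and X_deriv2: "(deriv w has_real_derivative deriv (deriv w) x) (at x)"
    and X_continuous2: "continuous_on UNIV (deriv (deriv w))"
    and X_hoelder: "\<exists>K>0. \<forall>x y. \<bar>deriv (deriv w) x - deriv (deriv w) y\<bar> \<le> K * \<bar>x - y\<bar> powr \<alpha>"
    and X_mean: "mean w = 0"
    and X_periodic1: "deriv w (x + 2 * pi) = deriv w x"
    and X_periodic2: "deriv (deriv w) (x + 2 * pi) = deriv (deriv w) x"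
    and X_odd1: "deriv w (- x) = - deriv w x"
    and X_even2: "deriv (deriv w) (- x) = deriv (deriv w) x"
proof -
  have w: "w \<in> hoelder_space 2 \<alpha>" and m: "mean w = 0" using assms by (auto simp: X_space_def)
  show "mean w = 0" by (rule m)
  show even: "w (- x) = w x" and "w (x + 2 * pi) = w x" for x using w by (auto simp: hoelder_space_def)
  have "(deriv ^^ 0) w field_differentiable at x" "(deriv ^^ 1) w field_differentiable at x" for x
    using w unfolding hoelder_space_def by (simp_all only: mem_Collect_eq)
  then show d1: "(w has_real_derivative deriv w x) (at x)"
    and d2: "(deriv w has_real_derivative deriv (deriv w) x) (at x)" for x
    by (auto simp: field_differentiable_derivI)
  show "continuous_on UNIV (deriv (deriv w))" using w by (simp add: hoelder_space_def deriv2)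
  obtain C where C: "\<And>x y. \<bar>deriv (deriv w) x - deriv (deriv w) y\<bar> \<le> C * \<bar>x - y\<bar> powr \<alpha>"
    using w by (auto simp: hoelder_space_def deriv2)
  have "C * \<bar>x - y\<bar> powr \<alpha> \<le> (max C 1) * \<bar>x - y\<bar> powr \<alpha>" for x y by (intro mult_right_mono) auto
  then show "\<exists>K>0. \<forall>x y. \<bar>deriv (deriv w) x - deriv (deriv w) y\<bar> \<le> K * \<bar>x - y\<bar> powr \<alpha>"
    using order_trans[OF C] by (intro exI[of _ "max C 1"]) auto
  show "deriv w (x + 2 * pi) = deriv w x" using hoelder_deriv_periodic[OF w, of 1 x] by simp
  show "deriv (deriv w) (x + 2 * pi) = deriv (deriv w) x" using hoelder_deriv_periodic[OF w, of 2 x] by (simp add: deriv2)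
  show o: "deriv w (- x) = - deriv w x" for x
  proof -
    have "((\<lambda>x. w (- x)) has_real_derivative deriv w (- x) * (- 1)) (at x)"
      by (rule DERIV_chain2[OF d1]) (auto intro!: derivative_eq_intros)
    then show ?thesis using DERIV_unique[OF _ d1] by (fastforce simp: even)
  qed
  have "((\<lambda>x. deriv w (- x)) has_real_derivative deriv (deriv w) (- x) * (- 1)) (at x)"
    by (rule DERIV_chain2[OF d2]) (auto intro!: derivative_eq_intros)
  moreover have "((\<lambda>x. deriv w (- x)) has_real_derivative - deriv (deriv w) x) (at x)"
    unfolding o by (intro DERIV_minus d2)
  ultimately show "deriv (deriv w) (- x) = deriv (deriv w) x" using DERIV_unique by fastforce
qed

lemma fourier_cos_deriv2:
  assumes w: "w \<in> X_space \<alpha>"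
  shows "fourier_cos (deriv (deriv w)) k = - ((real k)\<^sup>2 * fourier_cos w k)"
proof -
  let ?G = "\<lambda>x. deriv w x * cos (real k * x) + real k * (w x * sin (real k * x))"
  have c: "continuous_on {-pi..pi} (deriv (deriv w))" "continuous_on {-pi..pi} w"
    using X_continuous2[OF w] continuous_on_subset DERIV_continuous_on[of "{-pi..pi}" w] X_deriv[OF w] has_field_derivative_at_within by blast+
  have "((\<lambda>x. deriv (deriv w) x * cos (real k * x) + (real k)\<^sup>2 * (w x * cos (real k * x))) has_integral ?G pi - ?G (- pi)) {-pi..pi}"
  proof (rule fundamental_theorem_of_calculus)
    fix x
    have "(?G has_real_derivative deriv (deriv w) x * cos (real k * x) + (real k)\<^sup>2 * (w x * cos (real k * x))) (at x)"
      by (auto intro!: derivative_eq_intros X_deriv[OF w] X_deriv2[OF w] simp: power2_eq_square algebra_simps)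
    then show "(?G has_vector_derivative deriv (deriv w) x * cos (real k * x) + (real k)\<^sup>2 * (w x * cos (real k * x))) (at x within {-pi..pi})"
      by (simp add: has_real_derivative_iff_has_vector_derivative has_vector_derivative_at_within)
  qed simp
  moreover have "deriv w pi = deriv w (- pi)" using X_periodic1[OF w, of "- pi"] by simp
  then have "?G pi - ?G (- pi) = 0" by simp
  ultimately have "integral {-pi..pi} (\<lambda>x. deriv (deriv w) x * cos (real k * x) + (real k)\<^sup>2 * (w x * cos (real k * x))) = 0"
    by (simp only: integral_unique)
  also have "integral {-pi..pi} (\<lambda>x. deriv (deriv w) x * cos (real k * x) + (real k)\<^sup>2 * (w x * cos (real k * x)))
      = integral {-pi..pi} (\<lambda>x. deriv (deriv w) x * cos (real k * x)) + (real k)\<^sup>2 * integral {-pi..pi} (\<lambda>x. w x * cos (real k * x))"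
    using c by (subst integral_add) (auto intro!: integrable_continuous_real continuous_intros)
  finally show ?thesis by (simp add: fourier_cos_def field_simps)
qed

text \<open>Represents w' as an odd element: the cosine coefficient a_k of w sits halved at k and
  -k, and differentiation multiplies it by the mode.\<close>

definition wb :: "(real \<Rightarrow> real) \<Rightarrow> unit wien" where
  "wb w = Wien (\<lambda>k. real_of_int k * fourier_cos w (nat \<bar>k\<bar>) / 2)"

lemma sum_inverse_squares: "(\<Sum>k\<in>{1..n}. 1 / (real k)\<^sup>2) \<le> 2"
proof -
  have main: "(\<Sum>k\<in>{1..n}. 1 / (real k)\<^sup>2) \<le> 2 - 1 / real n" if "n \<ge> 1" for n
    using that
  proof (induction n rule: dec_induct)
    case (step n)
    have n: "real n > 0" using step by simp
    have "1 / (real n + 1)\<^sup>2 \<le> 1 / (real n * (real n + 1))"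
      using n by (intro divide_left_mono) (auto simp: power2_eq_square)
    also have "\<dots> = 1 / real n - 1 / (real n + 1)" using n by (simp add: field_simps)
    finally show ?case using step by (simp add: add.commute)
  qed simp
  show ?thesis
  proof (cases "n \<ge> 1")
    case True
    have "1 / real n \<ge> 0" by simp
    with main[OF True] show ?thesis by linarith
  qed simp
qed

lemma sum_symmetric_int:
  fixes f :: "int \<Rightarrow> real"
  shows "(\<Sum>k\<in>{- int n..int n}. f k) = f 0 + (\<Sum>k\<in>{1..n}. f (int k) + f (- int k))"
proof (induction n)
  case (Suc n)
  have "{- int (Suc n)..int (Suc n)} = insert (int (Suc n)) (insert (- int (Suc n)) {- int n..int n})" by auto
  then show ?case using Suc by simp
qed simp

text \<open>With f_k the cosine coefficients of w'', k |a_k| = |f_k| / k \<le> (S / k^2 + f_k^2 / S)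
  / 2. Both sums contribute at most 2 S, by the bound 2 for inverse squares and by Bessel. Balancing
  with S is what makes the result linear in S.\<close>

lemma
  assumes w: "w \<in> X_space \<alpha>" and S: "S > 0" "\<And>x. \<bar>deriv (deriv w) x\<bar> \<le> S"
  shows wb_wsummable: "wsummable TYPE(unit) (\<lambda>k. real_of_int k * fourier_cos w (nat \<bar>k\<bar>) / 2)"
    and wb_norm: "norm (wb w) \<le> 2 * S"
proof -
  let ?b = "\<lambda>k. real_of_int k * fourier_cos w (nat \<bar>k\<bar>) / 2"
  let ?f = "fourier_cos (deriv (deriv w))"
  have part: "(\<Sum>k\<in>{1..n}. real k * \<bar>fourier_cos w k\<bar>) \<le> 2 * S" for n
  proof -
    have "real k * \<bar>fourier_cos w k\<bar> \<le> (S * (1 / (real k)\<^sup>2) + (?f k)\<^sup>2 / S) / 2" if "k \<in> {1..n}" for k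
    proof -
      have k: "real k > 0" using that by simp
      have "\<bar>?f k\<bar> = (real k)\<^sup>2 * \<bar>fourier_cos w k\<bar>" by (simp add: fourier_cos_deriv2[OF w] abs_mult)
      then have e: "real k * \<bar>fourier_cos w k\<bar> = \<bar>?f k\<bar> / real k" using k by (simp add: power2_eq_square)
      have "0 \<le> (S / real k - \<bar>?f k\<bar>)\<^sup>2 / S" using S by simp
      also have "\<dots> = S * (1 / (real k)\<^sup>2) + (?f k)\<^sup>2 / S - 2 * (\<bar>?f k\<bar> / real k)"
        using S(1) k by (simp add: power2_diff field_simps power2_eq_square)
      finally have "0 \<le> S * (1 / (real k)\<^sup>2) + (?f k)\<^sup>2 / S - 2 * (\<bar>?f k\<bar> / real k)" .
      moreover have "Y \<le> X / 2" if "0 \<le> X - 2 * Y" for X Y :: real using that by simp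
      ultimately show ?thesis unfolding e by blast
    qed
    then have "(\<Sum>k\<in>{1..n}. real k * \<bar>fourier_cos w k\<bar>) \<le> (\<Sum>k\<in>{1..n}. (S * (1 / (real k)\<^sup>2) + (?f k)\<^sup>2 / S) / 2)"
      by (rule sum_mono)
    also have "\<dots> = (S * (\<Sum>k\<in>{1..n}. 1 / (real k)\<^sup>2) + (\<Sum>k\<in>{1..n}. (?f k)\<^sup>2) / S) / 2"
      by (simp add: sum_divide_distrib[symmetric] sum.distrib sum_distrib_left)
    also have "(\<Sum>k\<in>{1..n}. (?f k)\<^sup>2) \<le> 2 * S\<^sup>2"
      by (rule fourier_cos_le_bessel[OF continuous_on_subset[OF X_continuous2[OF w]] S(2)]) simp
    then have "(S * (\<Sum>k\<in>{1..n}. 1 / (real k)\<^sup>2) + (\<Sum>k\<in>{1..n}. (?f k)\<^sup>2) / S) / 2 \<le> (S * 2 + 2 * S\<^sup>2 / S) / 2"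
      using S(1) sum_inverse_squares[of n] by (intro divide_right_mono add_mono mult_left_mono) auto
    also have "\<dots> = 2 * S" using S(1) by (simp add: power2_eq_square)
    finally show ?thesis .
  qed
  have fin: "(\<Sum>k\<in>X. \<bar>?b k\<bar> * wgt TYPE(unit) k) \<le> 2 * S" if "finite X" for X
  proof -
    define n where "n = Max (insert 0 ((\<lambda>k. nat \<bar>k\<bar>) ` X))"
    have "nat \<bar>k\<bar> \<le> n" if "k \<in> X" for k unfolding n_def using \<open>finite X\<close> that by (intro Max_ge) auto
    then have "X \<subseteq> {- int n..int n}" by force
    then have "(\<Sum>k\<in>X. \<bar>?b k\<bar>) \<le> (\<Sum>k\<in>{- int n..int n}. \<bar>?b k\<bar>)" by (intro sum_mono2) auto
    also have "\<dots> = (\<Sum>k\<in>{1..n}. real k * \<bar>fourier_cos w k\<bar>)"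
      unfolding sum_symmetric_int by (simp add: abs_mult)
    also have "\<dots> \<le> 2 * S" by (rule part)
    finally show ?thesis by (simp add: wgt_def)
  qed
  show ws: "wsummable TYPE(unit) ?b"
    unfolding wsummable_def
    by (rule nonneg_bdd_above_summable_on) (use fin in \<open>auto simp: wgt_def intro!: bdd_aboveI[of _ "2 * S"]\<close>)
  have "coef (wb w) = ?b" unfolding wb_def by (rule coef_Wien[OF ws])
  then show "norm (wb w) \<le> 2 * S"
    unfolding norm_wien_def
    by (intro infsum_le_finite_sums) (use ws fin in \<open>auto simp: wsummable_def\<close>)
qed

lemma X_deriv2_bounded:
  assumes "w \<in> X_space \<alpha>"
  shows "\<exists>S>0. \<forall>x. \<bar>deriv (deriv w) x\<bar> \<le> S"
proof -
  obtain M where M: "\<And>x. \<bar>deriv (deriv w) x\<bar> \<le> M"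
    using hoelder_deriv_bdd[of w 2 \<alpha> 2] assms by (auto simp: X_space_def deriv2)
  have "M < \<bar>M\<bar> + 1" by simp
  then show ?thesis using M by (intro exI[of _ "\<bar>M\<bar> + 1"]) (auto intro: order_trans less_imp_le)
qed

lemma coef_wb:
  assumes "w \<in> X_space \<alpha>"
  shows "coef (wb w) k = real_of_int k * fourier_cos w (nat \<bar>k\<bar>) / 2"
  using wb_wsummable[OF assms] X_deriv2_bounded[OF assms] coef_Wien unfolding wb_def by metis

lemma od_wb:
  assumes "w \<in> X_space \<alpha>"
  shows "od (wb w)"
  by (simp add: od_def coef_wb[OF assms])

lemma Nop_deriv:
  assumes "od b"
  shows "(Ecos (coef (Nop b)) has_real_derivative Osin (coef b) x) (at x)"
proof -
  have e: "(\<lambda>k. real_of_int k * coef (Nop b) k) = coef b"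
    using od_coef_0[OF assms] by auto
  have "(\<lambda>k. real_of_int k * coef (Nop b) k) abs_summable_on UNIV"
    by (rule ssubst[OF e, of "\<lambda>c. c abs_summable_on UNIV"]) (rule coef_abs_summable)
  from Ecos_has_derivative[OF coef_abs_summable this, of x] show ?thesis unfolding e .
qed

text \<open>Both sides are continuous, even and periodic with the same cosine coefficients;
  agreement for k = 0 is the condition that w has mean zero.\<close>

lemma X_eq_Ecos:
  assumes w: "w \<in> X_space \<alpha>"
  shows "w = Ecos (coef (Nop (wb w)))"
proof
  fix x
  let ?c = "coef (Nop (wb w))"
  have cw: "continuous_on S w" for S
    using DERIV_continuous_on[of S w] X_deriv[OF w] has_field_derivative_at_within by blast
  have cE: "continuous_on S (Ecos ?c)" for S
    unfolding Ecos_def by (rule continuous_on_tser[OF coef_abs_summable])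
  have "w x - Ecos ?c x = 0"
  proof (rule fourier_cos_unique[of "\<lambda>x. w x - Ecos ?c x"])
    fix k
    have "integral {-pi..pi} (\<lambda>x. (w x - Ecos ?c x) * cos (real k * x))
        = integral {-pi..pi} (\<lambda>x. w x * cos (real k * x)) - integral {-pi..pi} (\<lambda>x. Ecos ?c x * cos (real k * x))"
      unfolding left_diff_distrib
      by (intro integral_diff integrable_continuous_real continuous_intros cw cE)
    also have "\<dots> = pi * (fourier_cos w k - fourier_cos (Ecos ?c) k)" by (simp add: fourier_cos_def right_diff_distrib)
    also have "fourier_cos (Ecos ?c) k = ?c (int k) + ?c (- int k)" by (rule fourier_cos_Ecos[OF coef_abs_summable])
    also have "\<dots> = fourier_cos w k"
    proof (cases "k = 0")
      case True
      have "fourier_cos w 0 = 2 * mean w" by (simp add: fourier_cos_def mean_def)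
      then show ?thesis using True X_mean[OF w] by simp
    qed (simp add: coef_wb[OF w])
    finally show "integral {-pi..pi} (\<lambda>x. (w x - Ecos ?c x) * cos (real k * x)) = 0" by (simp only: diff_self mult_zero_right)
  qed (use X_even[OF w] X_periodic[OF w] in \<open>auto simp: Ecos_even tser_periodic[of _ 0, folded Ecos_def] intro!: continuous_on_diff cw cE\<close>)
  then show "w x = Ecos ?c x" by simp
qed

lemma X_deriv_eq_Osin:
  assumes w: "w \<in> X_space \<alpha>"
  shows "deriv w = Osin (coef (wb w))"
proof
  fix x
  have "(w has_real_derivative Osin (coef (wb w)) x) (at x)"
    by (subst X_eq_Ecos[OF w]) (rule Nop_deriv[OF od_wb[OF w]])
  then show "deriv w x = Osin (coef (wb w)) x" by (rule DERIV_imp_deriv)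
qed

lemma hilbert_strip_X_deriv:
  assumes "h > 0" and w: "w \<in> X_space \<alpha>"
  shows "hilbert_strip h (deriv w) = Ecos (coef (Mop h (wb w)))"
proof
  fix x
  have "coef (Mop h (wb w)) = (\<lambda>k. coth (real_of_int k * h) * coef (wb w) k)"
    using coef_Mop[OF assms(1)] by auto
  then show "hilbert_strip h (deriv w) x = Ecos (coef (Mop h (wb w))) x"
    unfolding X_deriv_eq_Osin[OF w] using od_wb[OF w]
    by (simp add: hilbert_strip_Osin[OF assms(1) coef_abs_summable] od_def)
qed

text \<open>The symbol is split as 1 + (coth - 1). The first part is the conjugate series of the
  Hoelder function w'', uniformly convergent; the second converges absolutely by the bound 1 / x^2.
  The differentiated series of C w' is therefore uniformly convergent, and its sum is C w''.\<close>

lemma hilbert_strip_X_deriv2: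
  assumes h: "h > 0" and \<alpha>: "0 < \<alpha>" and w: "w \<in> X_space \<alpha>"
  shows "(Ecos (coef (Mop h (wb w))) has_real_derivative hilbert_strip h (deriv (deriv w)) x) (at x)"
proof -
  let ?f = "deriv (deriv w)" and ?b = "coef (wb w)"
  obtain K where K: "K > 0" "\<And>x y. \<bar>?f x - ?f y\<bar> \<le> K * \<bar>x - y\<bar> powr \<alpha>" using X_hoelder[OF w] by blast
  obtain S where S: "S > 0" "\<And>x. \<bar>?f x\<bar> \<le> S" using X_deriv2_bounded[OF w] by blast
  let ?s = "\<lambda>k x. fourier_cos ?f (Suc k) * sin (real (Suc k) * x)"
  let ?c = "\<lambda>k. coth (real (Suc k) * h)"
  have u1: "uniformly_convergent_on UNIV (\<lambda>N x. \<Sum>k<N. ?s k x)"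
    by (rule conjugate_series_uniformly_convergent[OF X_deriv2[OF w] coef_abs_summable X_deriv_eq_Osin[OF w] X_continuous2[OF w]
        X_even2[OF w] X_periodic2[OF w] \<alpha> K])
  have u2: "uniformly_convergent_on UNIV (\<lambda>N x. \<Sum>k<N. ?s k x * (?c k - 1))"
  proof (rule Weierstrass_m_test')
    show "summable (\<lambda>k. 2 * S / h\<^sup>2 * inverse (real (Suc k) ^ 2))"
      by (intro summable_mult summable_Suc_iff[THEN iffD2] inverse_power_summable) simp
    fix k x
    \<comment> \<open>Bessel's inequality is used merely to bound each single coefficient by 2
      S.\<close>
    have "(fourier_cos ?f (Suc k))\<^sup>2 \<le> (\<Sum>j\<in>{1..Suc k}. (fourier_cos ?f j)\<^sup>2)"
      by (rule member_le_sum) auto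
    also have "\<dots> \<le> 2 * S\<^sup>2"
      by (rule fourier_cos_le_bessel[OF continuous_on_subset[OF X_continuous2[OF w]] S(2)]) simp
    also have "\<dots> \<le> (2 * S)\<^sup>2" using S by (simp add: power_mult_distrib)
    finally have f: "\<bar>fourier_cos ?f (Suc k)\<bar> \<le> 2 * S"
      using S(1) by (metis abs_le_square_iff abs_of_pos mult_pos_pos zero_less_numeral)
    have p: "real (Suc k) * h > 0" using h by simp
    have "norm (?s k x * (?c k - 1)) \<le> (2 * S * 1) * (1 / (real (Suc k) * h)\<^sup>2)"
      unfolding real_norm_def abs_mult
      using coth_near_1[OF p] S f by (intro mult_mono) (auto simp del: of_nat_Suc)
    also have "\<dots> = 2 * S / h\<^sup>2 * inverse (real (Suc k) ^ 2)" by (simp add: power_mult_distrib divide_inverse mult_ac del: of_nat_Suc)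
    finally show "norm (?s k x * (?c k - 1)) \<le> 2 * S / h\<^sup>2 * inverse (real (Suc k) ^ 2)" .
  qed
  let ?u = "\<lambda>k x. 2 * coef (Mop h (wb w)) (int (Suc k)) * cos (real (Suc k) * x)"
  let ?u' = "\<lambda>k x. fourier_cos ?f (Suc k) * ?c k * sin (real (Suc k) * x)"
  have uc: "uniformly_convergent_on UNIV (\<lambda>N x. \<Sum>k<N. ?u' k x)"
  proof -
    have "(\<Sum>k<N. ?u' k x) = (\<Sum>k<N. ?s k x) + (\<Sum>k<N. ?s k x * (?c k - 1))" for N x
      unfolding sum.distrib[symmetric] by (rule sum.cong) (simp_all add: right_diff_distrib mult_ac del: of_nat_Suc)
    then show ?thesis using uniformly_convergent_add[OF u1 u2] by simp
  qed
  have D: "(?u k has_real_derivative ?u' k x) (at x)" for k x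
  proof -
    have "fourier_cos ?f (Suc k) = - (2 * real (Suc k) * ?b (int (Suc k)))"
      by (simp add: fourier_cos_deriv2[OF w] coef_wb[OF w] power2_eq_square nat_abs_int_diff del: of_nat_Suc)
    then have e: "?u' k x = 2 * coef (Mop h (wb w)) (int (Suc k)) * (- sin (real (Suc k) * x) * real (Suc k))"
      by (simp add: coef_Mop[OF h] del: of_nat_Suc)
    show ?thesis unfolding e by (auto intro!: derivative_eq_intros simp del: of_nat_Suc)
  qed
  have sums: "(\<lambda>k. ?u k x) sums Ecos (coef (Mop h (wb w))) x" for x
    by (rule Ecos_sums[OF coef_abs_summable])
      (use Mop_parity[OF h od_wb[OF w]] in \<open>auto simp: evn_def coef_Mop[OF h]\<close>)
  have "((\<lambda>x. \<Sum>k. ?u k x) has_real_derivative (\<Sum>k. ?u' k x)) (at x)"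
    by (rule has_field_derivative_series'(2)[OF convex_UNIV has_field_derivative_at_within[OF D] uc UNIV_I sums_summable[OF sums[of 0]]]) simp
  moreover have "(\<lambda>x. \<Sum>k. ?u k x) = Ecos (coef (Mop h (wb w)))" using sums by (auto simp: sums_iff)
  moreover have "(\<Sum>k. ?u' k x) = hilbert_strip h ?f x"
  proof -
    have "fourier_sin ?f k = 0" for k
    proof -
      have "integral {-pi..- (-pi)} (\<lambda>t. ?f (- t) * sin (real k * (- t))) = integral {-pi..pi} (\<lambda>t. ?f t * sin (real k * t))"
        by (rule Henstock_Kurzweil_Integration.integral_reflect_real)
      then show ?thesis by (simp add: X_even2[OF w] fourier_sin_def)
    qed
    then show ?thesis by (simp add: hilbert_strip_def)
  qed
  ultimately show ?thesis by simp
qed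

section \<open>Norms on X\<close>

lemma X_bdd:
  assumes "u \<in> X_space \<alpha>"
  shows "j \<le> 2 \<Longrightarrow> bdd_above (range (\<lambda>x. \<bar>(deriv ^^ j) u x\<bar>))"
    and "bdd_above ((\<lambda>(x, y). \<bar>(deriv ^^ 2) u x - (deriv ^^ 2) u y\<bar> / \<bar>x - y\<bar> powr \<alpha>) ` {(x, y). x \<noteq> y})"
proof -
  have u: "u \<in> hoelder_space 2 \<alpha>" using assms by (simp add: X_space_def)
  show "bdd_above (range (\<lambda>x. \<bar>(deriv ^^ j) u x\<bar>))" if "j \<le> 2"
    using hoelder_deriv_bdd[OF u that] by (auto intro: bdd_aboveI)
  obtain C where "\<And>x y. \<bar>(deriv ^^ 2) u x - (deriv ^^ 2) u y\<bar> \<le> C * \<bar>x - y\<bar> powr \<alpha>"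
    using u by (auto simp: hoelder_space_def)
  then show "bdd_above ((\<lambda>(x, y). \<bar>(deriv ^^ 2) u x - (deriv ^^ 2) u y\<bar> / \<bar>x - y\<bar> powr \<alpha>) ` {(x, y). x \<noteq> y})"
    by (intro bdd_aboveI[of _ C]) (auto simp: divide_le_eq)
qed

lemma hoelder_norm_ge:
  assumes "u \<in> X_space \<alpha>" "j \<le> 2"
  shows "\<bar>(deriv ^^ j) u x\<bar> \<le> hoelder_norm 2 \<alpha> u"
proof -
  have "\<bar>(deriv ^^ j) u x\<bar> \<le> (SUP x. \<bar>(deriv ^^ j) u x\<bar>)"
    by (rule cSUP_upper[OF UNIV_I X_bdd(1)[OF assms]])
  also have "\<dots> \<le> (\<Sum>j\<le>2. SUP x. \<bar>(deriv ^^ j) u x\<bar>)"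
  proof (rule member_le_sum)
    fix i :: nat assume "i \<in> {..2} - {j}"
    then have "i \<le> 2" by simp
    have "0 \<le> \<bar>(deriv ^^ i) u 0\<bar>" by simp
    also have "\<dots> \<le> (SUP x. \<bar>(deriv ^^ i) u x\<bar>)" by (rule cSUP_upper[OF UNIV_I X_bdd(1)[OF assms(1) \<open>i \<le> 2\<close>]])
    finally show "0 \<le> (SUP x. \<bar>(deriv ^^ i) u x\<bar>)" .
  qed (use assms in auto)
  also have "\<dots> \<le> hoelder_norm 2 \<alpha> u"
  proof -
    have "0 \<le> (case (0, 1) of (x, y) \<Rightarrow> \<bar>(deriv ^^ 2) u x - (deriv ^^ 2) u y\<bar> / \<bar>x - y\<bar> powr \<alpha>)" by simp
    also have "\<dots> \<le> (SUP (x, y) \<in> {(x, y). x \<noteq> y}. \<bar>(deriv ^^ 2) u x - (deriv ^^ 2) u y\<bar> / \<bar>x - y\<bar> powr \<alpha>)"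
      by (rule cSUP_upper[OF _ X_bdd(2)[OF assms(1)]]) simp
    finally show ?thesis by (simp add: hoelder_norm_def)
  qed
  finally show ?thesis .
qed

lemma hoelder_norm_le:
  assumes "\<And>j x. j \<le> 2 \<Longrightarrow> \<bar>(deriv ^^ j) u x\<bar> \<le> M"
    and "\<And>x y. \<bar>(deriv ^^ 2) u x - (deriv ^^ 2) u y\<bar> \<le> L * \<bar>x - y\<bar> powr \<alpha>"
  shows "hoelder_norm 2 \<alpha> u \<le> 3 * M + L"
proof -
  have "(\<Sum>j\<le>2. SUP x. \<bar>(deriv ^^ j) u x\<bar>) \<le> (\<Sum>j\<le>(2::nat). M)"
    by (intro sum_mono cSUP_least) (use assms(1) in auto)
  moreover have "(SUP (x, y) \<in> {(x, y). x \<noteq> y}. \<bar>(deriv ^^ 2) u x - (deriv ^^ 2) u y\<bar> / \<bar>x - y\<bar> powr \<alpha>) \<le> L"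
  proof (rule cSUP_least)
    have "(0, 1) \<in> {(x, y). x \<noteq> (y :: real)}" by simp
    then show "{(x, y). x \<noteq> (y :: real)} \<noteq> {}" by blast
  qed (use assms(2) in \<open>auto simp: divide_le_eq\<close>)
  ultimately show ?thesis by (simp add: hoelder_norm_def)
qed

lemma X_continuous: "w \<in> X_space \<alpha> \<Longrightarrow> continuous_on S w"
  using DERIV_continuous_on[of S w] X_deriv has_field_derivative_at_within by blast

lemma X_diff:
  assumes v: "v \<in> X_space \<alpha>" and w: "w \<in> X_space \<alpha>"
  shows "(\<lambda>x. v x - w x) \<in> X_space \<alpha>"
proof -
  have vh: "v \<in> hoelder_space 2 \<alpha>" and wh: "w \<in> hoelder_space 2 \<alpha>" using assms by (auto simp: X_space_def)
  note d = hoelder_diff[OF vh wh]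
  obtain C1 where C1: "\<And>x y. \<bar>(deriv ^^ 2) v x - (deriv ^^ 2) v y\<bar> \<le> C1 * \<bar>x - y\<bar> powr \<alpha>"
    using vh by (auto simp: hoelder_space_def)
  obtain C2 where C2: "\<And>x y. \<bar>(deriv ^^ 2) w x - (deriv ^^ 2) w y\<bar> \<le> C2 * \<bar>x - y\<bar> powr \<alpha>"
    using wh by (auto simp: hoelder_space_def)
  have "\<bar>(deriv ^^ 2) v x - (deriv ^^ 2) w x - ((deriv ^^ 2) v y - (deriv ^^ 2) w y)\<bar> \<le> (C1 + C2) * \<bar>x - y\<bar> powr \<alpha>" for x y
    using C1[of x y] C2[of x y] unfolding distrib_right by linarith
  then have "\<exists>C. \<forall>x y. \<bar>(deriv ^^ 2) v x - (deriv ^^ 2) w x - ((deriv ^^ 2) v y - (deriv ^^ 2) w y)\<bar> \<le> C * \<bar>x - y\<bar> powr \<alpha>"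
    by blast
  moreover have "(deriv ^^ j) (\<lambda>x. v x - w x) field_differentiable at x" if "j < 2" for j x
    using vh wh that unfolding hoelder_space_def by (subst d) (auto intro!: field_differentiable_diff)
  moreover have "continuous_on UNIV ((deriv ^^ 2) (\<lambda>x. v x - w x))"
    using vh wh unfolding hoelder_space_def by (subst d) (auto intro!: continuous_on_diff)
  moreover have "mean (\<lambda>x. v x - w x) = mean v - mean w"
    unfolding mean_def using X_continuous[OF v] X_continuous[OF w]
    by (subst integral_diff) (auto intro!: integrable_continuous_real simp: diff_divide_distrib)
  ultimately show ?thesis
    using vh wh X_mean[OF v] X_mean[OF w] by (simp add: X_space_def hoelder_space_def d)
qed

lemma X_zero: "(\<lambda>x. 0) \<in> X_space \<alpha>"
proof -
  have "(deriv ^^ j) (\<lambda>x. 0 :: real) = (\<lambda>x. 0)" for j by (induction j) auto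
  then show ?thesis by (auto simp: X_space_def hoelder_space_def mean_def intro!: exI[of _ 0])
qed

lemma X_dist_zero: "w \<in> X_space \<alpha> \<Longrightarrow> X_dist \<alpha> (\<lambda>x. 0) w = hoelder_norm 2 \<alpha> w"
proof -
  assume w: "w \<in> X_space \<alpha>"
  have "X_dist \<alpha> (\<lambda>x. 0) w = X_dist \<alpha> w (\<lambda>x. 0)"
    by (rule Metric_space.commute[OF Metric_space_X])
  then show ?thesis using w X_zero by (simp add: X_dist_def)
qed

lemma wb_norm_le:
  assumes w: "w \<in> X_space \<alpha>"
  shows "norm (wb w) \<le> 2 * hoelder_norm 2 \<alpha> w"
proof (rule field_le_epsilon)
  fix e :: real assume e: "e > 0"
  have b: "\<bar>deriv (deriv w) x\<bar> \<le> hoelder_norm 2 \<alpha> w" for x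
    using hoelder_norm_ge[OF w, of 2 x] by (simp add: deriv2)
  then have "hoelder_norm 2 \<alpha> w \<ge> 0" by (meson abs_ge_zero order_trans)
  \<comment> \<open>\<open>wb_norm\<close> asks for a strictly positive bound on w'', hence the
    slack e / 2.\<close>
  then have "norm (wb w) \<le> 2 * (hoelder_norm 2 \<alpha> w + e / 2)"
    using e b by (intro wb_norm[OF w]) (auto intro: add_increasing2)
  then show "norm (wb w) \<le> 2 * hoelder_norm 2 \<alpha> w + e" by simp
qed

text \<open>Continuity of the amplitude on X; the constant is the period 2 pi divided by the
  normalization pi.\<close>

lemma fourier_cos_diff_le:
  assumes v: "v \<in> X_space \<alpha>" and w: "w \<in> X_space \<alpha>"
  shows "\<bar>fourier_cos v k - fourier_cos w k\<bar> \<le> 2 * X_dist \<alpha> v w"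
proof -
  let ?d = "\<lambda>x. v x - w x"
  have i: "(\<lambda>x. u x * cos (real k * x)) integrable_on {-pi..pi}" if "u \<in> X_space \<alpha>" for u
    by (intro integrable_continuous_real continuous_intros X_continuous[OF that])
  have D: "X_dist \<alpha> v w = hoelder_norm 2 \<alpha> ?d" using v w by (simp add: X_dist_def)
  have "pi * (fourier_cos v k - fourier_cos w k) = integral {-pi..pi} (\<lambda>x. ?d x * cos (real k * x))"
    unfolding left_diff_distrib integral_diff[OF i[OF v] i[OF w]] by (simp add: fourier_cos_def right_diff_distrib)
  moreover have "norm (integral {-pi..pi} (\<lambda>x. ?d x * cos (real k * x))) \<le> integral {-pi..pi} (\<lambda>x. X_dist \<alpha> v w)"
  proof (rule integral_norm_bound_integral[OF i[OF X_diff[OF v w]]])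
    fix x
    have "\<bar>?d x\<bar> * \<bar>cos (real k * x)\<bar> \<le> \<bar>?d x\<bar>" by (simp add: mult_left_le)
    also have "\<dots> \<le> X_dist \<alpha> v w" using hoelder_norm_ge[OF X_diff[OF v w], of 0 x] by (simp add: D)
    finally show "norm (?d x * cos (real k * x)) \<le> X_dist \<alpha> v w" by (simp add: abs_mult)
  qed (rule integrable_const_ivl)
  ultimately have "norm (pi * (fourier_cos v k - fourier_cos w k)) \<le> 2 * pi * X_dist \<alpha> v w" by simp
  then have "pi * \<bar>fourier_cos v k - fourier_cos w k\<bar> \<le> pi * (2 * X_dist \<alpha> v w)" by (simp add: abs_mult)
  then show ?thesis unfolding mult_le_cancel_left_pos[OF pi_gt_zero] .
qed

section \<open>From weight two back to the space X\<close>

lemma bool_abs_summable: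
  fixes b :: "bool wien"
  assumes "\<And>k. \<bar>\<phi> k\<bar> \<le> (1 + \<bar>real_of_int k\<bar>)\<^sup>2"
  shows "(\<lambda>k. \<phi> k * coef b k) abs_summable_on UNIV" "(\<Sum>\<^sub>\<infinity>k. \<bar>\<phi> k * coef b k\<bar>) \<le> norm b"
proof -
  have le: "\<bar>\<phi> k * coef b k\<bar> \<le> \<bar>coef b k\<bar> * wgt TYPE(bool) k" for k
    using mult_right_mono[OF assms[of k], of "\<bar>coef b k\<bar>"] by (simp add: wgt_def abs_mult mult.commute)
  have s: "(\<lambda>k. \<bar>coef b k\<bar> * wgt TYPE(bool) k) summable_on UNIV" by (rule norm_summable)
  show a: "(\<lambda>k. \<phi> k * coef b k) abs_summable_on UNIV"
    using summable_on_comparison_test[OF s] le by simp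
  show "(\<Sum>\<^sub>\<infinity>k. \<bar>\<phi> k * coef b k\<bar>) \<le> norm b"
    unfolding norm_wien_def using a s le by (intro infsum_mono) auto
qed

text \<open>The coefficients k^2 b_k are summable, so w'' is bounded and Lipschitz. For |x - y|
  \<le> 1 the Lipschitz bound implies the Hoelder bound, beyond that the supremum does. Three
  suprema and a seminorm of at most 2 norms add up to 5.\<close>

lemma Ecos_X:
  fixes b :: "bool wien"
  assumes o: "od b" and \<alpha>: "0 < \<alpha>" "\<alpha> < 1"
  shows "Ecos (coef (Nop b)) \<in> X_space \<alpha>" "hoelder_norm 2 \<alpha> (Ecos (coef (Nop b))) \<le> 5 * norm b"
proof -
  let ?u = "Ecos (coef (Nop b))"
  have one: "1 \<le> (1 + \<bar>real_of_int k\<bar>)\<^sup>2" and lin: "\<bar>real_of_int k\<bar> \<le> (1 + \<bar>real_of_int k\<bar>)\<^sup>2"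
    and sq: "\<bar>real_of_int k * real_of_int k\<bar> \<le> (1 + \<bar>real_of_int k\<bar>)\<^sup>2" for k
    by (auto simp: power2_eq_square algebra_simps abs_mult)
  note a0 = coef_abs_summable[of "Nop b"] and a1 = coef_abs_summable[of b]
  have s0: "(\<Sum>\<^sub>\<infinity>k. \<bar>coef (Nop b) k\<bar>) \<le> norm b"
    using bool_abs_summable(2)[of "\<lambda>k. 1 / real_of_int k" b, OF order_trans[OF inverse_int_bound one]] by simp
  have s1: "(\<Sum>\<^sub>\<infinity>k. \<bar>coef b k\<bar>) \<le> norm b"
    using bool_abs_summable(2)[of "\<lambda>k. 1" b] one by simp
  note s2 = bool_abs_summable[where b = b and \<phi> = "\<lambda>k. real_of_int k", OF lin]
  note s3 = bool_abs_summable[where b = b and \<phi> = "\<lambda>k. real_of_int k * real_of_int k", OF sq]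
  let ?D2 = "\<lambda>x. - Ecos (\<lambda>k. real_of_int k * coef b k) x"
  have d0: "deriv ?u = Osin (coef b)" using Nop_deriv[OF o] by (auto intro!: DERIV_imp_deriv)
  have D1: "(Osin (coef b) has_real_derivative ?D2 x) (at x)" for x
    by (rule Osin_has_derivative[OF a1 s2(1)])
  have d1: "deriv (Osin (coef b)) = ?D2" using D1 by (auto intro!: DERIV_imp_deriv)
  have D2: "(?D2 has_real_derivative - Osin (\<lambda>k. real_of_int k * real_of_int k * coef b k) x) (at x)" for x
    using DERIV_minus[OF Ecos_has_derivative[OF s2(1), of x]] s3(1) by (simp add: mult.assoc)
  have b0: "\<bar>?u x\<bar> \<le> norm b" "\<bar>Osin (coef b) x\<bar> \<le> norm b" "\<bar>?D2 x\<bar> \<le> norm b"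
      "\<bar>- Osin (\<lambda>k. real_of_int k * real_of_int k * coef b k) x\<bar> \<le> norm b" for x
    using order_trans[OF tser_bound[OF a0, of 0 x] s0] order_trans[OF tser_bound[OF a1, of "pi/2" x] s1]
      order_trans[OF tser_bound[OF s2(1), of 0 x] s2(2)] order_trans[OF tser_bound[OF s3(1), of "pi/2" x] s3(2)]
    by (auto simp: Ecos_def Osin_def simp del: coef_Nop)
  have lip: "\<bar>?D2 x - ?D2 y\<bar> \<le> norm b * \<bar>x - y\<bar>" for x y
    using field_differentiable_bound[of UNIV ?D2, OF convex_UNIV has_field_derivative_at_within[OF D2] _ UNIV_I UNIV_I, of "norm b" x y] b0(4)
    by auto
  have hoe: "\<bar>?D2 x - ?D2 y\<bar> \<le> 2 * norm b * \<bar>x - y\<bar> powr \<alpha>" for x y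
  proof (cases "\<bar>x - y\<bar> \<le> 1")
    case True
    have "\<bar>x - y\<bar> powr 1 \<le> \<bar>x - y\<bar> powr \<alpha>" using True \<alpha> by (intro powr_mono') auto
    then have "\<bar>x - y\<bar> \<le> \<bar>x - y\<bar> powr \<alpha>" by simp
    then have "norm b * \<bar>x - y\<bar> \<le> norm b * \<bar>x - y\<bar> powr \<alpha>" by (intro mult_left_mono) auto
    also have "\<dots> \<le> 2 * norm b * \<bar>x - y\<bar> powr \<alpha>" by (intro mult_right_mono) auto
    finally show ?thesis using lip[of x y] by linarith
  next
    case False
    then have "1 \<le> \<bar>x - y\<bar> powr \<alpha>" using \<alpha> by (intro ge_one_powr_ge_zero) auto
    then have "2 * norm b * 1 \<le> 2 * norm b * \<bar>x - y\<bar> powr \<alpha>" by (intro mult_left_mono) auto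
    then show ?thesis using b0(3)[of x] b0(3)[of y] by linarith
  qed
  have fd: "(deriv ^^ j) ?u field_differentiable at x" if "j < 2" for j x
    using that Nop_deriv[OF o, of x] D1[of x] by (auto simp: less_2_cases_iff d0 field_differentiable_def)
  have dd: "(deriv ^^ 2) ?u = ?D2" by (simp add: deriv2 d0 d1)
  show "?u \<in> X_space \<alpha>"
    unfolding X_space_def hoelder_space_def
  proof (intro CollectI conjI allI impI)
    show "?u (- x) = ?u x" for x by (rule Ecos_even)
    show "?u (x + 2 * pi) = ?u x" for x unfolding Ecos_def by (rule tser_periodic)
    show "continuous_on UNIV ((deriv ^^ 2) ?u)"
      unfolding dd by (intro continuous_on_minus) (unfold Ecos_def, rule continuous_on_tser[OF s2(1)])
    show "\<exists>C. \<forall>x y. \<bar>(deriv ^^ 2) ?u x - (deriv ^^ 2) ?u y\<bar> \<le> C * \<bar>x - y\<bar> powr \<alpha>" unfolding dd using hoe by blast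
    show "mean ?u = 0" by (simp only: mean_Ecos[OF coef_abs_summable] coef_Nop) simp
  qed (use fd in auto)
  have "\<bar>(deriv ^^ j) ?u x\<bar> \<le> norm b" if "j \<le> 2" for j x
  proof -
    consider "j = 0" | "j = 1" | "j = 2" using \<open>j \<le> 2\<close> by linarith
    then show ?thesis by cases (use b0 in \<open>auto simp: d0 dd\<close>)
  qed
  moreover have "\<bar>(deriv ^^ 2) ?u x - (deriv ^^ 2) ?u y\<bar> \<le> 2 * norm b * \<bar>x - y\<bar> powr \<alpha>" for x y
    unfolding dd by (rule hoe)
  ultimately have "hoelder_norm 2 \<alpha> ?u \<le> 3 * norm b + 2 * norm b" by (rule hoelder_norm_le)
  then
  show "hoelder_norm 2 \<alpha> ?u \<le> 5 * norm b" by simp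
qed

text \<open>The bridge between the two weights. Equality is stated for coefficients because b
  carries weight two and \<open>wb\<close> weight 1, so the elements have different types.\<close>

lemma coef_wb_Ecos:
  assumes "od b" "Ecos (coef (Nop b)) \<in> X_space \<alpha>"
  shows "coef (wb (Ecos (coef (Nop b)))) = coef b"
proof
  fix k :: int
  have f: "fourier_cos (Ecos (coef (Nop b))) n = 2 * coef b (int n) / real n" for n
    using assms(1) by (simp only: fourier_cos_Ecos[OF coef_abs_summable]) (simp add: od_def)
  have o: "coef b (- k) = - coef b k" using assms(1) by (simp add: od_def)
  have "coef (wb (Ecos (coef (Nop b)))) k = real_of_int k * (2 * coef b \<bar>k\<bar> / real_of_int \<bar>k\<bar>) / 2"
    unfolding coef_wb[OF assms(2)] f by simp
  also have "\<dots> = coef b k"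
  proof (cases "k = 0")
    case False
    then show ?thesis using o by (cases "k > 0") auto
  qed (simp add: od_coef_0[OF assms(1)])
  finally show "coef (wb (Ecos (coef (Nop b)))) k = coef b k" .
qed

lemma hilbert_strip_od:
  assumes "h > 0" "od c"
  shows "hilbert_strip h (Osin (coef c)) x = Ecos (coef (Mop h c)) x"
proof -
  have "coef (Mop h c) = (\<lambda>k. coth (real_of_int k * h) * coef c k)" using coef_Mop[OF assms(1)] by auto
  then show ?thesis using assms(2) by (simp add: hilbert_strip_Osin[OF assms(1) coef_abs_summable] od_def)
qed

section \<open>The operator in Fourier coefficients\<close>

context wave
begin

text \<open>The implicit function theorem solves (1 + k)^2 J = 1 among even elements, with odd
  elements as parameters. The factor 1/2 turns the derivative 2 k at the origin into the
  identity.\<close>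

lemma kappa_exists:
  assumes "\<rho> > 0"
  obtains \<delta> where "\<delta> > 0" "\<And>b :: 'm::finite wien. od b \<Longrightarrow> norm b < \<delta> \<Longrightarrow> \<exists>k. evn k \<and> norm k < \<rho> \<and> E1 1 b k = 0"
proof -
  define \<Psi> where "\<Psi> p = (1/2) *\<^sub>R E1 1 (fst p) (snd p)" for p :: "'m wien \<times> 'm wien"
  have "strictly_differentiable \<Psi> (0, 0)"
    unfolding \<Psi>_def
    by (intro strict_scaleR strict_const strict_E1[where l = "\<lambda>_. 0" and m = "\<lambda>_. 0"] strict_linear bounded_linear_fst bounded_linear_snd)
  then obtain D where D: "has_strict_derivative \<Psi> D (0, 0)" by (auto simp: strictly_differentiable_def)
  have \<Psi>0: "\<Psi> (0, k) = k + (1/2) *\<^sub>R (k * k)" for k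
    by (simp add: \<Psi>_def E1_def K2_def J1_def Mop_linear scaleR_add_right)
  have DE: "D (0, z) = z" for z
  proof -
    have "((\<lambda>t. \<Psi> ((0, 0) + t *\<^sub>R (0, z))) has_vector_derivative D (0, z)) (at 0)"
      by (rule has_strict_derivative_directional[OF D])
    moreover have "(\<lambda>t. \<Psi> ((0, 0) + t *\<^sub>R (0, z))) = (\<lambda>t. t *\<^sub>R z + (t * t / 2) *\<^sub>R (z * z))"
      by (simp add: \<Psi>0)
    moreover have "((\<lambda>t. t *\<^sub>R z + (t * t / 2) *\<^sub>R (z * z)) has_vector_derivative z) (at 0)"
      by (auto intro!: derivative_eq_intros)
    ultimately show ?thesis using vector_derivative_unique_at by fastforce
  qed
  have sub: "subspace {k :: 'm wien. evn k}" by (auto simp: subspace_def intro: evn_arith)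
  obtain r \<delta> C \<gamma> where g: "r > 0" "\<delta> > 0" "C > 0"
    "\<And>p. od p \<Longrightarrow> norm p < \<delta> \<Longrightarrow> evn (\<gamma> p) \<and> norm (\<gamma> p) < r \<and> \<Psi> (p, \<gamma> p) = 0"
    "\<And>p z. od p \<Longrightarrow> norm p < \<delta> \<Longrightarrow> evn z \<Longrightarrow> norm z < r \<Longrightarrow> \<Psi> (p, z) = 0 \<Longrightarrow> z = \<gamma> p"
    "\<And>p q. od p \<Longrightarrow> norm p < \<delta> \<Longrightarrow> od q \<Longrightarrow> norm q < \<delta> \<Longrightarrow> norm (\<gamma> p - \<gamma> q) \<le> C * norm (p - q)"
  proof (rule implicit_function_strict[OF D _ sub closed_evn, of "{p. od p}"])
    show "\<Psi> (0, 0) = 0" by (simp add: \<Psi>0)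
    show "(0 :: 'm wien) \<in> {k. evn k}" by (simp add: evn_arith)
    show "\<Psi> (p, z) \<in> {k. evn k}" if "p \<in> {p. od p}" "z \<in> {k. evn k}" for p z
      using that evn_E1 by (auto simp: \<Psi>_def intro: evn_arith)
  qed (use DE in auto)
  have z: "\<gamma> 0 = 0" using g(5)[of 0 0] g(1,2) by (simp add: \<Psi>0 od_arith evn_arith)
  show ?thesis
  proof (rule that[of "min \<delta> (\<rho> / C)"])
    fix b :: "'m wien" assume b: "od b" "norm b < min \<delta> (\<rho> / C)"
    then have "norm (\<gamma> b) \<le> C * norm b" using g(6)[of b 0] g(2) z by (simp add: od_arith)
    also have "\<dots> < \<rho>" using b(2) g(3) by (simp add: pos_less_divide_eq mult.commute)
    finally show "\<exists>k. evn k \<and> norm k < \<rho> \<and> E1 1 b k = 0"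
      using g(4)[of b] b by (intro exI[of _ "\<gamma> b"]) (auto simp: \<Psi>_def)
  qed (use g assms in auto)
qed

lemma Ecos_abs_le: "\<bar>Ecos (coef (a :: 'm::finite wien)) x\<bar> \<le> norm a"
proof -
  have "(\<Sum>\<^sub>\<infinity>k. \<bar>coef a k\<bar>) \<le> norm a"
    unfolding norm_wien_def
  proof (rule infsum_mono)
    show "(\<lambda>k. \<bar>coef a k\<bar>) summable_on UNIV" using coef_abs_summable[of a] by simp
    show "\<bar>coef a k\<bar> \<le> \<bar>coef a k\<bar> * wgt TYPE('m) k" for k
      using mult_left_mono[OF wgt_ge_1[of k, where 'm = 'm], of "\<bar>coef a k\<bar>"] by simp
  qed (rule norm_summable)
  then show ?thesis unfolding Ecos_def using tser_bound[OF coef_abs_summable] order_trans by blast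
qed

lemma Osin_0: "Osin c 0 = 0"
  by (simp add: Osin_def tser_def)

text \<open>The weight remains a parameter and only the coefficients of b are tied to w, so one
  equivalence serves uniqueness and construction. E1 = 0 says that (1 + \<kappa>)^2 J = 1, and norm
  \<kappa> < 1 selects the positive root 1 / sqrt J. The bound on M b keeps the multiplier 1 + C w'
  positive, so multiplication by it is reversible.\<close>

lemma
  fixes b \<kappa> :: "'m::finite wien"
  assumes \<alpha>: "0 < \<alpha>" and w: "w \<in> X_space \<alpha>" and b: "coef b = coef (wb w)"
    and \<kappa>: "evn \<kappa>" "E1 1 b \<kappa> = 0" "norm \<kappa> < 1" "norm (Mop h b) < 1"
  shows conf_factor_nonzero: "conf_factor h w x \<noteq> 0"
    and F_op_zero_iff: "(\<forall>x. F_op g h A B \<beta> \<sigma> lam mu w x = 0) \<longleftrightarrow> Phi (1, lam, mu, b, \<kappa>) = 0"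
proof -
  have ob: "od b" using od_wb[OF w] by (simp add: od_def b)
  have N: "coef (Nop b) = coef (Nop (wb w))" and M: "coef (Mop h b) = coef (Mop h (wb w))"
    using b by (auto simp: coef_Mop[OF h_pos])
  define W p q kf pp qq where "W = Ecos (coef (Nop b))" and "p = Osin (coef b)" and "q = Ecos (coef (Mop h b))"
    and "kf x = 1 + Ecos (coef \<kappa>) x" and "pp = deriv (deriv w)" and "qq = hilbert_strip h (deriv (deriv w))" for x
  have wW: "w = W" unfolding W_def N by (rule X_eq_Ecos[OF w])
  have dw: "deriv w = p" unfolding p_def b by (rule X_deriv_eq_Osin[OF w])
  have hq: "hilbert_strip h p = q" unfolding q_def M dw[symmetric] by (rule hilbert_strip_X_deriv[OF h_pos w])
  have Dp: "(p has_real_derivative pp x) (at x)" for x using X_deriv2[OF w, of x] by (simp add: dw pp_def)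
  have Dq: "(q has_real_derivative qq x) (at x)" for x
    unfolding q_def M qq_def by (rule hilbert_strip_X_deriv2[OF h_pos \<alpha> w])
  have eN: "evn (Nop b)" and eM: "evn (Mop h b)" and oNb: "od (Nop b * b)" and oNNb: "od (Nop b * Nop b * b)"
    using Nop_parity(1)[OF ob] Mop_parity[OF h_pos ob] ob parity_intros by metis+
  define J where "J x = (1 + q x)\<^sup>2 + (p x)\<^sup>2" for x
  have conf: "conf_factor h w x = J x" for x by (simp add: conf_factor_def dw hq J_def)
  have EJ: "1 + Ecos (coef (J1 1 b)) x = J x" for x
    by (simp add: J1_def Ecos_linear Ecos_mult[OF eM eM] Ecos_mult_od[OF ob ob] J_def q_def p_def power2_eq_square algebra_simps)
  have EK: "1 + Ecos (coef (K2 1 \<kappa>)) x = (kf x)\<^sup>2" for x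
    by (simp add: K2_def Ecos_linear Ecos_mult[OF \<kappa>(1) \<kappa>(1)] kf_def power2_eq_square algebra_simps)
  have eK: "evn (K2 1 \<kappa>)" and eJ: "evn (J1 1 b)"
    unfolding K2_def J1_def using \<kappa>(1) eM evn_mult_od[OF ob ob] by (auto intro: evn_arith evn_mult)
  have kJ: "(kf x)\<^sup>2 * J x = 1" for x
  proof -
    have "Ecos (coef (E1 1 b \<kappa>)) x = 0" by (simp add: \<kappa>(2) Ecos_linear)
    then show ?thesis unfolding EJ[symmetric] EK[symmetric]
      by (simp add: E1_def Ecos_linear Ecos_mult[OF eK eJ] algebra_simps)
  qed
  show "conf_factor h w x \<noteq> 0" unfolding conf using kJ[of x] by auto
  have kf: "kf x > 0" for x using Ecos_abs_le[of \<kappa> x] \<kappa>(3) by (simp add: kf_def)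
  have q1: "1 + q x > 0" for x using Ecos_abs_le[of "Mop h b" x] \<kappa>(4) by (simp add: q_def)
  have J0: "J x > 0" for x
    using kJ[of x] kf[of x] by (metis zero_less_mult_pos zero_less_one zero_less_power)
  have sJ: "sqrt (J x) * kf x = 1" for x
  proof -
    have "sqrt ((kf x)\<^sup>2 * J x) = 1" by (simp add: kJ)
    then show ?thesis using kf[of x] by (simp add: real_sqrt_mult mult.commute)
  qed
  define Qf where "Qf x = lam + Ecos (coef (Q1 1 b)) x" for x
  have mean2: "mean (\<lambda>y. (w y)\<^sup>2) = coef (Nop b * Nop b) 0"
  proof -
    have "(\<lambda>y. (w y)\<^sup>2) = Ecos (coef (Nop b * Nop b))" by (simp add: fun_eq_iff wW W_def Ecos_mult[OF eN eN] power2_eq_square)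
    then show ?thesis by (simp add: mean_Ecos[OF coef_abs_summable])
  qed
  have mean3: "mean (\<lambda>y. (w y) ^ 3) = coef (Nop b * Nop b * Nop b) 0"
  proof -
    have "(\<lambda>y. (w y) ^ 3) = Ecos (coef (Nop b * Nop b * Nop b))"
      by (simp add: fun_eq_iff wW W_def Ecos_mult[OF eN eN] Ecos_mult[OF evn_mult[OF eN eN] eN] power3_eq_cube)
    then show ?thesis by (simp add: mean_Ecos[OF coef_abs_summable])
  qed
  have C1: "hilbert_strip h (\<lambda>y. w y * p y) = Ecos (coef (Mop h (Nop b * b)))"
  proof -
    have "(\<lambda>y. w y * p y) = Osin (coef (Nop b * b))" by (simp add: fun_eq_iff wW W_def p_def Osin_mult[OF eN ob])
    then show ?thesis using hilbert_strip_od[OF h_pos oNb] by auto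
  qed
  have C2: "hilbert_strip h (\<lambda>y. (w y)\<^sup>2 * p y) = Ecos (coef (Mop h (Nop b * Nop b * b)))"
  proof -
    have "(\<lambda>y. (w y)\<^sup>2 * p y) = Osin (coef (Nop b * Nop b * b))"
      by (simp add: fun_eq_iff wW W_def p_def Osin_mult[OF evn_mult[OF eN eN] ob] Ecos_mult[OF eN eN] power2_eq_square)
    then show ?thesis using hilbert_strip_od[OF h_pos oNNb] by auto
  qed
  have Q: "lam - \<beta> * (mean (\<lambda>y. (w y)\<^sup>2) / (2 * h) - w x + hilbert_strip h (\<lambda>y. w y * p y) x - w x * q x)
      - g * A / 2 * (mean (\<lambda>y. (w y) ^ 3) / (3 * h) - mean (\<lambda>y. (w y)\<^sup>2) - (w x)\<^sup>2 - 2 * h * w x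
          + hilbert_strip h (\<lambda>y. (w y)\<^sup>2 * p y) x - (w x)\<^sup>2 * q x
          + 2 * h * hilbert_strip h (\<lambda>y. w y * p y) x - 2 * h * w x * q x) = Qf x" for x
    unfolding mean2 mean3 C1 C2
    by (simp add: Qf_def Q1_def Ecos_linear Ecos_mult[OF eN eN] Ecos_mult[OF eN eM] Ecos_mult[OF eN evn_mult[OF eN eM]]
        wW W_def[symmetric] q_def[symmetric] power2_eq_square algebra_simps del: coef_Nop)
  have F: "F_op g h A B \<beta> \<sigma> lam mu w x = (Qf x)\<^sup>2 - (lam\<^sup>2 + mu - 2 * g * B * w x) * J x
      - 2 * \<sigma> * ((pp x + q x * pp x - p x * qq x) / sqrt (J x))" for x
    unfolding F_op_def Let_def dw hq Q conf using J_def[of x] Dp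
    by (simp add: qq_def pp_def dw[symmetric] add.commute)
  \<comment> \<open>The curvature numerator times (1 + q) / J^(3/2), in closed form;
    \<open>DS\<close> below shows that it is the derivative of the sine S.\<close>
  define s1 where "s1 x = kf x ^ 3 * (1 + q x) * (pp x * (1 + q x) - p x * qq x)" for x
  have eR: "evn (R 1 lam mu b \<kappa>)" by (rule evn_R[OF ob \<kappa>(1)])
  have eQ: "evn (Q1 1 b)" by (rule evn_Q1[OF ob \<kappa>(1)])
  have ER: "Ecos (coef (R 1 lam mu b \<kappa>)) x = (1 + q x) * ((kf x)\<^sup>2 * (Qf x)\<^sup>2 - lam\<^sup>2 - mu + 2 * g * B * w x) / (2 * \<sigma>)" for x
  proof -
    let ?K = "K2 1 \<kappa>" and ?Q = "Q1 1 b"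
    let ?G = "(lam * lam) *\<^sub>R ?K + (1 + ?K) * ((2 * lam) *\<^sub>R ?Q + ?Q * ?Q) - mu *\<^sub>R 1 + (2 * g * B) *\<^sub>R Nop b"
    have e: "evn ((2 * lam) *\<^sub>R ?Q + ?Q * ?Q)" "evn (1 + ?K)" "evn (1 + Mop h b)" by (intro evn_arith evn_mult eQ eK eM)+
    then have eG: "evn ?G" by (intro evn_arith evn_mult eK eN eQ)
    have "Ecos (coef (R 1 lam mu b \<kappa>)) x = (1 / (2 * \<sigma>)) * ((1 + q x) * Ecos (coef ?G) x)"
      by (simp add: R_def Ecos_linear(4) Ecos_mult[OF e(3) eG]) (simp add: Ecos_linear q_def)
    also have "Ecos (coef ?G) x = lam * lam * ((kf x)\<^sup>2 - 1) + (kf x)\<^sup>2 * (2 * lam * (Qf x - lam) + (Qf x - lam) * (Qf x - lam)) - mu + 2 * g * B * w x"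
      unfolding EK[symmetric]
      by (simp add: Ecos_linear Ecos_mult[OF e(2,1)] Ecos_mult[OF eQ eQ] Qf_def wW W_def del: coef_Nop)
    also have "\<dots> = (kf x)\<^sup>2 * (Qf x)\<^sup>2 - lam\<^sup>2 - mu + 2 * g * B * w x"
      by (simp add: power2_eq_square algebra_simps)
    finally show ?thesis by simp
  qed
  \<comment> \<open>F is multiplied by (1 + q) / (2 \<sigma> J), with 1 / J = kf^2: the tension term
    becomes s1 and everything else becomes R.\<close>
  have key: "s1 x = Ecos (coef (R 1 lam mu b \<kappa>)) x - (1 + q x) * (kf x)\<^sup>2 / (2 * \<sigma>) * F_op g h A B \<beta> \<sigma> lam mu w x" for x
  proof -
    have i: "1 / sqrt (J x) = kf x" using sJ[of x] J0[of x] by (simp add: field_simps)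
    define X where "X = pp x + q x * pp x - p x * qq x"
    have X: "X / sqrt (J x) = X * kf x" unfolding i[symmetric] by simp
    have s1: "s1 x = kf x ^ 3 * (1 + q x) * X" by (simp add: s1_def X_def algebra_simps)
    have "(1 + q x) * (kf x)\<^sup>2 / (2 * \<sigma>) * F_op g h A B \<beta> \<sigma> lam mu w x
        = (1 + q x) * ((kf x)\<^sup>2 * (Qf x)\<^sup>2 - (lam\<^sup>2 + mu - 2 * g * B * w x) * ((kf x)\<^sup>2 * J x)) / (2 * \<sigma>) - s1 x"
      unfolding F X_def[symmetric] X s1 using \<sigma>_pos by (simp add: field_simps power2_eq_square power3_eq_cube)
    then show ?thesis unfolding kJ ER by (simp add: algebra_simps)
  qed
  have zero_iff: "F_op g h A B \<beta> \<sigma> lam mu w x = 0 \<longleftrightarrow> s1 x = Ecos (coef (R 1 lam mu b \<kappa>)) x" for x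
    using key[of x] kf[of x] q1[of x] \<sigma>_pos by auto
  define S where "S x = Osin (coef (b + b * \<kappa>)) x" for x
  have S: "S x = p x / sqrt (J x)" for x
  proof -
    have "S x = p x * kf x" by (simp add: S_def Osin_linear Osin_mult'[OF ob \<kappa>(1)] p_def kf_def distrib_left)
    moreover have "kf x = 1 / sqrt (J x)" using sJ[of x] J0[of x] by (simp add: field_simps)
    ultimately show ?thesis by simp
  qed
  have DS: "(S has_real_derivative s1 x) (at x)" for x
  proof -
    have DJ: "(J has_real_derivative 2 * (1 + q x) * qq x + 2 * p x * pp x) (at x)"
      unfolding J_def[abs_def] by (auto intro!: derivative_eq_intros Dp Dq)
    have D: "((\<lambda>x. p x / sqrt (J x)) has_real_derivative
        (pp x * sqrt (J x) - p x * ((2 * (1 + q x) * qq x + 2 * p x * pp x) * (inverse (sqrt (J x)) / 2))) / (sqrt (J x) * sqrt (J x))) (at x)"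
      using J0[of x] by (auto intro!: derivative_eq_intros Dp DJ simp: less_imp_neq[symmetric])
    define r where "r = sqrt (J x)"
    have r: "r > 0" "r * r = J x" "kf x = 1 / r" using J0[of x] sJ[of x] by (auto simp: r_def field_simps)
    have "(pp x * r - p x * ((2 * (1 + q x) * qq x + 2 * p x * pp x) * (inverse r / 2))) / (r * r)
        = (pp x * (r * r) - p x * ((1 + q x) * qq x + p x * pp x)) / (r * r * r)"
      using r(1) by (simp add: field_simps)
    also have "\<dots> = s1 x"
    proof -
      have "pp x * J x - p x * ((1 + q x) * qq x + p x * pp x) = (1 + q x) * (pp x * (1 + q x) - p x * qq x)"
        by (simp add: J_def power2_eq_square algebra_simps)
      then show ?thesis unfolding r(2) s1_def r(3) by (simp add: power3_eq_cube power_divide) (simp add: r(2))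
    qed
    finally show ?thesis using D unfolding S[abs_def] r_def by simp
  qed
  have PhiE: "Phi (1, lam, mu, b, \<kappa>) = (coef (R 1 lam mu b \<kappa>) 0, b + b * \<kappa> + Nop (R 1 lam mu b \<kappa>), 0)"
    by (simp add: Phi_def E3_def E2_def R'_def \<kappa>(2))
  have oR: "od (Nop (R 1 lam mu b \<kappa>))" and obk: "od (b + b * \<kappa>)"
    using Nop_parity(2)[OF eR] od_mult[OF ob \<kappa>(1)] ob by (auto intro: od_arith)
  have DT: "(Osin (coef (Nop (R 1 lam mu b \<kappa>))) has_real_derivative - Ecos (coef (R 1 lam mu b \<kappa>)) x) (at x)"
    if "coef (R 1 lam mu b \<kappa>) 0 = 0" for x
  proof -
    have e: "(\<lambda>k. real_of_int k * coef (Nop (R 1 lam mu b \<kappa>)) k) = coef (R 1 lam mu b \<kappa>)" using that by auto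
    have "(\<lambda>k. real_of_int k * coef (Nop (R 1 lam mu b \<kappa>)) k) abs_summable_on UNIV"
      by (rule ssubst[OF e, of "\<lambda>c. c abs_summable_on UNIV"]) (rule coef_abs_summable)
    from Osin_has_derivative[OF coef_abs_summable this, of x] show ?thesis unfolding e .
  qed
  show "(\<forall>x. F_op g h A B \<beta> \<sigma> lam mu w x = 0) \<longleftrightarrow> Phi (1, lam, mu, b, \<kappa>) = 0"
  proof
    assume "\<forall>x. F_op g h A B \<beta> \<sigma> lam mu w x = 0"
    then have DS': "(S has_real_derivative Ecos (coef (R 1 lam mu b \<kappa>)) x) (at x)" for x
      using DS[of x] zero_iff[of x] by simp
    have "(Ecos (coef (R 1 lam mu b \<kappa>)) has_integral S pi - S (- pi)) {-pi..pi}"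
      by (rule fundamental_theorem_of_calculus)
        (use DS' in \<open>auto simp: has_real_derivative_iff_has_vector_derivative has_vector_derivative_at_within\<close>)
    moreover have "S pi = S (- pi)" using tser_periodic[of "coef (b + b * \<kappa>)" "pi/2" "- pi"] by (simp add: S_def Osin_def)
    ultimately have R0: "coef (R 1 lam mu b \<kappa>) 0 = 0"
      using mean_Ecos[OF coef_abs_summable, of "R 1 lam mu b \<kappa>"] by (simp add: mean_def integral_unique)
    \<comment> \<open>Both functions are odd, so the constant of integration is their value at 0,
      namely 0.\<close>
    have "S x + Osin (coef (Nop (R 1 lam mu b \<kappa>))) x = S 0 + Osin (coef (Nop (R 1 lam mu b \<kappa>))) 0" for x
    proof -
      have "\<forall>x. ((\<lambda>x. S x + Osin (coef (Nop (R 1 lam mu b \<kappa>))) x) has_real_derivative 0) (at x)"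
        using DERIV_add[OF DS' DT[OF R0]] by simp
      from DERIV_isconst_all[OF this] show ?thesis .
    qed
    then have "Osin (coef (b + b * \<kappa> + Nop (R 1 lam mu b \<kappa>))) x = Osin (coef (0 :: 'm wien)) x" for x
      by (simp only: Osin_linear(1)[of "b + b * \<kappa>"] S_def[symmetric] Osin_linear(5)) (simp add: S_def Osin_0 del: coef_Nop)
    then have "b + b * \<kappa> + Nop (R 1 lam mu b \<kappa>) = 0"
      by (intro Osin_inj od_arith obk oR)
    then show "Phi (1, lam, mu, b, \<kappa>) = 0" using R0 by (simp add: PhiE zero_prod_def)
  next
    assume "Phi (1, lam, mu, b, \<kappa>) = 0"
    then have R0: "coef (R 1 lam mu b \<kappa>) 0 = 0" and E: "b + b * \<kappa> + Nop (R 1 lam mu b \<kappa>) = 0"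
      by (auto simp: PhiE zero_prod_def)
    have "b + b * \<kappa> = - Nop (R 1 lam mu b \<kappa>)" using E by (simp add: eq_neg_iff_add_eq_0)
    then have Sx: "S = (\<lambda>x. - Osin (coef (Nop (R 1 lam mu b \<kappa>))) x)"
      by (simp only: S_def[abs_def] Osin_linear(3))
    show "\<forall>x. F_op g h A B \<beta> \<sigma> lam mu w x = 0"
    proof
      fix x
      have "(S has_real_derivative Ecos (coef (R 1 lam mu b \<kappa>)) x) (at x)"
        unfolding Sx using DERIV_minus[OF DT[OF R0, of x]] by simp
      then show "F_op g h A B \<beta> \<sigma> lam mu w x = 0" using DERIV_unique[OF DS] zero_iff by blast
    qed
  qed
qed

end

section \<open>Dispersion relation and kernel\<close>

context wave
begin

lemma bb_eq: "bb = \<beta> + A * g * h"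
  by (simp add: bb_def)

lemma T_val_pos: "n \<ge> 1 \<Longrightarrow> T_val h n > 0"
  using h_pos by (simp add: T_val_def)

lemma coth_T_val:
  assumes "n \<ge> 1"
  shows "coth (real n * h) = 1 / (T_val h n * real n)"
  using assms h_pos by (simp add: coth_def T_val_def tanh_def)

text \<open>Clearing denominators with coth (n h) = 1 / (n T_n) turns the symbol into a quadratic
  polynomial in l, whose roots are the two bifurcation values.\<close>

lemma symb_factor:
  assumes "n \<ge> 1"
  shows "symb l (int n) * (T_val h n * \<sigma> * (real n)\<^sup>2)
    = - (l\<^sup>2 - bb * T_val h n * l - (g * B + \<sigma> * (real n)\<^sup>2) * T_val h n)"
proof -
  have n: "real n > 0" using assms by simp
  note c = coth_T_val[OF assms]
  show ?thesis
    unfolding symb_def of_int_of_nat_eq c using n \<sigma>_pos T_val_pos[OF assms] by (simp add: field_simps power2_eq_square)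
qed

lemma symb_zero_iff:
  assumes "n \<ge> 1"
  shows "symb l (int n) = 0 \<longleftrightarrow> (\<exists>e\<in>{1, -1}. l = lam_star g h A B \<beta> \<sigma> n e)"
proof -
  define T D where "T = T_val h n" and "D = bb\<^sup>2 / 4 * T\<^sup>2 + (g * B + \<sigma> * (real n)\<^sup>2) * T"
  have T: "T > 0" unfolding T_def by (rule T_val_pos[OF assms])
  have D: "D \<ge> 0" using T g_pos B_pos \<sigma>_pos by (simp add: D_def)
  have "symb l (int n) = 0 \<longleftrightarrow> l\<^sup>2 - bb * T * l - (g * B + \<sigma> * (real n)\<^sup>2) * T = 0"
    using symb_factor[OF assms, of l] T \<sigma>_pos assms unfolding T_def[symmetric]
    by (metis less_numeral_extra(3) mult_eq_0_iff neg_equal_0_iff_equal of_nat_eq_0_iff power_eq_0_iff not_one_le_zero)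
  also have "\<dots> \<longleftrightarrow> (l - bb / 2 * T)\<^sup>2 = (sqrt D)\<^sup>2"
    using D by (simp add: D_def power2_eq_square algebra_simps)
  also have "\<dots> \<longleftrightarrow> l - bb / 2 * T = sqrt D \<or> l - bb / 2 * T = - sqrt D"
    by (rule power2_eq_iff)
  also have "\<dots> \<longleftrightarrow> (\<exists>e\<in>{1, -1}. l = lam_star g h A B \<beta> \<sigma> n e)"
    by (auto simp: lam_star_def bb_eq D_def T_def)
  finally show ?thesis .
qed

text \<open>Up to positive factors the derivative at a root is -2 e sqrt D. The discriminant is
  positive because g B + \<sigma> n^2 and T_n are, so the root is simple.\<close>

lemma dsymb_nonzero:
  assumes "n \<ge> 1" "e \<in> {1, -1}"
  shows "dsymb (lam_star g h A B \<beta> \<sigma> n e) (int n) \<noteq> 0"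
proof -
  define T D l where "T = T_val h n" and "D = bb\<^sup>2 / 4 * T\<^sup>2 + (g * B + \<sigma> * (real n)\<^sup>2) * T"
    and "l = lam_star g h A B \<beta> \<sigma> n e"
  have T: "T > 0" unfolding T_def by (rule T_val_pos[OF assms(1)])
  have n: "real n > 0" using assms by simp
  have D: "D > 0" using T n g_pos B_pos \<sigma>_pos by (simp add: D_def add_nonneg_pos add_pos_pos)
  have l: "l = bb / 2 * T + e * sqrt D" by (simp add: l_def lam_star_def bb_eq D_def T_def)
  have c: "coth (real n * h) = 1 / (T * real n)"
    unfolding T_def by (rule coth_T_val[OF assms(1)])
  have "dsymb l (int n) * (T * \<sigma> * (real n)\<^sup>2) = bb * T - 2 * l"
    unfolding dsymb_def of_int_of_nat_eq c using n \<sigma>_pos T by (simp add: field_simps power2_eq_square)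
  also have "\<dots> = - 2 * e * sqrt D" by (simp add: l)
  also have "\<dots> \<noteq> 0" using D assms(2) by auto
  finally show ?thesis unfolding l_def by auto
qed

text \<open>The shape of the operator along a line t \<phi>: the base of the square is a cubic in t,
  and all other transforms scale with t or t^2. Only the first-order coefficients reach the
  derivative.\<close>

lemma linearization_polynomial:
  fixes lam u1 u2 u3 v p q pp r :: real
  shows "((\<lambda>t. (lam + t * u1 + t * t * (u2 + t * u3))\<^sup>2 - (lam\<^sup>2 - t * v) * ((t * p)\<^sup>2 + (1 + t * q)\<^sup>2)
      - 2 * \<sigma> * ((t * pp + t * t * r) / sqrt ((1 + t * q)\<^sup>2 + (t * p)\<^sup>2)))
    has_real_derivative 2 * lam * u1 + v - 2 * lam\<^sup>2 * q - 2 * \<sigma> * pp) (at 0)"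
  by (auto intro!: derivative_eq_intros simp: algebra_simps power2_eq_square)

lemma Nop_bstar:
  assumes "n \<ge> 1"
  shows "Ecos (coef (Nop (bstar (int n) :: 'm::finite wien))) = (\<lambda>x. cos (real n * x))"
proof
  fix x
  let ?f = "\<lambda>k. coef (Nop (bstar (int n) :: 'm wien)) k * cos (real_of_int k * x + 0)"
  have "(?f has_sum cos (real n * x)) UNIV"
    by (rule has_sum_finite_neutralI[of "{int n, - int n}"]) (use assms in \<open>auto simp: coef_bstar\<close>)
  then show "Ecos (coef (Nop (bstar (int n) :: 'm wien))) x = cos (real n * x)"
    unfolding Ecos_def tser_def by (rule infsumI)
qed

lemma cos_X:
  assumes "n \<ge> 1" "0 < \<alpha>" "\<alpha> < 1"
  shows "(\<lambda>x. t * cos (real n * x)) \<in> X_space \<alpha>"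
proof -
  have "Ecos (coef (Nop (t *\<^sub>R bstar (int n) :: bool wien))) \<in> X_space \<alpha>"
    by (intro Ecos_X od_arith od_bstar assms)
  moreover have "Ecos (coef (Nop (t *\<^sub>R bstar (int n) :: bool wien))) = (\<lambda>x. t * cos (real n * x))"
    using Nop_bstar[OF assms(1), where 'm = bool]
    by (simp only: Nop_linear Ecos_linear fun_eq_iff) simp
  ultimately show ?thesis by simp
qed

text \<open>Connects the hypothesis on the kernel, phrased through pointwise derivatives of the
  operator, with the zeros of the symbol: every critical mode contributes a cosine.\<close>

lemma cos_in_kernel:
  assumes n: "n \<ge> 1" and \<alpha>: "0 < \<alpha>" "\<alpha> < 1" and z: "symb lam (int n) = 0"
  shows "(0, \<lambda>x. cos (real n * x)) \<in> F_kernel g h A B \<beta> \<sigma> \<alpha> lam"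
proof -
  let ?b = "bstar (int n) :: unit wien"
  define c where "c x = cos (real n * x)" for x
  define w where "w t x = t * c x" for t x
  have wX: "w t \<in> X_space \<alpha>" for t unfolding w_def c_def by (rule cos_X[OF n \<alpha>])
  have cN: "Ecos (coef (Nop ?b)) = c" unfolding c_def[abs_def] by (rule Nop_bstar[OF n])
  have ob: "od ?b" by (rule od_bstar)
  have eN: "evn (Nop ?b)" by (rule Nop_parity(1)[OF ob])
  have oNb: "od (Nop ?b * ?b)" "od (Nop ?b * Nop ?b * ?b)" by (intro od_mult' evn_mult eN ob)+
  have dw: "deriv (w t) = (\<lambda>x. t * Osin (coef ?b) x)" for t
  proof
    fix x show "deriv (w t) x = t * Osin (coef ?b) x"
      unfolding w_def cN[symmetric]
      by (intro DERIV_imp_deriv DERIV_cmult Nop_deriv[OF ob])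
  qed
  define p q where "p = Osin (coef ?b)" and "q = Ecos (coef (Mop h ?b))"
  have pc: "p x = - (real n * sin (real n * x))" for x
  proof -
    have "(c has_real_derivative p x) (at x)" using Nop_deriv[OF ob, of x] by (simp only: cN p_def)
    moreover have "(c has_real_derivative - (real n * sin (real n * x))) (at x)"
      unfolding c_def[abs_def] by (auto intro!: derivative_eq_intros)
    ultimately show ?thesis by (rule DERIV_unique)
  qed
  define pp where "pp x = - ((real n)\<^sup>2 * c x)" for x
  have Dp: "(p has_real_derivative pp x) (at x)" for x
    unfolding pc[abs_def] pp_def c_def by (auto intro!: derivative_eq_intros simp: power2_eq_square)
  have ddw: "deriv (deriv (w t)) = (\<lambda>x. t * pp x)" for t
  proof
    fix x show "deriv (deriv (w t)) x = t * pp x"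
      unfolding dw p_def[symmetric] by (intro DERIV_imp_deriv DERIV_cmult Dp)
  qed
  have tb: "(\<lambda>x. t * Osin (coef a) x) = Osin (coef (t *\<^sub>R a))" for t and a :: "unit wien"
    by (rule ext) (simp only: Osin_linear)
  have H: "hilbert_strip h (\<lambda>x. t * Osin (coef a) x) x = t * Ecos (coef (Mop h a)) x" if "od a" for t x and a :: "unit wien"
    unfolding tb using hilbert_strip_od[OF h_pos od_arith(3)[OF that]] by (simp only: Mop_linear Ecos_linear)
  have qc: "q x = real n * coth (real n * h) * c x" for x
  proof -
    have "Mop h ?b = (real n * coth (real n * h)) *\<^sub>R Nop ?b"
    proof (rule wien_eqI)
      fix j
      consider "j = int n" | "j = - int n" | "\<bar>j\<bar> \<noteq> int n" by linarith
      then show "coef (Mop h ?b) j = coef ((real n * coth (real n * h)) *\<^sub>R Nop ?b) j"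
        by cases (use n h_pos in \<open>auto simp: coef_Mop coef_bstar\<close>)
    qed
    then show ?thesis unfolding q_def by (simp only: Ecos_linear cN)
  qed
  \<comment> \<open>Homogeneity of the transform on w'' is obtained from uniqueness of derivatives:
    both sides differentiate t q.\<close>
  have HH: "hilbert_strip h (\<lambda>x. t * pp x) x = t * hilbert_strip h pp x" for t x
  proof -
    have cw: "coef (wb (w t)) = coef (t *\<^sub>R ?b)" for t
    proof -
      have "w t = Ecos (coef (Nop (t *\<^sub>R ?b)))" by (simp only: w_def fun_eq_iff Nop_linear Ecos_linear cN) simp
      then show ?thesis using coef_wb_Ecos[OF od_arith(3)[OF ob], of t \<alpha>] wX[of t] by simp
    qed
    have cM: "Ecos (coef (Mop h (wb (w t)))) = (\<lambda>x. t * q x)" for t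
    proof -
      have "wb (w t) = t *\<^sub>R ?b" using cw[of t] by (simp add: coef_inject)
      then show ?thesis by (simp only: Mop_linear Ecos_linear q_def fun_eq_iff) simp
    qed
    have D: "((\<lambda>x. t * q x) has_real_derivative hilbert_strip h (\<lambda>x. t * pp x) x) (at x)" for t
      using hilbert_strip_X_deriv2[OF h_pos \<alpha>(1) wX[of t], of x] unfolding cM ddw .
    have "((\<lambda>x. t * q x) has_real_derivative t * hilbert_strip h pp x) (at x)"
      using DERIV_cmult[OF D[of 1], of t] by simp
    with D show ?thesis by (rule DERIV_unique)
  qed
  have lin: "F_lin g h A B \<beta> \<sigma> lam 0 c x = 0" for x
  proof -
    define m2 m3 e1 e2 where "m2 = mean (\<lambda>y. (c y)\<^sup>2)" and "m3 = mean (\<lambda>y. (c y) ^ 3)"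
      and "e1 = Ecos (coef (Mop h (Nop ?b * ?b))) x" and "e2 = Ecos (coef (Mop h (Nop ?b * Nop ?b * ?b))) x"
    have M2: "mean (\<lambda>y. (w t y)\<^sup>2) = t * t * m2" for t
      by (simp add: w_def m2_def mean_def power_mult_distrib power2_eq_square[of t])
    have M3: "mean (\<lambda>y. (w t y) ^ 3) = t * t * t * m3" for t
      by (simp add: w_def m3_def mean_def power_mult_distrib power3_eq_cube[of t])
    have H1: "hilbert_strip h (\<lambda>y. w t y * (t * p y)) x = t * t * e1" for t
    proof -
      have "(\<lambda>y. w t y * (t * p y)) = (\<lambda>y. (t * t) * Osin (coef (Nop ?b * ?b)) y)"
        by (simp only: Osin_mult[OF eN ob] cN) (simp add: w_def p_def mult_ac)
      then show ?thesis using H[OF oNb(1), of "t * t" x] by (simp add: e1_def)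
    qed
    have H2: "hilbert_strip h (\<lambda>y. (w t y)\<^sup>2 * (t * p y)) x = t * t * t * e2" for t
    proof -
      have "(\<lambda>y. (w t y)\<^sup>2 * (t * p y)) = (\<lambda>y. (t * t * t) * Osin (coef (Nop ?b * Nop ?b * ?b)) y)"
        by (simp only: Osin_mult[OF evn_mult[OF eN eN] ob] Ecos_mult[OF eN eN] cN) (simp add: w_def p_def mult_ac power2_eq_square)
      then show ?thesis using H[OF oNb(2), of "t * t * t" x] by (simp add: e2_def)
    qed
    have H0: "hilbert_strip h (\<lambda>y. t * p y) x = t * q x" for t
      using H[OF ob, of t x] by (simp add: p_def q_def)
    \<comment> \<open>Coefficients of t, t^2 and t^3 in the base of the square.\<close>
    let ?u1 = "\<beta> * c x + g * A * h * c x"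
    let ?u2 = "- \<beta> * (m2 / (2 * h) + e1 - c x * q x) - g * A / 2 * (- m2 - (c x)\<^sup>2 + 2 * h * e1 - 2 * h * c x * q x)"
    let ?u3 = "- (g * A / 2) * (m3 / (3 * h) + e2 - (c x)\<^sup>2 * q x)"
    have "F_op g h A B \<beta> \<sigma> lam (t * 0) (w t) x =
        (lam + t * ?u1 + t * t * (?u2 + t * ?u3))\<^sup>2 - (lam\<^sup>2 - t * (2 * g * B * c x)) * ((t * p x)\<^sup>2 + (1 + t * q x)\<^sup>2)
      - 2 * \<sigma> * ((t * pp x + t * t * (q x * pp x - p x * hilbert_strip h pp x)) / sqrt ((1 + t * q x)\<^sup>2 + (t * p x)\<^sup>2))" for t
    proof -
      have Q: "lam - \<beta> * (t * t * m2 / (2 * h) - w t x + t * t * e1 - w t x * (t * q x)) -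
          g * A / 2 * (t * t * t * m3 / (3 * h) - t * t * m2 - (w t x)\<^sup>2 - 2 * h * w t x + t * t * t * e2 - (w t x)\<^sup>2 * (t * q x)
            + 2 * h * (t * t * e1) - 2 * h * w t x * (t * q x)) = lam + t * ?u1 + t * t * (?u2 + t * ?u3)"
        using h_pos by (simp add: w_def field_simps power2_eq_square)
      have X: "t * pp x + t * q x * (t * pp x) - t * p x * (t * hilbert_strip h pp x) = t * pp x + t * t * (q x * pp x - p x * hilbert_strip h pp x)"
        by (simp add: algebra_simps)
      have L: "lam\<^sup>2 + t * 0 - 2 * g * B * w t x = lam\<^sup>2 - t * (2 * g * B * c x)" by (simp add: w_def)
      show ?thesis
        unfolding F_op_def Let_def conf_factor_def dw p_def[symmetric] ddw[unfolded dw p_def[symmetric]] M2 M3 H0 H1 H2 HH Q X L ..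
    qed
    then have F: "(\<lambda>t. F_op g h A B \<beta> \<sigma> lam (t * 0) (\<lambda>y. t * c y) x) = (\<lambda>t. (lam + t * ?u1 + t * t * (?u2 + t * ?u3))\<^sup>2 - (lam\<^sup>2 - t * (2 * g * B * c x)) * ((t * p x)\<^sup>2 + (1 + t * q x)\<^sup>2)
      - 2 * \<sigma> * ((t * pp x + t * t * (q x * pp x - p x * hilbert_strip h pp x)) / sqrt ((1 + t * q x)\<^sup>2 + (t * p x)\<^sup>2)))"
      by (simp only: w_def[abs_def])
    have "F_lin g h A B \<beta> \<sigma> lam 0 c x = 2 * lam * ?u1 + 2 * g * B * c x - 2 * lam\<^sup>2 * q x - 2 * \<sigma> * pp x"
      unfolding F_lin_def F by (rule DERIV_imp_deriv[OF linearization_polynomial])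
    also have "\<dots> = 2 * c x * (\<sigma> * (real n)\<^sup>2 * symb lam (int n))"
      unfolding symb_def qc pp_def using n \<sigma>_pos by (simp add: bb_def field_simps power2_eq_square)
    finally show ?thesis by (simp add: z)
  qed
  have "c \<in> X_space \<alpha>" using wX[of 1] by (simp add: w_def[abs_def])
  with lin show ?thesis by (simp add: F_kernel_def c_def[abs_def])
qed

text \<open>Cosines of two critical modes would be multiples of one function; both equal 1 at the
  origin, so they would coincide, against their orthogonality.\<close>

lemma one_dimensional_symb:
  assumes \<alpha>: "0 < \<alpha>" "\<alpha> < 1" and one: "one_dimensional (F_kernel g h A B \<beta> \<sigma> \<alpha> lam)"
    and n: "n \<ge> 1" "symb lam (int n) = 0" and m: "m \<ge> 1" "symb lam (int m) = 0"
  shows "m = n"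
proof -
  obtain \<nu> \<phi> where K: "F_kernel g h A B \<beta> \<sigma> \<alpha> lam = {(c * \<nu>, \<lambda>x. c * \<phi> x) | c. True}"
    using one by (auto simp: one_dimensional_def)
  obtain c where c: "(\<lambda>x. cos (real n * x)) = (\<lambda>x. c * \<phi> x)"
    using cos_in_kernel[OF n(1) \<alpha> n(2)] unfolding K by auto
  obtain d where d: "(\<lambda>x. cos (real m * x)) = (\<lambda>x. d * \<phi> x)"
    using cos_in_kernel[OF m(1) \<alpha> m(2)] unfolding K by auto
  have "c * \<phi> 0 = 1" "d * \<phi> 0 = 1" using fun_cong[OF c, of 0] fun_cong[OF d, of 0] by auto
  then have "c = d" by (metis mult_cancel_right mult_zero_right zero_neq_one)
  then have e: "(\<lambda>x. cos (real n * x)) = (\<lambda>x. cos (real m * x))" using c d by simp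
  show ?thesis
  proof (rule ccontr)
    assume "m \<noteq> n"
    then have "integral {-pi..pi} (\<lambda>x. cos (real m * x) * cos (real n * x)) = 0"
      using integral_cos_cos[of "int m" 0 "int n" 0] m by simp
    then have "integral {-pi..pi} (\<lambda>x. cos (real n * x) * cos (real n * x)) = 0"
      using fun_cong[OF e] by simp
    then show False using integral_cos_cos[of "int n" 0 "int n" 0] n by simp
  qed
qed

lemma symb_critical:
  assumes \<alpha>: "0 < \<alpha>" "\<alpha> < 1" and n: "n \<ge> 1" "e \<in> {1, -1}"
    and one: "one_dimensional (F_kernel g h A B \<beta> \<sigma> \<alpha> (lam_star g h A B \<beta> \<sigma> n e))"
  shows "symb (lam_star g h A B \<beta> \<sigma> n e) j = 0 \<longleftrightarrow> \<bar>j\<bar> = int n"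
proof -
  let ?l = "lam_star g h A B \<beta> \<sigma> n e"
  have z: "symb ?l (int n) = 0" using symb_zero_iff[OF n(1), of ?l] n(2) by blast
  have abs: "symb ?l \<bar>j\<bar> = symb ?l j" by (simp add: abs_if symb_minus)
  show ?thesis
  proof
    assume j: "symb ?l j = 0"
    then have "j \<noteq> 0" by (auto simp: symb_def)
    then have "nat \<bar>j\<bar> \<ge> 1" by simp
    moreover have "symb ?l (int (nat \<bar>j\<bar>)) = 0" using j abs by simp
    ultimately have "nat \<bar>j\<bar> = n" using one_dimensional_symb[OF \<alpha> one n(1) z] by blast
    then show "\<bar>j\<bar> = int n" by auto
  next
    assume "\<bar>j\<bar> = int n"
    then show "symb ?l j = 0" using z abs by simp
  qed
qed

lemma symb_regular:
  assumes "l \<notin> {lam_star g h A B \<beta> \<sigma> n e | n e. n \<ge> 1 \<and> e \<in> {1, -1}}"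
  shows "symb l j \<noteq> 0"
proof
  assume j: "symb l j = 0"
  then have "j \<noteq> 0" by (auto simp: symb_def)
  then have "nat \<bar>j\<bar> \<ge> 1" by simp
  moreover have "symb l (int (nat \<bar>j\<bar>)) = 0" using j by (simp add: abs_if symb_minus)
  ultimately show False using symb_zero_iff[of "nat \<bar>j\<bar>" l] assms by blast
qed

end

section \<open>Solutions near the trivial branch\<close>

context wave
begin

abbreviation "sols \<alpha> \<equiv> solutions g h A B \<beta> \<sigma> \<alpha>"

text \<open>Translates smallness in X into the smallness required of b and \<kappa>. The final
  halving in \<eta> compensates for the factor 2 in \<open>wb_norm_le\<close>, which does not depend
  on \<alpha>.\<close>

lemma small_coefficients:
  assumes \<rho>: "\<rho> > 0"
  obtains \<eta> where "\<eta> > 0" "\<And>\<alpha> w. w \<in> X_space \<alpha> \<Longrightarrow> hoelder_norm 2 \<alpha> w < \<eta> \<Longrightarrow>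
    norm (wb w) < \<rho> \<and> norm (Mop h (wb w)) < 1 \<and> (\<exists>k. evn k \<and> norm k < \<rho> \<and> norm k < 1 \<and> E1 1 (wb w) k = 0)"
proof -
  have "min \<rho> 1 > 0" using \<rho> by simp
  from kappa_exists[OF this] obtain \<delta> where d: "\<delta> > 0"
    "\<And>b :: unit wien. od b \<Longrightarrow> norm b < \<delta> \<Longrightarrow> \<exists>k. evn k \<and> norm k < min \<rho> 1 \<and> E1 1 b k = 0" by metis
  obtain K where K: "K > 0" "\<And>a :: unit wien. norm (Mop h a) \<le> norm a * K"
    using bounded_linear.pos_bounded[OF bounded_linear_Mop[OF h_pos]] by blast
  define \<eta> where "\<eta> = min (min \<rho> \<delta>) (1 / K) / 2"
  have \<eta>: "\<eta> > 0" using \<rho> d K by (simp add: \<eta>_def)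
  show ?thesis
  proof (rule that[OF \<eta>])
    fix \<alpha> w assume w: "w \<in> X_space \<alpha>" "hoelder_norm 2 \<alpha> w < \<eta>"
    have n: "norm (wb w) < min (min \<rho> \<delta>) (1 / K)" using wb_norm_le[OF w(1)] w(2) by (simp add: \<eta>_def)
    have "norm (Mop h (wb w)) < 1"
    proof -
      have "norm (wb w) * K < 1" using n K(1) by (simp add: pos_less_divide_eq)
      then show ?thesis using K(2)[of "wb w"] by linarith
    qed
    moreover have "\<exists>k. evn k \<and> norm k < \<rho> \<and> norm k < 1 \<and> E1 1 (wb w) k = 0"
      using d(2)[OF od_wb[OF w(1)]] n by auto
    ultimately show "norm (wb w) < \<rho> \<and> norm (Mop h (wb w)) < 1 \<and> (\<exists>k. evn k \<and> norm k < \<rho> \<and> norm k < 1 \<and> E1 1 (wb w) k = 0)"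
      using n by simp
  qed
qed

lemma wb_zero:
  assumes "w \<in> X_space \<alpha>" "wb w = 0"
  shows "w = (\<lambda>x. 0)"
proof -
  have "Nop (0 :: unit wien) = 0" by (simp only: Nop_linear)
  then show ?thesis using X_eq_Ecos[OF assms(1)] unfolding assms(2) by (simp only: Ecos_linear fun_eq_iff) simp
qed

lemma regular_solutions_trivial:
  assumes \<alpha>: "0 < \<alpha>" and reg: "\<And>j. symb l0 j \<noteq> 0"
  obtains r where "r > 0" "\<And>l m w. (l, m, w) \<in> sols \<alpha> \<Longrightarrow> \<bar>l - l0\<bar> < r \<Longrightarrow> \<bar>m\<bar> < r \<Longrightarrow>
    hoelder_norm 2 \<alpha> w < r \<Longrightarrow> m = 0 \<and> w = (\<lambda>x. 0)"
proof -
  obtain r where r: "r > 0" "\<And>l m (y :: unit wien) k. \<bar>l - l0\<bar> < r \<Longrightarrow> \<bar>m\<bar> < r \<Longrightarrow> norm y < r \<Longrightarrow> norm k < r \<Longrightarrow>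
    Phi (1, l, m, y, k) = 0 \<Longrightarrow> m = 0 \<and> y = 0" using regular_isolated[OF reg] by metis
  obtain \<eta> where \<eta>: "\<eta> > 0" "\<And>\<alpha> w. w \<in> X_space \<alpha> \<Longrightarrow> hoelder_norm 2 \<alpha> w < \<eta> \<Longrightarrow>
    norm (wb w) < r \<and> norm (Mop h (wb w)) < 1 \<and> (\<exists>k. evn k \<and> norm k < r \<and> norm k < 1 \<and> E1 1 (wb w) k = 0)"
    using small_coefficients[OF r(1)] by metis
  show ?thesis
  proof (rule that[of "min r \<eta>"])
    fix l m w assume s: "(l, m, w) \<in> sols \<alpha>" and a: "\<bar>l - l0\<bar> < min r \<eta>" "\<bar>m\<bar> < min r \<eta>" "hoelder_norm 2 \<alpha> w < min r \<eta>"
    have w: "w \<in> X_space \<alpha>" and F: "\<forall>x. F_op g h A B \<beta> \<sigma> l m w x = 0" using s by (auto simp: solutions_def)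
    obtain k where k: "norm (wb w) < r" "norm (Mop h (wb w)) < 1" "evn k" "norm k < r" "norm k < 1" "E1 1 (wb w) k = 0"
      using \<eta>(2)[OF w] a by auto
    have "Phi (1, l, m, wb w, k) = 0"
      using F_op_zero_iff[OF \<alpha> w refl k(3,6,5,2)] F by blast
    with r(2)[of l m "wb w" k] a k have "m = 0" "wb w = 0" by auto
    then show "m = 0 \<and> w = (\<lambda>x. 0)" using wb_zero[OF w] by simp
  qed (use r \<eta> in auto)
qed

text \<open>Divided by its amplitude s, a solution falls into the ball where the implicit function
  theorem admits a single solution for each s. For s = 0 the same estimate forces m and w to vanish.
  The curve of weight 1 acts here only as a common value for two solutions.\<close>

lemma critical_solutions_unique:
  assumes \<alpha>: "0 < \<alpha>" and n: "n \<ge> 1" and crit: "\<And>j. symb l0 j = 0 \<longleftrightarrow> \<bar>j\<bar> = int n"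
    and trans: "dsymb l0 (int n) \<noteq> 0"
  obtains r where "r > 0"
    "\<And>l m w. (l, m, w) \<in> sols \<alpha> \<Longrightarrow> \<bar>l - l0\<bar> < r \<Longrightarrow> \<bar>m\<bar> < r \<Longrightarrow> hoelder_norm 2 \<alpha> w < r \<Longrightarrow>
      fourier_cos w n = 0 \<Longrightarrow> m = 0 \<and> w = (\<lambda>x. 0)"
    "\<And>l m w l' m' w'. (l, m, w) \<in> sols \<alpha> \<Longrightarrow> \<bar>l - l0\<bar> < r \<Longrightarrow> \<bar>m\<bar> < r \<Longrightarrow> hoelder_norm 2 \<alpha> w < r \<Longrightarrow>
      (l', m', w') \<in> sols \<alpha> \<Longrightarrow> \<bar>l' - l0\<bar> < r \<Longrightarrow> \<bar>m'\<bar> < r \<Longrightarrow> hoelder_norm 2 \<alpha> w' < r \<Longrightarrow>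
      fourier_cos w n = fourier_cos w' n \<Longrightarrow> fourier_cos w n \<noteq> 0 \<Longrightarrow> \<bar>fourier_cos w n\<bar> < r \<Longrightarrow> (l, m, w) = (l', m', w')"
proof -
  have n': "int n > 0" using n by simp
  obtain r1 \<delta> C L M Y K where c: "r1 > 0" "\<delta> > 0"
    "\<And>s l m y k. \<bar>s\<bar> < \<delta> \<Longrightarrow> od y \<Longrightarrow> evn k \<Longrightarrow> coef y (int n) = real_of_int (int n) / 2 \<Longrightarrow>
        Phi (s, l, m, y, k) = 0 \<Longrightarrow> norm ((l, m, y, k) - (l0, 0, bstar (int n), kstar (int n))) < r1 \<Longrightarrow>
        (l, m, y, k) = (L s, M s, Y s :: unit wien, K s)"
    using critical_curve[OF n' crit trans, where 'm = unit] by metis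
  \<comment> \<open>One quarter of r1 bounds |l - l0| and another the rescaled m, y and k together,
    so their sum stays below r1.\<close>
  have "r1 / 4 > 0" using c by simp
  from critical_estimate[OF n' crit this, where 'm = unit] obtain r2 where r2: "r2 > 0"
    "\<And>l m (y :: unit wien) k s. \<bar>l - l0\<bar> < r2 \<Longrightarrow> \<bar>m\<bar> < r2 \<Longrightarrow> norm y < r2 \<Longrightarrow> norm k < r2 \<Longrightarrow>
    Phi (1, l, m, y, k) = 0 \<Longrightarrow> od y \<Longrightarrow> coef y (int n) = s * real_of_int (int n) / 2 \<Longrightarrow>
    \<bar>m\<bar> + norm (y - s *\<^sub>R bstar (int n)) + norm (k - s *\<^sub>R kstar (int n)) \<le> r1 / 4 * \<bar>s\<bar>" by metis
  obtain \<eta> where \<eta>: "\<eta> > 0" "\<And>\<alpha> w. w \<in> X_space \<alpha> \<Longrightarrow> hoelder_norm 2 \<alpha> w < \<eta> \<Longrightarrow>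
    norm (wb w) < r2 \<and> norm (Mop h (wb w)) < 1 \<and> (\<exists>k. evn k \<and> norm k < r2 \<and> norm k < 1 \<and> E1 1 (wb w) k = 0)"
    using small_coefficients[OF r2(1)] by metis
  define r where "r = Min {r1 / 4, r2, \<eta>, \<delta>}"
  have r: "r > 0" using c r2 \<eta> by (simp add: r_def)
  have rle: "r \<le> r1 / 4" "r \<le> r2" "r \<le> \<eta>" "r \<le> \<delta>" unfolding r_def by (rule Min_le; simp)+
  have base: "\<exists>k. evn k \<and> Phi (1, l, m, wb w, k) = 0 \<and> coef (wb w) (int n) = fourier_cos w n * real_of_int (int n) / 2 \<and>
      \<bar>m\<bar> + norm (wb w - fourier_cos w n *\<^sub>R bstar (int n)) + norm (k - fourier_cos w n *\<^sub>R kstar (int n)) \<le> r1 / 4 * \<bar>fourier_cos w n\<bar>"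
    if s: "(l, m, w) \<in> sols \<alpha>" "\<bar>l - l0\<bar> < r" "\<bar>m\<bar> < r" "hoelder_norm 2 \<alpha> w < r" for l m w
  proof -
    have w: "w \<in> X_space \<alpha>" and F: "\<forall>x. F_op g h A B \<beta> \<sigma> l m w x = 0" using s by (auto simp: solutions_def)
    obtain k where k: "norm (wb w) < r2" "norm (Mop h (wb w)) < 1" "evn k" "norm k < r2" "norm k < 1" "E1 1 (wb w) k = 0"
      using \<eta>(2)[OF w] s rle by auto
    have P: "Phi (1, l, m, wb w, k) = 0"
      using F_op_zero_iff[OF \<alpha> w refl k(3,6,5,2)] F by blast
    have f: "coef (wb w) (int n) = fourier_cos w n * real_of_int (int n) / 2" by (simp add: coef_wb[OF w])
    show ?thesis
      using r2(2)[OF _ _ k(1,4) P od_wb[OF w] f] s rle k(3) P f by (intro exI[of _ k]) auto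
  qed
  have repr: "l = L (fourier_cos w n) \<and> m = fourier_cos w n * M (fourier_cos w n) \<and> wb w = fourier_cos w n *\<^sub>R Y (fourier_cos w n)"
    if s: "(l, m, w) \<in> sols \<alpha>" "\<bar>l - l0\<bar> < r" "\<bar>m\<bar> < r" "hoelder_norm 2 \<alpha> w < r" "fourier_cos w n \<noteq> 0" "\<bar>fourier_cos w n\<bar> < r" for l m w
  proof -
    define s where "s = fourier_cos w n"
    obtain k where k: "evn k" "Phi (1, l, m, wb w, k) = 0" "coef (wb w) (int n) = s * real_of_int (int n) / 2"
      "\<bar>m\<bar> + norm (wb w - s *\<^sub>R bstar (int n)) + norm (k - s *\<^sub>R kstar (int n)) \<le> r1 / 4 * \<bar>s\<bar>"
      using base[OF s(1-4)] unfolding s_def by blast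
    have s0: "s \<noteq> 0" "\<bar>s\<bar> < \<delta>" using s(5,6) rle by (auto simp: s_def)
    have w: "w \<in> X_space \<alpha>" using s(1) by (auto simp: solutions_def)
    let ?y = "(1 / s) *\<^sub>R wb w" and ?k = "(1 / s) *\<^sub>R k"
    have "s *\<^sub>R Phi (s, l, m / s, ?y, ?k) = 0"
      using Phi_scale[of l s "m / s" ?y ?k] s0 k(2) by simp
    then have P: "Phi (s, l, m / s, ?y, ?k) = 0" using s0 by simp
    have "\<bar>m / s\<bar> + norm (?y - bstar (int n)) + norm (?k - kstar (int n)) = (\<bar>m\<bar> + norm (wb w - s *\<^sub>R bstar (int n)) + norm (k - s *\<^sub>R kstar (int n))) / \<bar>s\<bar>"
    proof -
      have "?y - bstar (int n) = (1 / s) *\<^sub>R (wb w - s *\<^sub>R bstar (int n))" "?k - kstar (int n) = (1 / s) *\<^sub>R (k - s *\<^sub>R kstar (int n))"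
        using s0 by (simp_all add: scaleR_diff_right)
      then show ?thesis using s0 by (simp only: norm_scaleR) (simp add: abs_divide add_divide_distrib)
    qed
    also have "\<dots> \<le> r1 / 4" using k(4) s0 by (simp add: divide_le_eq)
    finally have "\<bar>m / s\<bar> + norm (?y - bstar (int n)) + norm (?k - kstar (int n)) \<le> r1 / 4" .
    moreover have "norm ((l, m / s, ?y, ?k) - (l0, 0, bstar (int n), kstar (int n))) \<le> \<bar>l - l0\<bar> + (\<bar>m / s\<bar> + (norm (?y - bstar (int n)) + norm (?k - kstar (int n))))"
      using norm_Pair_le[of "l - l0" "(m / s, ?y - bstar (int n), ?k - kstar (int n))"]
        norm_Pair_le[of "m / s" "(?y - bstar (int n), ?k - kstar (int n))"]
        norm_Pair_le[of "?y - bstar (int n)" "?k - kstar (int n)"] by simp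
    ultimately have "norm ((l, m / s, ?y, ?k) - (l0, 0, bstar (int n), kstar (int n))) < r1"
      using s(2) rle(1) c(1) by linarith
    from c(3)[OF s0(2) _ _ _ P this] have "(l, m / s, ?y, ?k) = (L s, M s, Y s, K s)"
      using od_wb[OF w] k(1,3) s0(1) by (auto intro!: od_arith evn_arith)
    then have "l = L s" "m / s = M s" "?y = Y s" by auto
    moreover have "m = s * (m / s)" "wb w = s *\<^sub>R ?y" using s0(1) by auto
    ultimately show ?thesis unfolding s_def[symmetric] by metis
  qed
  show ?thesis
  proof (rule that[OF r])
    fix l m w assume s: "(l, m, w) \<in> sols \<alpha>" "\<bar>l - l0\<bar> < r" "\<bar>m\<bar> < r" "hoelder_norm 2 \<alpha> w < r" "fourier_cos w n = 0"
    obtain k :: "unit wien" where "\<bar>m\<bar> + norm (wb w) + norm k \<le> 0" using base[OF s(1-4)] s(5) by auto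
    then have "\<bar>m\<bar> = 0" "norm (wb w) = 0" using norm_ge_zero[of "wb w"] norm_ge_zero[of k] abs_ge_zero[of m] by linarith+
    then show "m = 0 \<and> w = (\<lambda>x. 0)" using wb_zero[of w \<alpha>] s(1) by (simp add: solutions_def)
  next
    fix l m w l' m' w'
    assume s: "(l, m, w) \<in> sols \<alpha>" "\<bar>l - l0\<bar> < r" "\<bar>m\<bar> < r" "hoelder_norm 2 \<alpha> w < r"
      and s': "(l', m', w') \<in> sols \<alpha>" "\<bar>l' - l0\<bar> < r" "\<bar>m'\<bar> < r" "hoelder_norm 2 \<alpha> w' < r"
      and f: "fourier_cos w n = fourier_cos w' n" "fourier_cos w n \<noteq> 0" "\<bar>fourier_cos w n\<bar> < r"
    have e: "l = l'" "m = m'" "wb w = wb w'" using repr[OF s f(2,3)] repr[OF s'] f by auto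
    have "w \<in> X_space \<alpha>" "w' \<in> X_space \<alpha>" using s(1) s'(1) by (auto simp: solutions_def)
    then have "w = w'" using X_eq_Ecos[of w \<alpha>] X_eq_Ecos[of w' \<alpha>] e(3) by metis
    with e show "(l, m, w) = (l', m', w')" by simp
  qed
qed

lemma trivial_subset: "0 < \<alpha> \<Longrightarrow> trivial_solutions \<subseteq> sols \<alpha>"
proof
  fix p assume \<alpha>: "0 < \<alpha>" and "p \<in> trivial_solutions"
  then obtain l where p: "p = (l, 0, \<lambda>x. 0)" by (auto simp: trivial_solutions_def)
  have wb0: "wb (\<lambda>x. 0) = 0" by (rule wien_eqI) (simp add: coef_wb[OF X_zero] fourier_cos_def)
  have a: "coef (0 :: unit wien) = coef (wb (\<lambda>x. 0))" "evn (0 :: unit wien)" "E1 1 (0 :: unit wien) 0 = 0"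
    "norm (0 :: unit wien) < 1" "norm (Mop h (0 :: unit wien)) < 1"
    using Phi_trivial[of 0, where 'a = unit] by (simp_all add: wb0 evn_arith Phi_def Mop_linear zero_prod_def)
  show "p \<in> sols \<alpha>"
    using conf_factor_nonzero[OF \<alpha> X_zero a] F_op_zero_iff[OF \<alpha> X_zero a, of l 0] Phi_trivial
    by (auto simp: p solutions_def X_zero)
qed

text \<open>The interval is shrunk until s K and M (s Y) have norm below 1, as the equivalence with
  F requires. The normalization of Y makes the parameter s equal to the n-th cosine coefficient of
  the solution.\<close>

lemma solution_curve:
  assumes \<alpha>: "0 < \<alpha>" "\<alpha> < 1" and n: "n \<ge> 1" and crit: "\<And>j. symb l0 j = 0 \<longleftrightarrow> \<bar>j\<bar> = int n"
    and trans: "dsymb l0 (int n) \<noteq> 0"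
  obtains \<delta> C L M and Y :: "real \<Rightarrow> bool wien" where "\<delta> > 0" "C > 0" "L 0 = l0" "M 0 = 0" "Y 0 = bstar (int n)"
    "\<And>s. \<bar>s\<bar> \<le> \<delta> \<Longrightarrow> od (Y s) \<and> norm (Y s) \<le> C"
    "\<And>s. \<bar>s\<bar> \<le> \<delta> \<Longrightarrow> (L s, s * M s, Ecos (coef (Nop (s *\<^sub>R Y s)))) \<in> sols \<alpha>"
    "\<And>s. \<bar>s\<bar> \<le> \<delta> \<Longrightarrow> fourier_cos (Ecos (coef (Nop (s *\<^sub>R Y s)))) n = s"
    "\<And>s t. \<bar>s\<bar> \<le> \<delta> \<Longrightarrow> \<bar>t\<bar> \<le> \<delta> \<Longrightarrow> \<bar>L s - L t\<bar> \<le> C * \<bar>s - t\<bar> \<and> \<bar>M s - M t\<bar> \<le> C * \<bar>s - t\<bar> \<and> norm (Y s - Y t) \<le> C * \<bar>s - t\<bar>"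
proof -
  have n': "int n > 0" using n by simp
  obtain \<delta>1 C L M K and Y :: "real \<Rightarrow> bool wien" where c: "\<delta>1 > 0" "C > 0"
    "\<And>s. \<bar>s\<bar> < \<delta>1 \<Longrightarrow> od (Y s) \<and> evn (K s) \<and> coef (Y s) (int n) = real_of_int (int n) / 2 \<and> Phi (s, L s, M s, Y s, K s) = 0"
    "\<And>s t. \<bar>s\<bar> < \<delta>1 \<Longrightarrow> \<bar>t\<bar> < \<delta>1 \<Longrightarrow> norm ((L s, M s, Y s, K s) - (L t, M t, Y t, K t)) \<le> C * \<bar>s - t\<bar>"
    "(L 0, M 0, Y 0, K 0) = (l0, 0, bstar (int n), kstar (int n))"
    using critical_curve[OF n' crit trans, where 'm = bool] by metis
  have lip: "\<bar>L s - L t\<bar> \<le> C * \<bar>s - t\<bar> \<and> \<bar>M s - M t\<bar> \<le> C * \<bar>s - t\<bar> \<and> norm (Y s - Y t) \<le> C * \<bar>s - t\<bar> \<and> norm (K s - K t) \<le> C * \<bar>s - t\<bar>"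
    if "\<bar>s\<bar> < \<delta>1" "\<bar>t\<bar> < \<delta>1" for s t
  proof -
    have "norm (a, b, y, k) \<ge> \<bar>a\<bar> \<and> norm (a, b, y, k) \<ge> \<bar>b\<bar> \<and> norm (a, b, y, k) \<ge> norm y \<and> norm (a, b, y, k) \<ge> norm k"
      for a b :: real and y k :: "bool wien"
      using norm_fst_le[of a "(b, y, k)"] norm_snd_le[of "(b, y, k)" a] norm_fst_le[of b "(y, k)"] norm_snd_le[of "(y, k)" b]
        norm_fst_le[of y k] norm_snd_le[of k y] by auto
    from this[of "L s - L t" "M s - M t" "Y s - Y t" "K s - K t"] c(4)[OF that] show ?thesis by auto
  qed
  obtain Km where Km: "Km > 0" "\<And>a :: bool wien. norm (Mop h a) \<le> norm a * Km"
    using bounded_linear.pos_bounded[OF bounded_linear_Mop[OF h_pos]] by blast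
  \<comment> \<open>Bounds Y and K on the whole interval; the extra summand C lets D serve as
    Lipschitz constant as well.\<close>
  define D where "D = norm (bstar (int n) :: bool wien) + norm (kstar (int n) :: bool wien) + C * \<delta>1 + C"
  have D: "D > 0" using c by (simp add: D_def add_nonneg_pos)
  have bd: "norm (Y s) \<le> D" "norm (K s) \<le> D" if "\<bar>s\<bar> < \<delta>1" for s
  proof -
    have l: "norm (Y s - bstar (int n)) \<le> C * \<bar>s\<bar>" "norm (K s - kstar (int n)) \<le> C * \<bar>s\<bar>"
      using lip[OF that, of 0] c(1,5) by auto
    have "C * \<bar>s\<bar> \<le> C * \<delta>1" using that c by (intro mult_left_mono) auto
    with l show "norm (Y s) \<le> D" "norm (K s) \<le> D"
      unfolding D_def
      using norm_triangle_sub[of "Y s" "bstar (int n)"] norm_triangle_sub[of "K s" "kstar (int n)"]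
        norm_ge_zero[of "bstar (int n) :: bool wien"] norm_ge_zero[of "kstar (int n) :: bool wien"] c(2) by linarith+
  qed
  define \<delta> where "\<delta> = Min {\<delta>1 / 2, 1 / (2 * D), 1 / (2 * D * Km)}"
  have \<delta>: "\<delta> > 0" using c D Km by (simp add: \<delta>_def)
  have "\<delta> \<le> \<delta>1 / 2" "\<delta> \<le> 1 / (2 * D)" "\<delta> \<le> 1 / (2 * D * Km)" unfolding \<delta>_def by (rule Min_le; simp)+
  then have dle: "\<delta> < \<delta>1" "\<delta> * D < 1" "\<delta> * D * Km < 1"
    using c D Km pos_le_divide_eq[of "2 * D" \<delta> 1] pos_le_divide_eq[of "2 * D * Km" \<delta> 1] by (auto simp: mult_ac)
  show ?thesis
  proof (rule that[OF \<delta> D, of L M Y])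
    show "L 0 = l0" "M 0 = 0" "Y 0 = bstar (int n)" using c(5) by auto
    fix s assume s: "\<bar>s\<bar> \<le> \<delta>"
    then have s1: "\<bar>s\<bar> < \<delta>1" using dle by simp
    note cs = c(3)[OF s1]
    show "od (Y s) \<and> norm (Y s) \<le> D" using cs bd[OF s1] by simp
    let ?b = "s *\<^sub>R Y s" and ?k = "s *\<^sub>R K s" and ?w = "Ecos (coef (Nop (s *\<^sub>R Y s)))"
    have o: "od ?b" and e: "evn ?k" using cs by (auto intro: od_arith evn_arith)
    have w: "?w \<in> X_space \<alpha>" by (rule Ecos_X(1)[OF o \<alpha>])
    have cw: "coef ?b = coef (wb ?w)" by (rule coef_wb_Ecos[OF o w, symmetric])
    have P: "Phi (1, L s, s * M s, ?b, ?k) = 0" using cs by (simp only: Phi_scale) simp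
    then have E: "E1 1 ?b ?k = 0" by (simp add: Phi_def zero_prod_def)
    have nb: "norm ?b \<le> \<delta> * D" "norm ?k \<le> \<delta> * D" using s bd[OF s1] \<delta> D by (auto intro!: mult_mono)
    then have "norm ?k < 1" using dle by linarith
    moreover have "norm (Mop h ?b) < 1"
    proof -
      have "norm ?b * Km \<le> \<delta> * D * Km" using nb(1) Km(1) by (intro mult_right_mono) auto
      then show ?thesis using Km(2)[of ?b] dle by linarith
    qed
    ultimately show "(L s, s * M s, ?w) \<in> sols \<alpha>"
      using conf_factor_nonzero[OF \<alpha>(1) w cw e E] F_op_zero_iff[OF \<alpha>(1) w cw e E, of "L s" "s * M s"] P w
      by (simp add: solutions_def del: coef_Nop)
    have "real_of_int (int n) * fourier_cos ?w n / 2 = s * (real_of_int (int n) / 2)"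
      using coef_wb[OF w, of "int n"] fun_cong[OF cw, of "int n"] cs by (auto simp del: coef_Nop)
    then show "fourier_cos ?w n = s" using n by (simp del: coef_Nop)
  next
    fix s t assume st: "\<bar>s\<bar> \<le> \<delta>" "\<bar>t\<bar> \<le> \<delta>"
    have "C * \<bar>s - t\<bar> \<le> D * \<bar>s - t\<bar>" using c(1,2) by (intro mult_right_mono) (auto simp: D_def)
    then show "\<bar>L s - L t\<bar> \<le> D * \<bar>s - t\<bar> \<and> \<bar>M s - M t\<bar> \<le> D * \<bar>s - t\<bar> \<and> norm (Y s - Y t) \<le> D * \<bar>s - t\<bar>"
      using lip[of s t] st dle by auto
  qed
qed

end

section \<open>The product topology\<close>

lemma openin_RRX_box:
  assumes V: "openin (Metric_space.mtopology (X_space \<alpha>) (X_dist \<alpha>)) V"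
  shows "openin (RRX_topology \<alpha>) {(l, m, w). \<bar>l - l0\<bar> < r \<and> \<bar>m\<bar> < r \<and> w \<in> V}"
proof -
  have "{(l, m, w). \<bar>l - l0\<bar> < r \<and> \<bar>m\<bar> < r \<and> w \<in> V} = ball l0 r \<times> (ball 0 r \<times> V)"
    by (auto simp: dist_real_def abs_minus_commute)
  moreover have "openin (RRX_topology \<alpha>) (ball l0 r \<times> (ball 0 r \<times> V))"
    unfolding RRX_topology_def using V by (simp add: openin_prod_Times_iff open_openin[symmetric])
  ultimately show ?thesis by simp
qed

lemma openin_X_small:
  "openin (Metric_space.mtopology (X_space \<alpha>) (X_dist \<alpha>)) {w \<in> X_space \<alpha>. hoelder_norm 2 \<alpha> w < r}"
proof -
  have "{w \<in> X_space \<alpha>. hoelder_norm 2 \<alpha> w < r} = Metric_space.mball (X_space \<alpha>) (X_dist \<alpha>) (\<lambda>x. 0) r"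
    by (auto simp: Metric_space.in_mball[OF Metric_space_X] X_zero X_dist_zero)
  then show ?thesis by (simp add: Metric_space.openin_mball[OF Metric_space_X])
qed

text \<open>A bound on the amplitude has to be part of the neighbourhood U, so that a solution in U
  off the trivial branch belongs to a parameter with |s| < \<epsilon>. This requires the bound to be
  an open condition in X.\<close>

lemma openin_X_fourier:
  "openin (Metric_space.mtopology (X_space \<alpha>) (X_dist \<alpha>)) {w \<in> X_space \<alpha>. \<bar>fourier_cos w n\<bar> < \<epsilon>}"
  unfolding Metric_space.openin_mtopology[OF Metric_space_X]
proof (intro conjI allI impI)
  fix w assume w: "w \<in> {w \<in> X_space \<alpha>. \<bar>fourier_cos w n\<bar> < \<epsilon>}"
  define r where "r = (\<epsilon> - \<bar>fourier_cos w n\<bar>) / 2"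
  have "\<bar>fourier_cos v n\<bar> < \<epsilon>" if "v \<in> X_space \<alpha>" "X_dist \<alpha> w v < r" for v
    using fourier_cos_diff_le[of w \<alpha> v n] w that by (simp add: r_def)
  then have "Metric_space.mball (X_space \<alpha>) (X_dist \<alpha>) w r \<subseteq> {w \<in> X_space \<alpha>. \<bar>fourier_cos w n\<bar> < \<epsilon>}"
    by (auto simp: Metric_space.in_mball[OF Metric_space_X])
  moreover have "r > 0" using w by (simp add: r_def)
  ultimately show "\<exists>r>0. Metric_space.mball (X_space \<alpha>) (X_dist \<alpha>) w r \<subseteq> {w \<in> X_space \<alpha>. \<bar>fourier_cos w n\<bar> < \<epsilon>}"
    by blast
qed auto

lemma Ecos_Nop_diff:
  "(\<lambda>x. Ecos (coef (Nop a)) x - Ecos (coef (Nop b)) x) = Ecos (coef (Nop (a - b :: 'm::finite wien)))"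
  by (simp only: linear_simps[OF bounded_linear_Nop] Ecos_linear fun_eq_iff) simp

lemma X_dist_Ecos:
  fixes a b :: "bool wien"
  assumes "0 < \<alpha>" "\<alpha> < 1" "od a" "od b"
  shows "X_dist \<alpha> (Ecos (coef (Nop a))) (Ecos (coef (Nop b))) \<le> 5 * norm (a - b)"
proof -
  let ?v = "Ecos (coef (Nop a))" and ?w = "Ecos (coef (Nop b))"
  have "?v \<in> X_space \<alpha>" "?w \<in> X_space \<alpha>" by (rule Ecos_X(1)[OF assms(3,1,2)], rule Ecos_X(1)[OF assms(4,1,2)])
  then have "X_dist \<alpha> ?v ?w = hoelder_norm 2 \<alpha> (\<lambda>x. ?v x - ?w x)" by (simp only: X_dist_def if_True simp_thms)
  also have "\<dots> = hoelder_norm 2 \<alpha> (Ecos (coef (Nop (a - b))))"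
    by (rule arg_cong[OF Ecos_Nop_diff])
  also have "\<dots> \<le> 5 * norm (a - b)" by (rule Ecos_X(2)[OF od_arith(2)[OF assms(3,4)] assms(1,2)])
  finally show ?thesis .
qed

lemma (in wave) bifurcation:
  assumes \<alpha>: "0 < \<alpha>" "\<alpha> < 1" and n: "n \<ge> 1" and crit: "\<And>j. symb l0 j = 0 \<longleftrightarrow> \<bar>j\<bar> = int n"
    and trans: "dsymb l0 (int n) \<noteq> 0"
  shows "\<exists>(lam :: real \<Rightarrow> real) (mu :: real \<Rightarrow> real) (w :: real \<Rightarrow> real \<Rightarrow> real).
           continuous_map euclideanreal (RRX_topology \<alpha>) (\<lambda>s. (lam s, mu s, w s)) \<and>
           (\<forall>s. (lam s, mu s, w s) \<in> sols \<alpha>) \<and>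
           (lam 0, mu 0, w 0) = (l0, 0, \<lambda>x. 0) \<and>
           (\<lambda>s. hoelder_norm 2 \<alpha> (\<lambda>x. w s x - s * cos (real n * x))) \<in> o[at 0](\<lambda>s. s) \<and>
           (\<forall>\<^sub>F \<epsilon> in at_right 0. \<exists>U. openin (RRX_topology \<alpha>) U \<and> (l0, 0, \<lambda>x. 0) \<in> U \<and>
              U \<inter> sols \<alpha> = U \<inter> trivial_solutions \<union> (\<lambda>s. (lam s, mu s, w s)) ` {s. \<bar>s\<bar> < \<epsilon>})"
proof -
  obtain r where r: "r > 0"
    "\<And>l m w. (l, m, w) \<in> sols \<alpha> \<Longrightarrow> \<bar>l - l0\<bar> < r \<Longrightarrow> \<bar>m\<bar> < r \<Longrightarrow> hoelder_norm 2 \<alpha> w < r \<Longrightarrow>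
      fourier_cos w n = 0 \<Longrightarrow> m = 0 \<and> w = (\<lambda>x. 0)"
    "\<And>l m w l' m' w'. (l, m, w) \<in> sols \<alpha> \<Longrightarrow> \<bar>l - l0\<bar> < r \<Longrightarrow> \<bar>m\<bar> < r \<Longrightarrow> hoelder_norm 2 \<alpha> w < r \<Longrightarrow>
      (l', m', w') \<in> sols \<alpha> \<Longrightarrow> \<bar>l' - l0\<bar> < r \<Longrightarrow> \<bar>m'\<bar> < r \<Longrightarrow> hoelder_norm 2 \<alpha> w' < r \<Longrightarrow>
      fourier_cos w n = fourier_cos w' n \<Longrightarrow> fourier_cos w n \<noteq> 0 \<Longrightarrow> \<bar>fourier_cos w n\<bar> < r \<Longrightarrow> (l, m, w) = (l', m', w')"
    by (rule critical_solutions_unique[OF \<alpha>(1) n crit trans]) (rule that, assumption+)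
  obtain \<delta> C L M and Y :: "real \<Rightarrow> bool wien" where c: "\<delta> > 0" "C > 0" "L 0 = l0" "M 0 = 0" "Y 0 = bstar (int n)"
    "\<And>s. \<bar>s\<bar> \<le> \<delta> \<Longrightarrow> od (Y s) \<and> norm (Y s) \<le> C"
    "\<And>s. \<bar>s\<bar> \<le> \<delta> \<Longrightarrow> (L s, s * M s, Ecos (coef (Nop (s *\<^sub>R Y s)))) \<in> sols \<alpha>"
    "\<And>s. \<bar>s\<bar> \<le> \<delta> \<Longrightarrow> fourier_cos (Ecos (coef (Nop (s *\<^sub>R Y s)))) n = s"
    "\<And>s t. \<bar>s\<bar> \<le> \<delta> \<Longrightarrow> \<bar>t\<bar> \<le> \<delta> \<Longrightarrow> \<bar>L s - L t\<bar> \<le> C * \<bar>s - t\<bar> \<and> \<bar>M s - M t\<bar> \<le> C * \<bar>s - t\<bar> \<and> norm (Y s - Y t) \<le> C * \<bar>s - t\<bar>"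
    by (rule solution_curve[OF \<alpha> n crit trans]) (rule that, assumption+)
  \<comment> \<open>Clamping extends the local curve to all real s: beyond the endpoints of
    [-\<delta>, \<delta>] it stays at its end values, which are solutions too.\<close>
  define cl where "cl s = max (- \<delta>) (min \<delta> s)" for s
  have cl: "\<bar>cl s\<bar> \<le> \<delta>" for s using c(1) by (auto simp: cl_def)
  have cl_id: "cl s = s" if "\<bar>s\<bar> \<le> \<delta>" for s using that by (auto simp: cl_def)
  have cl_cont: "continuous_on UNIV cl" unfolding cl_def by (intro continuous_intros)
  define W where "W s = Ecos (coef (Nop (s *\<^sub>R Y s)))" for s
  have lipschitz_continuous: "continuous_on {-\<delta>..\<delta>} f"
    if f: "\<And>s t. \<bar>s\<bar> \<le> \<delta> \<Longrightarrow> \<bar>t\<bar> \<le> \<delta> \<Longrightarrow> norm (f s - f t) \<le> C * \<bar>s - t\<bar>" for f :: "real \<Rightarrow> 'z::real_normed_vector"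
  proof (rule continuous_onI)
    fix s e assume s: "s \<in> {-\<delta>..\<delta>}" and e: "(e :: real) > 0"
    have "dist (f t) (f s) \<le> e" if t: "t \<in> {-\<delta>..\<delta>}" "dist t s < e / C" for t
    proof -
      have "norm (f t - f s) \<le> C * \<bar>t - s\<bar>" using s t by (intro f) auto
      moreover have "C * \<bar>t - s\<bar> < e" using t(2) c(2) by (simp add: dist_real_def pos_less_divide_eq mult.commute)
      ultimately show ?thesis by (simp add: dist_norm)
    qed
    then show "\<exists>d>0. \<forall>t\<in>{-\<delta>..\<delta>}. dist t s < d \<longrightarrow> dist (f t) (f s) \<le> e" using e c(2) by (intro exI[of _ "e / C"]) auto
  qed
  have Lc: "continuous_on {-\<delta>..\<delta>} L" by (rule lipschitz_continuous) (use c(9) in auto)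
  have Mc: "continuous_on {-\<delta>..\<delta>} M" by (rule lipschitz_continuous) (use c(9) in auto)
  have Yc: "continuous_on {-\<delta>..\<delta>} Y" by (rule lipschitz_continuous) (use c(9) in auto)
  have comp: "continuous_on UNIV (\<lambda>s. f (cl s))" if "continuous_on {-\<delta>..\<delta>} f" for f :: "real \<Rightarrow> 'z::topological_space"
    by (rule continuous_on_compose2[OF that cl_cont]) (use cl in \<open>auto simp: abs_le_iff minus_le_iff\<close>)
  have odY: "od (s *\<^sub>R Y s)" if "\<bar>s\<bar> \<le> \<delta>" for s using c(6)[OF that] by (simp add: od_arith)
  have WX: "W s \<in> X_space \<alpha>" if "\<bar>s\<bar> \<le> \<delta>" for s
    unfolding W_def by (rule Ecos_X(1)[OF odY[OF that] \<alpha>])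
  have "continuous_on {-\<delta>..\<delta>} (\<lambda>s. s *\<^sub>R Y s)" by (intro continuous_intros Yc)
  from comp[OF this] have yc: "continuous_on UNIV (\<lambda>s. cl s *\<^sub>R Y (cl s))" .
  have Wcont: "continuous_map euclideanreal (Metric_space.mtopology (X_space \<alpha>) (X_dist \<alpha>)) (\<lambda>s. W (cl s))"
    unfolding Metric_space.continuous_map_to_metric[OF Metric_space_X]
  proof (intro ballI allI impI)
    fix s e :: real assume "e > 0"
    then have "e / 5 > 0" by simp
    then obtain d where d: "d > 0" "\<And>t. dist t s < d \<Longrightarrow> dist (cl t *\<^sub>R Y (cl t)) (cl s *\<^sub>R Y (cl s)) < e / 5"
      using yc unfolding continuous_on_iff by (metis UNIV_I)
    have "W (cl t) \<in> Metric_space.mball (X_space \<alpha>) (X_dist \<alpha>) (W (cl s)) e" if "t \<in> ball s d" for t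
    proof -
      have "X_dist \<alpha> (W (cl s)) (W (cl t)) \<le> 5 * norm (cl s *\<^sub>R Y (cl s) - cl t *\<^sub>R Y (cl t))"
        unfolding W_def by (intro X_dist_Ecos \<alpha> odY cl)
      also have "\<dots> < e" using d(2)[of t] that by (simp add: dist_norm norm_minus_commute abs_minus_commute mult.commute)
      finally show ?thesis using WX[OF cl] by (simp add: Metric_space.in_mball[OF Metric_space_X])
    qed
    then show "\<exists>U. openin euclideanreal U \<and> s \<in> U \<and> (\<forall>t\<in>U. W (cl t) \<in> Metric_space.mball (X_space \<alpha>) (X_dist \<alpha>) (W (cl s)) e)"
      using d(1) by (intro exI[of _ "ball s d"]) auto
  qed
  define curve where "curve s = (L (cl s), cl s * M (cl s), W (cl s))" for s
  have W0: "W 0 = (\<lambda>x. 0)"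
    unfolding W_def by (simp only: scaleR_zero_left Nop_linear Ecos_linear fun_eq_iff) simp
  have hW: "hoelder_norm 2 \<alpha> (W s) \<le> 5 * C * \<bar>s\<bar>" if "\<bar>s\<bar> \<le> \<delta>" for s
  proof -
    have "hoelder_norm 2 \<alpha> (W s) \<le> 5 * (\<bar>s\<bar> * norm (Y s))"
      using Ecos_X(2)[OF odY[OF that] \<alpha>] by (simp add: W_def)
    also have "\<dots> \<le> 5 * (\<bar>s\<bar> * C)" using c(6)[OF that] by (intro mult_left_mono) auto
    finally show ?thesis by (simp add: mult_ac)
  qed
  \<comment> \<open>W s - s cos (n x) is represented by s (Y s - bstar), and Y is Lipschitz with
    value bstar at 0, so the remainder is quadratic in s.\<close>
  have asym: "hoelder_norm 2 \<alpha> (\<lambda>x. W s x - s * cos (real n * x)) \<le> 5 * C * \<bar>s\<bar> * \<bar>s\<bar>"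
    "hoelder_norm 2 \<alpha> (\<lambda>x. W s x - s * cos (real n * x)) \<ge> 0" if s: "\<bar>s\<bar> \<le> \<delta>" for s
  proof -
    have "(\<lambda>x. s * cos (real n * x)) = Ecos (coef (Nop (s *\<^sub>R bstar (int n) :: bool wien)))"
      using Nop_bstar[OF n, where 'm = bool] by (simp only: Nop_linear Ecos_linear fun_eq_iff) simp
    then have e: "(\<lambda>x. W s x - s * cos (real n * x)) = Ecos (coef (Nop (s *\<^sub>R (Y s - bstar (int n)))))"
      unfolding W_def scaleR_diff_right Ecos_Nop_diff[symmetric] by (simp only: fun_eq_iff) metis
    have o: "od (s *\<^sub>R (Y s - bstar (int n)))" using c(6)[OF s] by (intro od_arith od_bstar) auto
    have "norm (Y s - bstar (int n)) \<le> C * \<bar>s\<bar>" using c(9)[OF s, of 0] c(1,5) by simp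
    then have "5 * (\<bar>s\<bar> * norm (Y s - bstar (int n))) \<le> 5 * (\<bar>s\<bar> * (C * \<bar>s\<bar>))" by (intro mult_left_mono) auto
    then show "hoelder_norm 2 \<alpha> (\<lambda>x. W s x - s * cos (real n * x)) \<le> 5 * C * \<bar>s\<bar> * \<bar>s\<bar>"
      using Ecos_X(2)[OF o \<alpha>] unfolding e by (simp add: mult_ac)
    show "hoelder_norm 2 \<alpha> (\<lambda>x. W s x - s * cos (real n * x)) \<ge> 0"
      unfolding e using hoelder_norm_ge[OF Ecos_X(1)[OF o \<alpha>], of 0 0] by (meson abs_ge_zero order_trans zero_le)
  qed
  \<comment> \<open>The entries keep s in the domain of the curve, make |s M s| at most C |s|, bound
    the amplitude, and bring L s - l0 and the norm of W s below r.\<close>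
  define \<epsilon>0 where "\<epsilon>0 = Min {\<delta>, 1, r, r / C, r / (5 * C)}"
  have \<epsilon>0: "\<epsilon>0 > 0" using c r by (simp add: \<epsilon>0_def)
  have \<epsilon>0_le: "\<epsilon>0 \<le> \<delta>" "\<epsilon>0 \<le> 1" "\<epsilon>0 \<le> r" "\<epsilon>0 \<le> r / C" "\<epsilon>0 \<le> r / (5 * C)"
    unfolding \<epsilon>0_def by (rule Min_le; simp)+
  have small: "\<bar>L s - l0\<bar> < r" "\<bar>s * M s\<bar> < r" "hoelder_norm 2 \<alpha> (W s) < r" if s: "\<bar>s\<bar> < \<epsilon>0" for s
  proof -
    have sd: "\<bar>s\<bar> \<le> \<delta>" using s \<epsilon>0_le by simp
    have Cs: "C * \<bar>s\<bar> < r" "5 * C * \<bar>s\<bar> < r"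
      using s \<epsilon>0_le c(2) pos_less_divide_eq[of C "\<bar>s\<bar>" r] pos_less_divide_eq[of "5 * C" "\<bar>s\<bar>" r] by (auto simp: mult_ac)
    show "\<bar>L s - l0\<bar> < r" using c(9)[OF sd, of 0] c(1,3) Cs by simp
    have "\<bar>s\<bar> * \<bar>M s\<bar> \<le> 1 * (C * \<bar>s\<bar>)" using c(9)[OF sd, of 0] c(1,4) s \<epsilon>0_le by (intro mult_mono) auto
    then show "\<bar>s * M s\<bar> < r" using Cs by (simp add: abs_mult)
    show "hoelder_norm 2 \<alpha> (W s) < r" using hW[OF sd] Cs by simp
  qed
  have curve_id: "curve s = (L s, s * M s, W s)" if "\<bar>s\<bar> \<le> \<delta>" for s
    using cl_id[OF that] by (simp add: curve_def)
  have W_sol: "(L s, s * M s, W s) \<in> sols \<alpha>" if "\<bar>s\<bar> \<le> \<delta>" for s using c(7)[OF that] by (simp only: W_def)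
  have W_f: "fourier_cos (W s) n = s" if "\<bar>s\<bar> \<le> \<delta>" for s using c(8)[OF that] by (simp only: W_def)
  have local: "\<exists>U. openin (RRX_topology \<alpha>) U \<and> (l0, 0, \<lambda>x. 0) \<in> U \<and>
      U \<inter> sols \<alpha> = U \<inter> trivial_solutions \<union> curve ` {s. \<bar>s\<bar> < \<epsilon>}" if \<epsilon>: "0 < \<epsilon>" "\<epsilon> < \<epsilon>0" for \<epsilon>
  proof -
    let ?V = "{w \<in> X_space \<alpha>. hoelder_norm 2 \<alpha> w < r} \<inter> {w \<in> X_space \<alpha>. \<bar>fourier_cos w n\<bar> < \<epsilon>}"
    let ?U = "{(l, m, w). \<bar>l - l0\<bar> < r \<and> \<bar>m\<bar> < r \<and> w \<in> ?V}"
    have "openin (RRX_topology \<alpha>) ?U"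
      by (intro openin_RRX_box openin_Int openin_X_small openin_X_fourier)
    moreover have "(l0, 0, \<lambda>x. 0) \<in> ?U"
      using r(1) \<epsilon> X_zero hW[of 0] c(1) by (auto simp: W0 fourier_cos_def)
    moreover have "?U \<inter> sols \<alpha> = ?U \<inter> trivial_solutions \<union> curve ` {s. \<bar>s\<bar> < \<epsilon>}"
    proof (intro equalityI subsetI)
      fix p assume p: "p \<in> ?U \<inter> sols \<alpha>"
      obtain l m w where plmw: "p = (l, m, w)" by (cases p) auto
      define s where "s = fourier_cos w n"
      have s: "\<bar>s\<bar> < \<epsilon>" "\<bar>s\<bar> < \<epsilon>0" "\<bar>s\<bar> \<le> \<delta>" "\<bar>s\<bar> < r" using p \<epsilon> \<epsilon>0_le by (auto simp: plmw s_def)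
      have a: "(l, m, w) \<in> sols \<alpha>" "\<bar>l - l0\<bar> < r" "\<bar>m\<bar> < r" "hoelder_norm 2 \<alpha> w < r" using p by (auto simp: plmw)
      show "p \<in> ?U \<inter> trivial_solutions \<union> curve ` {s. \<bar>s\<bar> < \<epsilon>}"
      proof (cases "s = 0")
        case True
        then show ?thesis using r(2)[OF a] p by (auto simp: plmw s_def trivial_solutions_def)
      next
        case False
        have "(l, m, w) = (L s, s * M s, W s)"
          using False s by (intro r(3)[OF a W_sol[OF s(3)] small[OF s(2)]]) (auto simp: W_f s_def)
        then have "p = curve s" using curve_id[OF s(3)] by (simp add: plmw)
        then show ?thesis using s(1) by blast
      qed
    next
      fix p assume "p \<in> ?U \<inter> trivial_solutions \<union> curve ` {s. \<bar>s\<bar> < \<epsilon>}"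
      then consider "p \<in> ?U \<inter> trivial_solutions" | s where "p = curve s" "\<bar>s\<bar> < \<epsilon>" by blast
      then show "p \<in> ?U \<inter> sols \<alpha>"
      proof cases
        case 1
        then show ?thesis using trivial_subset[OF \<alpha>(1)] by blast
      next
        case 2
        then have s: "\<bar>s\<bar> < \<epsilon>0" "\<bar>s\<bar> \<le> \<delta>" using \<epsilon> \<epsilon>0_le by auto
        show ?thesis using W_sol[OF s(2)] small[OF s(1)] WX[OF s(2)] W_f[OF s(2)] 2 by (auto simp: curve_id[OF s(2)])
      qed
    qed
    ultimately show ?thesis by blast
  qed
  show ?thesis
  proof (intro exI conjI)
    show "continuous_map euclideanreal (RRX_topology \<alpha>) (\<lambda>s. (L (cl s), cl s * M (cl s), W (cl s)))"
      unfolding RRX_topology_def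
    proof (intro continuous_map_pairedI Wcont)
      show "continuous_map euclideanreal euclideanreal (\<lambda>s. L (cl s))" using comp[OF Lc] by simp
      show "continuous_map euclideanreal euclideanreal (\<lambda>s. cl s * M (cl s))"
        using continuous_on_mult[OF cl_cont comp[OF Mc]] by simp
    qed
    show "\<forall>s. (L (cl s), cl s * M (cl s), W (cl s)) \<in> sols \<alpha>" using W_sol[OF cl] by blast
    show "(L (cl 0), cl 0 * M (cl 0), W (cl 0)) = (l0, 0, \<lambda>x. 0)" using cl_id[of 0] c(1,3) W0 by simp
    show "(\<lambda>s. hoelder_norm 2 \<alpha> (\<lambda>x. W (cl s) x - s * cos (real n * x))) \<in> o[at 0](\<lambda>s. s)"
    proof (rule landau_o.smallI)
      fix e :: real assume e: "e > 0"
      define d where "d = min \<delta> (e / (5 * C))"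
      have d: "d > 0" using e c by (simp add: d_def)
      have "norm (hoelder_norm 2 \<alpha> (\<lambda>x. W (cl s) x - s * cos (real n * x))) \<le> e * norm s" if "\<bar>s\<bar> < d" for s
      proof -
        have s: "\<bar>s\<bar> \<le> \<delta>" "5 * C * \<bar>s\<bar> \<le> e"
          using that c(2) pos_less_divide_eq[of "5 * C" "\<bar>s\<bar>" e] by (auto simp: d_def mult_ac)
        have "5 * C * \<bar>s\<bar> * \<bar>s\<bar> \<le> e * \<bar>s\<bar>" using s(2) by (intro mult_right_mono) auto
        then show ?thesis using asym[OF s(1)] cl_id[OF s(1)] by simp
      qed
      then show "eventually (\<lambda>s. norm (hoelder_norm 2 \<alpha> (\<lambda>x. W (cl s) x - s * cos (real n * x))) \<le> e * norm s) (at 0)"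
        using d unfolding eventually_at by (intro exI[of _ d]) (auto simp: dist_real_def)
    qed
    show "\<forall>\<^sub>F \<epsilon> in at_right 0. \<exists>U. openin (RRX_topology \<alpha>) U \<and> (l0, 0, \<lambda>x. 0) \<in> U \<and>
        U \<inter> sols \<alpha> = U \<inter> trivial_solutions \<union> (\<lambda>s. (L (cl s), cl s * M (cl s), W (cl s))) ` {s. \<bar>s\<bar> < \<epsilon>}"
      unfolding curve_def[symmetric] eventually_at_right_field using local \<epsilon>0 by blast
  qed
qed

text \<open>Off the bifurcation values the symbol has no zero. At such a value the kernel hypothesis
  leaves n and -n as the only critical modes, and simplicity of the root of the quadratic supplies
  transversality.\<close>

theorem theorem1:
  fixes g h A B \<beta> \<sigma> \<alpha> :: real
  assumes "g > 0" "h > 0" "B > 0" "\<sigma> > 0" "0 < \<alpha>" "\<alpha> < 1"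
  shows
    "(\<forall>lam. lam \<notin> {lam_star g h A B \<beta> \<sigma> n e | n e. n \<ge> 1 \<and> e \<in> {1, -1}} \<longrightarrow>
        (\<exists>U. openin (RRX_topology \<alpha>) U \<and> (lam, 0, \<lambda>x. 0) \<in> U \<and>
             U \<inter> solutions g h A B \<beta> \<sigma> \<alpha> \<subseteq> trivial_solutions)) \<and>
     (\<forall>n::nat. \<forall>e::real. n \<ge> 1 \<and> e \<in> {1, -1} \<and>
        one_dimensional (F_kernel g h A B \<beta> \<sigma> \<alpha> (lam_star g h A B \<beta> \<sigma> n e)) \<longrightarrow>
        (\<exists>(lam :: real \<Rightarrow> real) (mu :: real \<Rightarrow> real) (w :: real \<Rightarrow> real \<Rightarrow> real).
           continuous_map euclideanreal (RRX_topology \<alpha>) (\<lambda>s. (lam s, mu s, w s)) \<and>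
           (\<forall>s. (lam s, mu s, w s) \<in> solutions g h A B \<beta> \<sigma> \<alpha>) \<and>
           (lam 0, mu 0, w 0) = (lam_star g h A B \<beta> \<sigma> n e, 0, \<lambda>x. 0) \<and>
           (\<lambda>s. hoelder_norm 2 \<alpha> (\<lambda>x. w s x - s * cos (real n * x))) \<in> o[at 0](\<lambda>s. s) \<and>
           (\<forall>\<^sub>F \<epsilon> in at_right 0. \<exists>U. openin (RRX_topology \<alpha>) U \<and>
              (lam_star g h A B \<beta> \<sigma> n e, 0, \<lambda>x. 0) \<in> U \<and>
              U \<inter> solutions g h A B \<beta> \<sigma> \<alpha> =
                U \<inter> trivial_solutions \<union> (\<lambda>s. (lam s, mu s, w s)) ` {s. \<bar>s\<bar> < \<epsilon>})))"
proof -
  interpret wave g h A B \<beta> \<sigma> by unfold_locales (rule assms)+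
  note \<alpha> = assms(5,6)
  show ?thesis
  proof (intro conjI allI impI)
    fix lam assume "lam \<notin> {lam_star g h A B \<beta> \<sigma> n e | n e. n \<ge> 1 \<and> e \<in> {1, -1}}"
    from symb_regular[OF this] have reg: "symb lam j \<noteq> 0" for j .
    obtain r where r: "r > 0" "\<And>l m w. (l, m, w) \<in> sols \<alpha> \<Longrightarrow> \<bar>l - lam\<bar> < r \<Longrightarrow> \<bar>m\<bar> < r \<Longrightarrow>
        hoelder_norm 2 \<alpha> w < r \<Longrightarrow> m = 0 \<and> w = (\<lambda>x. 0)"
      using regular_solutions_trivial[OF \<alpha>(1) reg] by metis
    let ?U = "{(l, m, w). \<bar>l - lam\<bar> < r \<and> \<bar>m\<bar> < r \<and> w \<in> {w \<in> X_space \<alpha>. hoelder_norm 2 \<alpha> w < r}}"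
    have z: "hoelder_norm 2 \<alpha> (\<lambda>x. 0) = 0"
      using X_dist_zero[OF X_zero, of \<alpha>] Metric_space.mdist_zero[OF Metric_space_X X_zero, of \<alpha>] by simp
    have "?U \<inter> sols \<alpha> \<subseteq> trivial_solutions"
    proof
      fix p assume p: "p \<in> ?U \<inter> sols \<alpha>"
      obtain l m w where plmw: "p = (l, m, w)" by (cases p) auto
      show "p \<in> trivial_solutions" using p r(2)[of l m w] by (auto simp: plmw trivial_solutions_def)
    qed
    then show "\<exists>U. openin (RRX_topology \<alpha>) U \<and> (lam, 0, \<lambda>x. 0) \<in> U \<and> U \<inter> sols \<alpha> \<subseteq> trivial_solutions"
      using openin_RRX_box[OF openin_X_small, of \<alpha> lam r r] r(1) X_zero z by (intro exI[of _ ?U]) auto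
  next
    fix n :: nat and e :: real
    assume a: "n \<ge> 1 \<and> e \<in> {1, -1} \<and> one_dimensional (F_kernel g h A B \<beta> \<sigma> \<alpha> (lam_star g h A B \<beta> \<sigma> n e))"
    then have n: "n \<ge> 1" "e \<in> {1, -1}" and one: "one_dimensional (F_kernel g h A B \<beta> \<sigma> \<alpha> (lam_star g h A B \<beta> \<sigma> n e))"
      by blast+
    show "\<exists>(lam :: real \<Rightarrow> real) (mu :: real \<Rightarrow> real) (w :: real \<Rightarrow> real \<Rightarrow> real).
           continuous_map euclideanreal (RRX_topology \<alpha>) (\<lambda>s. (lam s, mu s, w s)) \<and>
           (\<forall>s. (lam s, mu s, w s) \<in> sols \<alpha>) \<and>
           (lam 0, mu 0, w 0) = (lam_star g h A B \<beta> \<sigma> n e, 0, \<lambda>x. 0) \<and>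
           (\<lambda>s. hoelder_norm 2 \<alpha> (\<lambda>x. w s x - s * cos (real n * x))) \<in> o[at 0](\<lambda>s. s) \<and>
           (\<forall>\<^sub>F \<epsilon> in at_right 0. \<exists>U. openin (RRX_topology \<alpha>) U \<and>
              (lam_star g h A B \<beta> \<sigma> n e, 0, \<lambda>x. 0) \<in> U \<and>
              U \<inter> sols \<alpha> = U \<inter> trivial_solutions \<union> (\<lambda>s. (lam s, mu s, w s)) ` {s. \<bar>s\<bar> < \<epsilon>})"
      by (rule bifurcation[OF \<alpha> n(1) symb_critical[OF \<alpha> n one] dsymb_nonzero[OF n]])
  qed
qed

end
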